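(* Let $n\ge 2$. If $A\subseteq\mathfrak{S}_n$ is Schur-positive and invariant under horizontal rotation (i.e. $A=Ac_n$), then $A$ is cyclic Schur-positive.
   Context: Permutations are in one-line notation, composed right to left; $c_n=(1,2,\dots,n)=23\cdots n1$ and $Ac_n=\{\sigma c_n:\sigma\in A\}$. For $\pi\in\mathfrak{S}_n$, $\mathrm{Des}(\pi)=\{i\in[n-1]:\pi(i)>\pi(i+1)\}$, $\mathrm{cDes}(\pi)=\{i\in[n]:\pi(i)>\pi(i+1)\}$ with $\pi(n+1):=\pi(1)$. $\mathbf{x}^J=\prod_{i\in J}x_i$; $i+J=\{i+j\bmod n:j\in J\}\subseteq[n]$. Schur-positive: $\sum_{\pi\in A}\mathcal{F}_{n,\mathrm{Des}(\pi)}$ is symmetric and Schur-nonnegative, where $\mathcal{F}_{n,D}=\sum x_{i_1}\cdots x_{i_n}$ over $i_1\le\cdots\le i_n$ with $i_j<i_{j+1}$ for $j\in D$. Cyclic Schur-positive: for a skew shape $\lambda/\mu$ with $n$ cells, $\mathrm{Des}(T)$ for $T\in\mathrm{SYT}(\lambda/\mu)$ is the set of $i\in[n-1]$ with $i+1$ in a strictly lower row than $i$. A cyclic descent extension on $\mathrm{SYT}(\lambda/\mu)$ is a pair $(\mathrm{cDes},\psi)$ with $\mathrm{cDes}(T)\cap[n-1]=\mathrm{Des}(T)$, $\mathrm{cDes}(\psi T)=1+\mathrm{cDes}(T)$, $\emptyset\ne\mathrm{cDes}(T)\ne[n]$ ($\psi$ a bijection); it exists iff $\lambda/\mu$ is not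 a connected ribbon, and $\sum_T\mathbf{x}^{\mathrm{cDes}(T)}$ is independent of the choice. $A$ is cyclic Schur-positive if $\sum_{\pi\in A}\mathbf{x}^{\mathrm{cDes}(\pi)}=\sum m_{\lambda/\mu}\sum_{T\in\mathrm{SYT}(\lambda/\mu)}\mathbf{x}^{\mathrm{cDes}(T)}$ for some nonnegative integers $m_{\lambda/\mu}$ indexed by skew shapes with $n$ cells that are not connected ribbons. *)

theory Defs
  imports "HOL-Combinatorics.Combinatorics"
begin

text \<open>Permutations of [n] are functions nat => nat permuting {1..n}; one-line notation
  pi = pi(1) pi(2) ... pi(n).  Composition is right to left (function composition).\<close>

definition cyc :: "nat \<Rightarrow> nat \<Rightarrow> nat" where
  "cyc n i = (if i \<in> {1..<n} then i + 1 else if i = n then 1 else i)"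

definition Des :: "nat \<Rightarrow> (nat \<Rightarrow> nat) \<Rightarrow> nat set" where
  "Des n \<pi> = {i \<in> {1..<n}. \<pi> i > \<pi> (i + 1)}"

definition cDes :: "nat \<Rightarrow> (nat \<Rightarrow> nat) \<Rightarrow> nat set" where
  "cDes n \<pi> = {i \<in> {1..n}. \<pi> i > \<pi> (if i = n then 1 else i + 1)}"

text \<open>1 + J (mod n), with representatives in [n].\<close>
definition cshift :: "nat \<Rightarrow> nat set \<Rightarrow> nat set" where
  "cshift n J = (\<lambda>j. j mod n + 1) ` J"

text \<open>Homogeneous formal power series in variables x_1, x_2, ... with integer coefficients
  are represented by their coefficient function on exponent vectors e :: nat => nat
  (e k = exponent of x_k; the component e 0 is unused, a monomial involving it has
  coefficient 0).\<close>

type_synonym sfun = "(nat \<Rightarrow> nat) \<Rightarrow> int"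

definition content_of_list :: "nat list \<Rightarrow> nat \<Rightarrow> nat" where
  "content_of_list w k = count_list w k"

text \<open>Fundamental quasisymmetric function F_{n,D}: sum of x_{i_1}...x_{i_n} over
  1 <= i_1 <= ... <= i_n with i_j < i_{j+1} for j in D.\<close>
definition Fund :: "nat \<Rightarrow> nat set \<Rightarrow> sfun" where
  "Fund n D e = int (card {w :: nat list. length w = n \<and> (\<forall>k\<in>set w. 1 \<le> k) \<and> sorted w
       \<and> (\<forall>j\<in>D. 1 \<le> j \<and> j < n \<longrightarrow> w ! (j - 1) < w ! j)
       \<and> content_of_list w = e})"

definition symmetric_fun :: "sfun \<Rightarrow> bool" where
  "symmetric_fun f \<longleftrightarrow> (\<forall>\<tau> e. \<tau> permutes {1..} \<longrightarrow> f (e \<circ> \<tau>) = f e)"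

definition is_partition :: "nat list \<Rightarrow> bool" where
  "is_partition la \<longleftrightarrow> sorted_wrt (\<ge>) la \<and> (\<forall>x\<in>set la. 0 < x)"

text \<open>Cells of the skew diagram lambda/mu: (row, column), 0-indexed, rows going down.\<close>
definition skew_cells :: "nat list \<Rightarrow> nat list \<Rightarrow> (nat \<times> nat) set" where
  "skew_cells la mu = {(i, j). i < length la \<and> (if i < length mu then mu ! i else 0) \<le> j \<and> j < la ! i}"

definition is_skew_shape :: "nat list \<Rightarrow> nat list \<Rightarrow> bool" where
  "is_skew_shape la mu \<longleftrightarrow> is_partition la \<and> is_partition mu \<and> length mu \<le> length la
     \<and> (\<forall>i < length mu. mu ! i \<le> la ! i)"

definition SSYT :: "nat list \<Rightarrow> ((nat \<times> nat) \<Rightarrow> nat) set" where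
  "SSYT la = {T. (\<forall>c. c \<notin> skew_cells la [] \<longrightarrow> T c = 0)
      \<and> (\<forall>c\<in>skew_cells la []. 1 \<le> T c)
      \<and> (\<forall>i j. (i, j) \<in> skew_cells la [] \<and> (i, j + 1) \<in> skew_cells la [] \<longrightarrow> T (i, j) \<le> T (i, j + 1))
      \<and> (\<forall>i j. (i, j) \<in> skew_cells la [] \<and> (i + 1, j) \<in> skew_cells la [] \<longrightarrow> T (i, j) < T (i + 1, j))}"

definition schur :: "nat list \<Rightarrow> sfun" where
  "schur la e = int (card {T \<in> SSYT la. \<forall>k. card {c \<in> skew_cells la []. T c = k} = e k})"

definition schur_nonneg :: "sfun \<Rightarrow> bool" where
  "schur_nonneg f \<longleftrightarrow> (\<exists>P (c :: nat list \<Rightarrow> nat). finite P \<and> (\<forall>la\<in>P. is_partition la)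
       \<and> f = (\<lambda>e. \<Sum>la\<in>P. int (c la) * schur la e))"

definition schur_positive :: "nat \<Rightarrow> (nat \<Rightarrow> nat) set \<Rightarrow> bool" where
  "schur_positive n A \<longleftrightarrow>
     (let f = (\<lambda>e. \<Sum>\<pi>\<in>A. Fund n (Des n \<pi>) e) in symmetric_fun f \<and> schur_nonneg f)"

definition SYT :: "nat list \<Rightarrow> nat list \<Rightarrow> ((nat \<times> nat) \<Rightarrow> nat) set" where
  "SYT la mu = {T. bij_betw T (skew_cells la mu) {1..card (skew_cells la mu)}
      \<and> (\<forall>c. c \<notin> skew_cells la mu \<longrightarrow> T c = 0)
      \<and> (\<forall>i j. (i, j) \<in> skew_cells la mu \<and> (i, j + 1) \<in> skew_cells la mu \<longrightarrow> T (i, j) < T (i, j + 1))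
      \<and> (\<forall>i j. (i, j) \<in> skew_cells la mu \<and> (i + 1, j) \<in> skew_cells la mu \<longrightarrow> T (i, j) < T (i + 1, j))}"

definition row_of :: "nat list \<Rightarrow> nat list \<Rightarrow> ((nat \<times> nat) \<Rightarrow> nat) \<Rightarrow> nat \<Rightarrow> nat" where
  "row_of la mu T k = fst (inv_into (skew_cells la mu) T k)"

definition DesT :: "nat list \<Rightarrow> nat list \<Rightarrow> ((nat \<times> nat) \<Rightarrow> nat) \<Rightarrow> nat set" where
  "DesT la mu T = {i \<in> {1..<card (skew_cells la mu)}. row_of la mu T (i + 1) > row_of la mu T i}"

definition cell_adj :: "nat \<times> nat \<Rightarrow> nat \<times> nat \<Rightarrow> bool" where
  "cell_adj c d \<longleftrightarrow> (fst c = fst d \<and> (snd d = snd c + 1 \<or> snd c = snd d + 1))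
                   \<or> (snd c = snd d \<and> (fst d = fst c + 1 \<or> fst c = fst d + 1))"

definition connected_ribbon :: "nat list \<Rightarrow> nat list \<Rightarrow> bool" where
  "connected_ribbon la mu \<longleftrightarrow>
     (let C = skew_cells la mu in
        C \<noteq> {}
      \<and> (\<forall>c\<in>C. \<forall>d\<in>C. (\<lambda>x y. x \<in> C \<and> y \<in> C \<and> cell_adj x y)\<^sup>*\<^sup>* c d)
      \<and> \<not> (\<exists>i j. (i, j) \<in> C \<and> (i + 1, j) \<in> C \<and> (i, j + 1) \<in> C \<and> (i + 1, j + 1) \<in> C))"

definition cyclic_descent_ext ::
  "nat list \<Rightarrow> nat list \<Rightarrow> (((nat \<times> nat) \<Rightarrow> nat) \<Rightarrow> nat set)
     \<Rightarrow> (((nat \<times> nat) \<Rightarrow> nat) \<Rightarrow> ((nat \<times> nat) \<Rightarrow> nat)) \<Rightarrow> bool" where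
  "cyclic_descent_ext la mu cD \<psi> \<longleftrightarrow>
     (let n = card (skew_cells la mu) in
        bij_betw \<psi> (SYT la mu) (SYT la mu)
      \<and> (\<forall>T\<in>SYT la mu. cD T \<subseteq> {1..n}
           \<and> cD T \<inter> {1..<n} = DesT la mu T
           \<and> cD (\<psi> T) = cshift n (cD T)
           \<and> cD T \<noteq> {} \<and> cD T \<noteq> {1..n}))"

text \<open>Cyclic Schur-positivity: comparing coefficients of the squarefree monomials x^J.\<close>
definition cyclic_schur_positive :: "nat \<Rightarrow> (nat \<Rightarrow> nat) set \<Rightarrow> bool" where
  "cyclic_schur_positive n A \<longleftrightarrow>
     (\<exists>S (m :: nat list \<times> nat list \<Rightarrow> nat) cD \<psi>. finite S
        \<and> (\<forall>(la, mu)\<in>S. is_skew_shape la mu \<and> card (skew_cells la mu) = n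
              \<and> \<not> connected_ribbon la mu \<and> cyclic_descent_ext la mu (cD (la, mu)) (\<psi> (la, mu)))
        \<and> (\<forall>J. card {\<pi> \<in> A. cDes n \<pi> = J}
               = (\<Sum>(la, mu)\<in>S. m (la, mu) * card {T \<in> SYT la mu. cD (la, mu) T = J})))"

end

theory Submission
  imports Defs "HOL-Library.Function_Algebras"
begin

text \<open>
  Expanding the quasisymmetric function of A into Schur functions shows that the descent sets of A
  are distributed like those of a multiset of straight standard tableaux.  A rotation-invariant
  refinement of a distribution of descent sets to cyclic descent sets, in which the empty set does
  not occur, is unique.  It therefore suffices to refine the tableaux side, with nonnegative numbers.

  For a partition of n that is not a hook, let \<open>V\<close> be Young's seminormal representation of the symmetric
  group, \<open>U\<^sub>i\<close> the fixed space of the transposition \<open>(i, i + 1)\<close> for \<open>i < n\<close> and \<open>U\<^sub>n\<close> that of \<open>(n, 1)\<close>.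
  The n-cycle permutes the \<open>U\<^sub>i\<close> cyclically.  Let \<open>W J\<close> be the intersection of the \<open>U\<^sub>i\<close> with \<open>i\<close> outside \<open>J\<close>.
  The number of tableaux with cyclic descent set \<open>J\<close> is defined to be the dimension of \<open>W J\<close> modulo
  the sum of the \<open>W (J - {j})\<close>.  Any \<open>n - 1\<close> of the \<open>U\<^sub>i\<close> have a common adapted basis, indexed by the
  tableaux and their descent sets.  Hence these dimensions refine the descent distribution as soon as
  the relations between the subspaces \<open>W (J - {j})\<close> are the trivial ones.  Whether this holds depends
  only on the size of \<open>J\<close>, and for a cyclic interval it holds because no tableau of a shape
  containing a 2 by 2 square has an initial interval as its descent set.

  For hooks the descent distribution depends only on the size of the descent set.  What
  remains of A after removing the other shapes is thus distributed according to the size of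
  the cyclic descent set, which is what the disconnected shapes formed by a row and a column realise;
  the multiplicities are nonnegative because the other shapes do not contribute to initial intervals.
\<close>

section \<open>Finite-dimensional subspaces\<close>

text \<open>A basis adapted to all \<open>n\<close> subspaces at once would label its vectors by
  cyclic descent sets, but adapted bases are only available when one subspace is omitted. Quotient
  dimensions take their place. The identity required of them, \<open>g D + g (insert n D)\<close> =
  number of basis vectors labelled \<open>D\<close>, reduces by the dimension formula to the claim
  that \<open>W D\<close> meets the sum of the \<open>W (insert n (D - {j}))\<close> only in
  \<open>W' D\<close>. An element of that intersection is a relation on \<open>insert n D\<close>;
  trivial relations are those given by antisymmetric arrays, as in the lowest place of a Koszul
  complex. For the families with one subspace omitted this complex splits along the adapted basis
  into complexes of full simplices. Their exactness in two consecutive degrees lets triviality pass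
  from \<open>J\<close> to any set obtained by exchanging one element.

  Hooks are treated apart because initial intervals do occur among their descent sets, so the
  starting case of the exchange is missing. The transposition \<open>(n, 1)\<close> is never
  constructed: its fixed space is defined as the image of that of the last generator under a Coxeter
  element, so that only Coxeter relations have to be verified.\<close>

context vector_space
begin

text \<open>The finite spanning set \<open>F\<close> matters: \<open>dim\<close> of an
  infinite-dimensional set is 0, so monotonicity fails in general.\<close>

lemma dim_mono_finite:
  assumes "A \<subseteq> span C" "C \<subseteq> span F" "finite F"
  shows "dim A \<le> dim C"
proof -
  obtain B where B: "B \<subseteq> C" "independent B" "C \<subseteq> span B" "card B = dim C"
    using basis_exists by blast
  have "finite B"
    using independent_span_bound[OF \<open>finite F\<close> B(2)] B(1) assms(2) by blast
  moreover have "A \<subseteq> span B"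
    using assms(1) B(3) span_minimal[of C "span B"] subspace_span by blast
  ultimately show ?thesis
    using dim_le_card[of A B] B(4) by simp
qed

text \<open>A basis of the intersection is extended to a basis of \<open>A\<close> and to one of
  \<open>C\<close>; the union of the two is a basis of the sum.\<close>

lemma dim_Un_Int_finite:
  assumes A: "subspace A" and C: "subspace C"
    and AF: "A \<subseteq> span F" and CF: "C \<subseteq> span F" and F: "finite F"
  shows "dim (A \<union> C) + dim (A \<inter> C) = dim A + dim C"
proof -
  obtain I where I: "I \<subseteq> A \<inter> C" "independent I" "A \<inter> C \<subseteq> span I"
    by (rule basis_exists[of "A \<inter> C"])
  obtain BA where BA: "I \<subseteq> BA" "BA \<subseteq> A" "independent BA" "A \<subseteq> span BA"
    by (rule maximal_independent_subset_extend[of I A]) (use I in auto)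
  obtain BC where BC: "I \<subseteq> BC" "BC \<subseteq> C" "independent BC" "C \<subseteq> span BC"
    by (rule maximal_independent_subset_extend[of I C]) (use I in auto)
  have fin: "finite BA" "finite BC"
    using independent_span_bound[OF F BA(3)] independent_span_bound[OF F BC(3)]
      BA(2) BC(2) AF CF by blast+
  have spA: "span BA = A" using BA A span_subspace by blast
  \<comment> \<open>The vectors of \<open>BC - I\<close> are added to \<open>BA\<close> one by one.
    A dependence would put the new vector, up to earlier ones, into \<open>A \<inter> C\<close>,
    hence into the span of \<open>I\<close>, against independence of \<open>BC\<close>.\<close>
  have ind: "independent (BA \<union> X) \<and> BA \<inter> X = {}" if "X \<subseteq> BC - I" for X
  proof -
    have "finite X" using that fin(2) finite_subset by blast
    then show ?thesis using that
    proof (induction X rule: finite_induct)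
      case empty then show ?case using BA(3) by simp
    next
      case (insert e X)
      have "e \<notin> span (BA \<union> X)"
      proof
        assume "e \<in> span (BA \<union> X)"
        then obtain a x where ax: "e = a + x" "a \<in> span BA" "x \<in> span X"
          unfolding span_Un by auto
        have "x \<in> C" using ax(3) insert.prems BC(2) C span_minimal[of X C] by blast
        moreover have "e \<in> C" using insert.prems BC(2) by blast
        ultimately have "a \<in> A \<inter> C"
          using ax(1,2) spA subspace_diff[OF C, of e x] by (simp add: algebra_simps)
        then have "a \<in> span (I \<union> X)" using I(3) span_mono[of I "I \<union> X"] by blast
        moreover have "x \<in> span (I \<union> X)" using ax(3) span_mono[of X "I \<union> X"] by blast
        ultimately have "e \<in> span (I \<union> X)" unfolding ax(1) by (rule span_add)
        moreover have "I \<union> X \<subseteq> BC - {e}" using insert BC(1) by blast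
        ultimately have "e \<in> span (BC - {e})" using span_mono by blast
        then show False using BC(3) insert.prems unfolding dependent_def by blast
      qed
      moreover have "independent (BA \<union> X)" using insert by blast
      ultimately have "independent (insert e (BA \<union> X))" by (simp add: independent_insertI)
      moreover have "e \<notin> BA" using \<open>e \<notin> span (BA \<union> X)\<close> span_base by blast
      ultimately show ?case using insert by auto
    qed
  qed
  have "BA \<union> (BC - I) = BA \<union> BC" using BA(1) by blast
  then have i2: "independent (BA \<union> BC)" "BA \<inter> (BC - I) = {}" using ind[of "BC - I"] by auto
  have "A \<union> C \<subseteq> span (BA \<union> BC)"
    using BA(4) BC(4) span_mono[of BA "BA \<union> BC"] span_mono[of BC "BA \<union> BC"] by blast
  then have "card (BA \<union> BC) = dim (A \<union> C)"
    using basis_card_eq_dim[of "BA \<union> BC" "A \<union> C"] i2(1) BA(2) BC(2) by blast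
  moreover have "card BA = dim A" "card BC = dim C" "card I = dim (A \<inter> C)"
    using basis_card_eq_dim BA BC I by blast+
  moreover have "BA \<inter> BC = I" using i2(2) BA(1) BC(1) by blast
  ultimately show ?thesis using card_Un_Int[OF fin] by simp
qed

lemma dim_image_linear_inj:
  assumes "Vector_Spaces.linear scale scale c" "inj_on c (span A)"
  shows "dim (c ` A) = dim A"
proof -
  interpret vector_space_pair scale scale ..
  obtain B where B: "B \<subseteq> A" "independent B" "A \<subseteq> span B" "card B = dim A"
    using basis_exists by blast
  have sub: "span B \<subseteq> span A" using B(1) by (rule span_mono)
  have "independent (c ` B)"
    by (intro linear_independent_injective_image[OF assms(1) B(2)] inj_on_subset[OF assms(2) sub])
  moreover have "c ` A \<subseteq> span (c ` B)"
    unfolding linear_span_image[OF assms(1)] using B(3) by (rule image_mono)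
  ultimately have "card (c ` B) = dim (c ` A)"
    using basis_card_eq_dim[of "c ` B" "c ` A"] B(1) by blast
  moreover have "inj_on c B"
    by (rule inj_on_subset[OF assms(2)]) (use sub span_superset[of B] in blast)
  ultimately show ?thesis using B(4) card_image[of c B] by simp
qed

end

section \<open>Cyclic families of subspaces\<close>

definition csucc :: "nat \<Rightarrow> nat \<Rightarrow> nat" where
  "csucc n j = j mod n + 1"

lemma cshift_eq_image_csucc: "cshift n J = csucc n ` J"
  by (simp add: cshift_def csucc_def)

lemma csucc_less: "1 \<le> j \<Longrightarrow> j < n \<Longrightarrow> csucc n j = j + 1"
  by (simp add: csucc_def)

lemma csucc_self: "csucc n n = 1"
  by (simp add: csucc_def)

lemma bij_betw_csucc: "bij_betw (csucc n) {1..n} {1..n}"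
proof -
  have csucc_if: "csucc n j = (if j < n then j + 1 else 1)" if "j \<in> {1..n}" for j
  proof (cases "j < n")
    case False
    then have "j = n" using that by simp
    then show ?thesis by (simp add: csucc_self)
  qed (use that in \<open>simp add: csucc_less\<close>)
  have "inj_on (csucc n) {1..n}"
  proof (rule inj_onI)
    fix i j assume ij: "i \<in> {1..n}" "j \<in> {1..n}" "csucc n i = csucc n j"
    have "(if i < n then i + 1 else 1) = (if j < n then j + 1 else 1)"
      using csucc_if[OF ij(1)] csucc_if[OF ij(2)] ij(3) by metis
    then show "i = j" using ij(1,2) unfolding atLeastAtMost_iff by presburger
  qed
  moreover have "csucc n ` {1..n} \<subseteq> {1..n}"
  proof
    fix i assume "i \<in> csucc n ` {1..n}"
    then obtain j where j: "j \<in> {1..n}" "i = csucc n j" by blast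
    then show "i \<in> {1..n}" using csucc_if[OF j(1)] by auto
  qed
  ultimately show ?thesis
    using endo_inj_surj[of "{1..n}" "csucc n"] by (simp add: bij_betw_def)
qed

lemma inj_on_csucc: "inj_on (csucc n) {1..n}"
  and image_csucc: "csucc n ` {1..n} = {1..n}"
  using bij_betw_csucc[of n] by (auto simp: bij_betw_def)

text \<open>The induction starts at \<open>n\<close> because the adapted basis and the splitting
  identities are given there; rotation then reaches 1, 2 and so on.\<close>

lemma cyclic_induct [consumes 1, case_names last step]:
  assumes "v \<in> {1..n}" "P n" "\<And>v. v \<in> {1..n} \<Longrightarrow> P v \<Longrightarrow> P (csucc n v)"
  shows "P v"
proof -
  have "1 \<le> v \<Longrightarrow> v \<le> n \<Longrightarrow> P v"
  proof (induction v rule: nat_induct_at_least)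
    case base
    then show ?case using assms(2) assms(3)[of n] by (simp add: csucc_self)
  next
    case (Suc v)
    then show ?case using assms(3)[of v] by (simp add: csucc_less)
  qed
  then show ?thesis using assms(1) by simp
qed

section \<open>Subspaces permuted cyclically by a linear map\<close>

text \<open>In the application \<open>c\<close> is the Coxeter element and \<open>L\<close> gives
  the descent set of a tableau. \<open>V\<close> is a subset rather than the whole type because the
  operators used later are defined on all functions but invertible only on \<open>V\<close>.\<close>

locale cyclic_subspaces = vector_space scale
  for scale :: "'a::field \<Rightarrow> 'b::ab_group_add \<Rightarrow> 'b" +
  fixes n :: nat and V :: "'b set" and U :: "nat \<Rightarrow> 'b set" and c :: "'b \<Rightarrow> 'b"
    and B :: "'b set" and L :: "'b \<Rightarrow> nat set"
  assumes n_pos: "0 < n"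
    and finite_B: "finite B" and independent_B: "independent B" and span_B: "span B = V"
    and subspace_U: "\<And>i. i \<in> {1..n} \<Longrightarrow> subspace (U i)"
    and U_subset: "\<And>i. i \<in> {1..n} \<Longrightarrow> U i \<subseteq> V"
    and linear_c: "Vector_Spaces.linear scale scale c"
    and inj_c: "inj_on c V" and image_c: "c ` V = V"
    and image_c_U: "\<And>i. i \<in> {1..n} \<Longrightarrow> c ` U i = U (csucc n i)"
    and L_subset: "\<And>b. b \<in> B \<Longrightarrow> L b \<subseteq> {1..n} - {n}"
    and adapted_B: "\<And>D. D \<subseteq> {1..n} - {n} \<Longrightarrow>
       V \<inter> (\<Inter>i\<in>{1..n} - insert n D. U i) = span {b \<in> B. L b \<subseteq> D}"
begin

definition W :: "nat set \<Rightarrow> 'b set" where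
  "W J = V \<inter> (\<Inter>i\<in>{1..n} - J. U i)"

definition W' :: "nat set \<Rightarrow> 'b set" where
  "W' J = span (\<Union>j\<in>J. W (J - {j}))"

text \<open>The subtraction does not truncate, since \<open>W' J\<close> is contained in the
  finite-dimensional space \<open>W J\<close>.\<close>

definition g :: "nat set \<Rightarrow> nat" where
  "g J = dim (W J) - dim (W' J)"

lemma subspace_V: "subspace V"
  using span_B subspace_span by metis

lemma subspace_W: "subspace (W J)"
proof -
  have "\<forall>S\<in>U ` ({1..n} - J). subspace S" using subspace_U by blast
  then show ?thesis unfolding W_def by (intro subspace_inter subspace_Inter subspace_V)
qed

lemma subspace_W': "subspace (W' J)"
  unfolding W'_def by (rule subspace_span)

lemma W_mono: "I \<subseteq> J \<Longrightarrow> W I \<subseteq> W J"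
  unfolding W_def by blast

lemma W_subset: "W J \<subseteq> span B"
  unfolding W_def span_B by blast

lemma W_subset_V: "W J \<subseteq> V"
  unfolding W_def by blast

lemma W'_subset: "W' J \<subseteq> W J"
  unfolding W'_def
  by (intro span_minimal subspace_W UN_least W_mono) blast

lemma image_c_W:
  assumes "J \<subseteq> {1..n}"
  shows "c ` W J = W (cshift n J)"
proof -
  have "c ` W J = V \<inter> (\<Inter>i\<in>{1..n} - J. U (csucc n i))"
  proof (intro equalityI subsetI)
    fix y assume "y \<in> c ` W J"
    then show "y \<in> V \<inter> (\<Inter>i\<in>{1..n} - J. U (csucc n i))"
      unfolding W_def using image_c image_c_U by blast
  next
    fix y assume y: "y \<in> V \<inter> (\<Inter>i\<in>{1..n} - J. U (csucc n i))"
    then obtain x where x: "x \<in> V" "y = c x" using image_c by blast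
    have "x \<in> U i" if "i \<in> {1..n} - J" for i
    proof -
      have "c x \<in> c ` U i" using y x that image_c_U by auto
      then show ?thesis using inj_onD[OF inj_c] x(1) U_subset[of i] that by blast
    qed
    then show "y \<in> c ` W J" unfolding W_def using x by blast
  qed
  also have "\<dots> = V \<inter> (\<Inter>i\<in>csucc n ` ({1..n} - J). U i)" by simp
  also have "csucc n ` ({1..n} - J) = {1..n} - csucc n ` J"
    using assms inj_on_image_set_diff[OF inj_on_csucc[of n], of "{1..n}" J] image_csucc[of n] by simp
  finally show ?thesis unfolding W_def cshift_eq_image_csucc .
qed

lemma cshift_Diff:
  "J \<subseteq> {1..n} \<Longrightarrow> K \<subseteq> {1..n} \<Longrightarrow> cshift n (J - K) = cshift n J - cshift n K"
  unfolding cshift_eq_image_csucc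
  using inj_on_image_set_diff[OF inj_on_csucc[of n], of J K] by blast

lemma image_c_span: "c ` span S = span (c ` S)"
proof -
  interpret vector_space_pair scale scale ..
  show ?thesis by (rule linear_span_image[OF linear_c, symmetric])
qed

lemma image_c_W':
  assumes "J \<subseteq> {1..n}"
  shows "c ` W' J = W' (cshift n J)"
proof -
  have "c ` W' J = span (\<Union>j\<in>J. c ` W (J - {j}))"
    unfolding W'_def image_c_span image_UN ..
  also have "(\<Union>j\<in>J. c ` W (J - {j})) = (\<Union>j\<in>J. W (cshift n J - {csucc n j}))"
  proof (intro SUP_cong refl)
    fix j assume "j \<in> J"
    then have "{j} \<subseteq> {1..n}" "J - {j} \<subseteq> {1..n}" using assms by auto
    then show "c ` W (J - {j}) = W (cshift n J - {csucc n j})"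
      using image_c_W cshift_Diff[OF assms, of "{j}"] by (simp add: cshift_eq_image_csucc)
  qed
  also have "\<dots> = (\<Union>j\<in>cshift n J. W (cshift n J - {j}))"
    by (simp add: cshift_eq_image_csucc)
  finally show ?thesis unfolding W'_def .
qed

lemma dim_image_c: "S \<subseteq> V \<Longrightarrow> dim (c ` S) = dim S"
  by (intro dim_image_linear_inj[OF linear_c] inj_on_subset[OF inj_c] span_minimal subspace_V)

lemma g_cshift:
  assumes "J \<subseteq> {1..n}"
  shows "g (cshift n J) = g J"
  unfolding g_def image_c_W[OF assms, symmetric] image_c_W'[OF assms, symmetric]
  using dim_image_c[OF W_subset_V] dim_image_c[OF order_trans[OF W'_subset W_subset_V]] by simp

section \<open>Adapted bases for the family cut at an arbitrary index\<close>

definition adapted :: "nat \<Rightarrow> 'b set \<Rightarrow> ('b \<Rightarrow> nat set) \<Rightarrow> bool" where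
  "adapted v C M \<longleftrightarrow> finite C \<and> independent C \<and> span C = V
     \<and> (\<forall>b\<in>C. M b \<subseteq> {1..n} - {v})
     \<and> (\<forall>D\<subseteq>{1..n} - {v}. W (insert v D) = span {b \<in> C. M b \<subseteq> D})"

text \<open>The basis given for the cut at \<open>n\<close> is carried around the cycle by
  \<open>c\<close>, and its labels are rotated along with it.\<close>

lemma adapted_exists:
  assumes "v \<in> {1..n}"
  shows "\<exists>C M. adapted v C M"
proof (rule cyclic_induct[where P = "\<lambda>v. \<exists>C M. adapted v C M", OF assms])
  have "adapted n B L"
    unfolding adapted_def W_def
    by (intro conjI allI ballI impI finite_B independent_B span_B L_subset adapted_B)
  then show "\<exists>C M. adapted n C M" by (intro exI)
next
  fix v assume v: "v \<in> {1..n}" and "\<exists>C M. adapted v C M"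
  then obtain C M where CM: "adapted v C M" by (elim exE)
  interpret vector_space_pair scale scale ..
  have CV: "C \<subseteq> V" using CM span_superset unfolding adapted_def by blast
  define N where "N b = cshift n (M (inv_into V c b))" for b
  have N: "N (c b) = cshift n (M b)" if "b \<in> C" for b
    unfolding N_def using inv_into_f_f[OF inj_c] that CV by auto
  have v: "{v} \<subseteq> {1..n}" using v by simp
  have sv: "cshift n ({1..n} - {v}) = {1..n} - {csucc n v}"
    using cshift_Diff[OF order_refl v] image_csucc[of n] by (simp add: cshift_eq_image_csucc)
  have "adapted (csucc n v) (c ` C) N"
    unfolding adapted_def
  proof (intro conjI ballI allI impI)
    show "finite (c ` C)" using CM unfolding adapted_def by blast
    show "independent (c ` C)"
      using linear_independent_injective_image[OF linear_c] CM inj_c unfolding adapted_def by blast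
    show "span (c ` C) = V"
      using CM image_c unfolding adapted_def image_c_span[symmetric] by simp
  next
    fix b assume "b \<in> c ` C"
    then obtain a where a: "a \<in> C" "b = c a" by blast
    then have "M a \<subseteq> {1..n} - {v}" using CM unfolding adapted_def by blast
    then have "cshift n (M a) \<subseteq> cshift n ({1..n} - {v})"
      unfolding cshift_eq_image_csucc by (rule image_mono)
    then show "N b \<subseteq> {1..n} - {csucc n v}" using a N sv by simp
  next
    fix D assume D: "D \<subseteq> {1..n} - {csucc n v}"
    then obtain E where E: "E \<subseteq> {1..n} - {v}" "D = cshift n E"
      unfolding sv[symmetric] cshift_eq_image_csucc using subset_imageE by metis
    have iv: "insert v E \<subseteq> {1..n}" using E v by blast
    have "W (insert (csucc n v) D) = c ` W (insert v E)"
      unfolding image_c_W[OF iv] E(2) by (simp add: cshift_eq_image_csucc)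
    also have "\<dots> = span (c ` {b \<in> C. M b \<subseteq> E})"
      using CM E(1) unfolding adapted_def image_c_span[symmetric] by simp
    also have "c ` {b \<in> C. M b \<subseteq> E} = {b \<in> c ` C. N b \<subseteq> D}"
    proof -
      have "N (c b) \<subseteq> D \<longleftrightarrow> M b \<subseteq> E" if "b \<in> C" for b
      proof -
        have "M b \<subseteq> {1..n}" "E \<subseteq> {1..n}" using CM that E(1) unfolding adapted_def by blast+
        then show ?thesis
          unfolding N[OF that] E(2) cshift_eq_image_csucc
          using inj_on_image_mem_iff[OF inj_on_csucc[of n]] by blast
      qed
      then show ?thesis by blast
    qed
    finally show "W (insert (csucc n v) D) = span {b \<in> c ` C. N b \<subseteq> D}" .
  qed
  then show "\<exists>C M. adapted (csucc n v) C M" by (intro exI)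
qed

lemma adapted_representation:
  assumes ad: "adapted v C M" and D: "D \<subseteq> {1..n} - {v}"
    and x: "x \<in> W (insert v D)" and nz: "representation C x b \<noteq> 0"
  shows "b \<in> C" "M b \<subseteq> D"
proof -
  let ?S = "{b \<in> C. M b \<subseteq> D}"
  have C: "independent C" using ad unfolding adapted_def by blast
  have "x \<in> span ?S" using ad D x unfolding adapted_def by simp
  then have "representation C x = representation ?S x"
    using representation_extend[OF C] by simp
  then have "b \<in> ?S" using nz representation_ne_zero by metis
  then show "b \<in> C" "M b \<subseteq> D" by auto
qed

lemma adapted_sum_mem:
  assumes ad: "adapted v C M" and D: "D \<subseteq> {1..n} - {v}"
    and "\<And>b. b \<in> C \<Longrightarrow> k b \<noteq> 0 \<Longrightarrow> M b \<subseteq> D"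
  shows "(\<Sum>b\<in>C. scale (k b) b) \<in> W (insert v D)"
proof -
  have eq: "W (insert v D) = span {b \<in> C. M b \<subseteq> D}" using ad D unfolding adapted_def by simp
  show ?thesis unfolding eq
  proof (rule span_sum)
    fix b assume "b \<in> C"
    show "scale (k b) b \<in> span {b \<in> C. M b \<subseteq> D}"
    proof (cases "k b = 0")
      case True
      then show ?thesis by (simp add: span_zero)
    next
      case False
      then show ?thesis using assms(3) \<open>b \<in> C\<close> by (intro span_scale span_base) simp
    qed
  qed
qed

lemma adapted_sum_representation:
  assumes "adapted v C M" "x \<in> V"
  shows "(\<Sum>b\<in>C. scale (representation C x b) b) = x"
  using assms sum_representation_eq[of C x C] unfolding adapted_def by simp

section \<open>Relations between subspaces\<close>

text \<open>In an adapted basis the relation can be treated one basis vector \<open>b\<close> at a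
  time. The coefficients at \<open>b\<close> are supported on \<open>D - M b\<close> and sum to 0,
  so they form a 0-cycle of the simplex on these vertices; joining every vertex to a chosen vertex
  \<open>e b\<close> writes it as a boundary.\<close>

lemma cut_relation_trivial:
  assumes v: "v \<in> {1..n}" and D: "D \<subseteq> {1..n} - {v}"
    and y: "\<And>p. p \<in> D \<Longrightarrow> y p \<in> W (insert v (D - {p}))"
    and sum0: "(\<Sum>p\<in>D. y p) = 0"
  obtains z where "\<And>p q. p \<in> D \<Longrightarrow> q \<in> D \<Longrightarrow> z p q \<in> W (insert v (D - {p, q}))"
    and "\<And>p q. z p q = - z q p" and "\<And>p. z p p = 0"
    and "\<And>p. p \<in> D \<Longrightarrow> y p = (\<Sum>q\<in>D. z p q)"
proof -
  obtain C M where ad: "adapted v C M" using adapted_exists[OF v] by (elim exE)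
  have finC: "finite C" and indC: "independent C" and spanC: "span C = V"
    using ad unfolding adapted_def by blast+
  have finD: "finite D" using D finite_subset by blast
  define r where "r p b = representation C (y p) b" for p b
  \<comment> \<open>If no such index exists, \<open>e b\<close> is arbitrary, but then all
    coefficients \<open>r p b\<close> with \<open>p\<close> in \<open>D\<close> vanish.\<close>
  define e where "e b = (SOME p. p \<in> D \<and> p \<notin> M b)" for b
  \<comment> \<open>The cone over the 0-cycle with apex \<open>e b\<close>, written as an
    antisymmetric array of edges.\<close>
  define k where "k p q b = (if q = e b then r p b else 0) - (if p = e b then r q b else 0)" for p q b
  define z where "z p q = (\<Sum>b\<in>C. scale (k p q b) b)" for p q
  have Dp: "D - {p} \<subseteq> {1..n} - {v}" for p using D by blast
  have M: "M b \<subseteq> D - {p}" if "p \<in> D" "r p b \<noteq> 0" for p b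
    using adapted_representation(2)[OF ad Dp y[OF that(1)]] that(2) unfolding r_def by blast
  have e: "e b \<in> D" "e b \<notin> M b" if "p \<in> D" "r p b \<noteq> 0" for p b
  proof -
    have "p \<in> D \<and> p \<notin> M b" using M[OF that] that(1) by blast
    then have "e b \<in> D \<and> e b \<notin> M b" unfolding e_def by (rule someI)
    then show "e b \<in> D" "e b \<notin> M b" by auto
  qed
  have yV: "y p \<in> V" if "p \<in> D" for p using y[OF that] W_subset_V by blast
  have r0: "(\<Sum>p\<in>D. r p b) = 0" for b
  proof -
    have "(\<Sum>p\<in>D. r p b) = representation C (\<Sum>p\<in>D. y p) b"
      unfolding r_def using representation_sum[OF indC, of D y] yV spanC by simp
    then show ?thesis unfolding sum0 using representation_zero by simp
  qed
  show thesis
  proof (rule that)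
    show "z p q \<in> W (insert v (D - {p, q}))" if pq: "p \<in> D" "q \<in> D" for p q
      unfolding z_def
    proof (rule adapted_sum_mem[OF ad])
      show "D - {p, q} \<subseteq> {1..n} - {v}" using D by blast
      fix b assume "k p q b \<noteq> 0"
      then have "q = e b \<and> r p b \<noteq> 0 \<or> p = e b \<and> r q b \<noteq> 0"
        unfolding k_def by (auto split: if_splits)
      then show "M b \<subseteq> D - {p, q}"
        using M[OF pq(1)] M[OF pq(2)] e(2)[OF pq(1)] e(2)[OF pq(2)] by blast
    qed
    show "z p q = - z q p" for p q
    proof -
      have "k p q b = - k q p b" for b unfolding k_def by simp
      then have "z p q = (\<Sum>b\<in>C. scale (- k q p b) b)" unfolding z_def by metis
      then show ?thesis unfolding z_def by (simp add: sum_negf)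
    qed
    show "z p p = 0" for p unfolding z_def k_def by simp
    show "y p = (\<Sum>q\<in>D. z p q)" if p: "p \<in> D" for p
    proof -
      have "(\<Sum>q\<in>D. z p q) = (\<Sum>b\<in>C. scale (\<Sum>q\<in>D. k p q b) b)"
        unfolding z_def scale_sum_left by (rule sum.swap)
      also have "\<dots> = (\<Sum>b\<in>C. scale (r p b) b)"
      proof (rule sum.cong[OF refl])
        fix b
        have "(\<Sum>q\<in>D. if q = e b then r p b else 0) = r p b"
          using e(1)[OF p, of b] finD by (cases "r p b = 0") (auto simp: sum.delta)
        moreover have "(\<Sum>q\<in>D. if p = e b then r q b else 0) = 0"
          using r0[of b] by (cases "p = e b") simp_all
        ultimately show "scale (\<Sum>q\<in>D. k p q b) b = scale (r p b) b"
          unfolding k_def sum_subtractf by simp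
      qed
      also have "\<dots> = y p"
        unfolding r_def by (rule adapted_sum_representation[OF ad yV[OF p]])
      finally show ?thesis ..
    qed
  qed
qed

text \<open>The same cone one degree higher: the coefficients at \<open>b\<close> are now an
  antisymmetric 1-cycle, which the cone with apex \<open>e b\<close> fills by triangles.\<close>

lemma cut_relation_trivial2:
  assumes v: "v \<in> {1..n}" and D: "D \<subseteq> {1..n} - {v}"
    and y: "\<And>p q. p \<in> D \<Longrightarrow> q \<in> D \<Longrightarrow> y p q \<in> W (insert v (D - {p, q}))"
    and anti: "\<And>p q. p \<in> D \<Longrightarrow> q \<in> D \<Longrightarrow> y p q = - y q p"
    and diag: "\<And>p. p \<in> D \<Longrightarrow> y p p = 0"
    and sum0: "\<And>p. p \<in> D \<Longrightarrow> (\<Sum>q\<in>D. y p q) = 0"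
  obtains z where "\<And>p q r. p \<in> D \<Longrightarrow> q \<in> D \<Longrightarrow> r \<in> D \<Longrightarrow> z p q r \<in> W (insert v (D - {p, q, r}))"
    and "\<And>p q r. p \<in> D \<Longrightarrow> q \<in> D \<Longrightarrow> r \<in> D \<Longrightarrow> z p q r = - z p r q"
    and "\<And>p q. p \<in> D \<Longrightarrow> q \<in> D \<Longrightarrow> z p q q = 0"
    and "\<And>p q. p \<in> D \<Longrightarrow> q \<in> D \<Longrightarrow> z p q p = 0"
    and "\<And>p q. p \<in> D \<Longrightarrow> q \<in> D \<Longrightarrow> y p q = (\<Sum>r\<in>D. z p q r)"
proof -
  obtain C M where ad: "adapted v C M" using adapted_exists[OF v] by (elim exE)
  have finC: "finite C" and indC: "independent C" and spanC: "span C = V"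
    using ad unfolding adapted_def by blast+
  have finD: "finite D" using D finite_subset by blast
  define s where "s p q b = representation C (y p q) b" for p q b
  define e where "e b = (SOME p. p \<in> D \<and> p \<notin> M b)" for b
  define k where "k p q r b = (if r = e b then s p q b else 0) + (if p = e b then s q r b else 0)
     + (if q = e b then s r p b else 0)" for p q r b
  define z where "z p q r = (\<Sum>b\<in>C. scale (k p q r b) b)" for p q r
  have yV: "y p q \<in> V" if "p \<in> D" "q \<in> D" for p q using y[OF that] W_subset_V by blast
  have Dp: "D - {p, q} \<subseteq> {1..n} - {v}" for p q using D by blast
  have M: "M b \<subseteq> D - {p, q}" if "p \<in> D" "q \<in> D" "s p q b \<noteq> 0" for p q b
    using adapted_representation(2)[OF ad Dp y[OF that(1,2)]] that(3) unfolding s_def by blast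
  have e: "e b \<in> D" "e b \<notin> M b" if "p \<in> D" "q \<in> D" "s p q b \<noteq> 0" for p q b
  proof -
    have "p \<in> D \<and> p \<notin> M b" using M[OF that] that(1) by blast
    then have "e b \<in> D \<and> e b \<notin> M b" unfolding e_def by (rule someI)
    then show "e b \<in> D" "e b \<notin> M b" by auto
  qed
  have s_anti: "s p q b = - s q p b" if "p \<in> D" "q \<in> D" for p q b
    unfolding s_def anti[OF that] using representation_neg[OF indC] yV[OF that(2,1)] spanC by simp
  have s_diag: "s p p b = 0" if "p \<in> D" for p b
    unfolding s_def diag[OF that] using representation_zero by simp
  have s0: "(\<Sum>q\<in>D. s p q b) = 0" if "p \<in> D" for p b
  proof -
    have "(\<Sum>q\<in>D. s p q b) = representation C (\<Sum>q\<in>D. y p q) b"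
      unfolding s_def using representation_sum[OF indC, of D "y p"] yV[OF that] spanC by simp
    then show ?thesis unfolding sum0[OF that] using representation_zero by simp
  qed
  show thesis
  proof (rule that)
    show "z p q r \<in> W (insert v (D - {p, q, r}))" if pq: "p \<in> D" "q \<in> D" "r \<in> D" for p q r
      unfolding z_def
    proof (rule adapted_sum_mem[OF ad])
      show "D - {p, q, r} \<subseteq> {1..n} - {v}" using D by blast
      fix b assume "k p q r b \<noteq> 0"
      then have "r = e b \<and> s p q b \<noteq> 0 \<or> p = e b \<and> s q r b \<noteq> 0 \<or> q = e b \<and> s r p b \<noteq> 0"
        unfolding k_def by (auto split: if_splits)
      then show "M b \<subseteq> D - {p, q, r}"
        using M[OF pq(1,2)] M[OF pq(2,3)] M[OF pq(3,1)] e(2)[OF pq(1,2)] e(2)[OF pq(2,3)] e(2)[OF pq(3,1)]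
        by blast
    qed
    show "z p q r = - z p r q" if pq: "p \<in> D" "q \<in> D" "r \<in> D" for p q r
    proof -
      have "k p q r b = - k p r q b" for b
        unfolding k_def s_anti[OF pq(1,2)] s_anti[OF pq(2,3)] s_anti[OF pq(3,1)] by simp
      then have "z p q r = (\<Sum>b\<in>C. scale (- k p r q b) b)" unfolding z_def by metis
      then show ?thesis unfolding z_def by (simp add: sum_negf)
    qed
    show "z p q q = 0" if pq: "p \<in> D" "q \<in> D" for p q
    proof -
      have "k p q q b = 0" for b unfolding k_def s_anti[OF pq] s_diag[OF pq(2)] by simp
      then show ?thesis unfolding z_def by simp
    qed
    show "z p q p = 0" if pq: "p \<in> D" "q \<in> D" for p q
    proof -
      have "k p q p b = 0" for b unfolding k_def s_anti[OF pq] s_diag[OF pq(1)] by simp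
      then show ?thesis unfolding z_def by simp
    qed
    show "y p q = (\<Sum>r\<in>D. z p q r)" if p: "p \<in> D" and q: "q \<in> D" for p q
    proof -
      have "(\<Sum>r\<in>D. z p q r) = (\<Sum>b\<in>C. scale (\<Sum>r\<in>D. k p q r b) b)"
        unfolding z_def scale_sum_left by (rule sum.swap)
      also have "\<dots> = (\<Sum>b\<in>C. scale (s p q b) b)"
      proof (rule sum.cong[OF refl])
        fix b
        have "(\<Sum>r\<in>D. if r = e b then s p q b else 0) = s p q b"
          using e(1)[OF p q, of b] finD by (cases "s p q b = 0") (auto simp: sum.delta)
        moreover have "(\<Sum>r\<in>D. if p = e b then s q r b else 0) = 0"
          using s0[OF q, of b] by (cases "p = e b") simp_all
        moreover have "(\<Sum>r\<in>D. s r p b) = (\<Sum>r\<in>D. - s p r b)"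
          by (rule sum.cong[OF refl]) (rule s_anti[OF _ p])
        then have "(\<Sum>r\<in>D. if q = e b then s r p b else 0) = 0"
          using s0[OF p, of b] by (cases "q = e b") (simp_all add: sum_negf)
        ultimately show "scale (\<Sum>r\<in>D. k p q r b) b = scale (s p q b) b"
          unfolding k_def sum.distrib by simp
      qed
      also have "\<dots> = y p q"
        unfolding s_def by (rule adapted_sum_representation[OF ad yV[OF p q]])
      finally show ?thesis ..
    qed
  qed
qed

text \<open>Every relation between the \<open>W (J - {j})\<close> is a Koszul relation.\<close>

definition good :: "nat set \<Rightarrow> bool" where
  "good J \<longleftrightarrow> (\<forall>y. (\<forall>j\<in>J. y j \<in> W (J - {j})) \<longrightarrow> (\<Sum>j\<in>J. y j) = 0 \<longrightarrow>
     (\<exists>z. (\<forall>p\<in>J. \<forall>q\<in>J. z p q \<in> W (J - {p, q}) \<and> z p q = - z q p) \<and> (\<forall>p\<in>J. z p p = 0)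
        \<and> (\<forall>p\<in>J. y p = (\<Sum>q\<in>J. z p q))))"

lemma goodE:
  assumes "good J" "\<And>j. j \<in> J \<Longrightarrow> y j \<in> W (J - {j})" "(\<Sum>j\<in>J. y j) = 0"
  obtains z where "\<And>p q. p \<in> J \<Longrightarrow> q \<in> J \<Longrightarrow> z p q \<in> W (J - {p, q})"
    "\<And>p q. p \<in> J \<Longrightarrow> q \<in> J \<Longrightarrow> z p q = - z q p" "\<And>p. p \<in> J \<Longrightarrow> z p p = 0"
    "\<And>p. p \<in> J \<Longrightarrow> y p = (\<Sum>q\<in>J. z p q)"
proof -
  obtain z where z: "\<forall>p\<in>J. \<forall>q\<in>J. z p q \<in> W (J - {p, q}) \<and> z p q = - z q p"
      "\<forall>p\<in>J. z p p = 0" "\<forall>p\<in>J. y p = (\<Sum>q\<in>J. z p q)"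
    using assms unfolding good_def by metis
  show thesis
    by (rule that[of z]) (use z in blast)+
qed

text \<open>Both \<open>J\<close> and its modification are compared with \<open>insert w J\<close>: the relation \<open>y\<close> is first completed,
  by exactness of the family cut at \<open>u\<close>, to a second-order relation \<open>Y\<close> on \<open>insert w J\<close>, which is then
  trivialised by \<open>good J\<close> and exactness of the family cut at \<open>w\<close>.\<close>

lemma good_swap:
  assumes J: "good J" "J \<subseteq> {1..n}" and u: "u \<in> J" and w: "w \<in> {1..n}" "w \<notin> J"
  shows "good (insert w (J - {u}))"
  unfolding good_def
proof (intro allI impI)
  let ?J' = "insert w (J - {u})" and ?Jp = "insert w J"
  fix y assume y: "\<forall>j\<in>?J'. y j \<in> W (?J' - {j})" and y0: "(\<Sum>j\<in>?J'. y j) = 0"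
  have finJ: "finite J" using J(2) finite_subset by blast
  have uw: "u \<noteq> w" using u w by blast
  have uJ': "?J' \<subseteq> {1..n} - {u}" "u \<in> {1..n}" using J(2) u w by auto
  have "y p \<in> W (insert u (?J' - {p}))" if "p \<in> ?J'" for p
    using y that W_mono[of "?J' - {p}" "insert u (?J' - {p})"] by blast
  then obtain x where x: "\<And>p q. p \<in> ?J' \<Longrightarrow> q \<in> ?J' \<Longrightarrow> x p q \<in> W (insert u (?J' - {p, q}))"
      "\<And>p q. x p q = - x q p" "\<And>p. x p p = 0" "\<And>p. p \<in> ?J' \<Longrightarrow> y p = (\<Sum>q\<in>?J'. x p q)"
    using cut_relation_trivial[OF uJ'(2,1) _ y0] by blast
  \<comment> \<open>Row and column \<open>u\<close> carry the given relation up to sign, which makes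
    every row of \<open>Y\<close> on \<open>insert w J\<close> sum to zero.\<close>
  define Y where "Y p q = (if p = u then (if q = u then 0 else y q) else if q = u then - y p else x p q)" for p q
  have Y_anti: "Y p q = - Y q p" for p q unfolding Y_def using x(2)[of p q] by simp
  have Y_mem: "Y p q \<in> W (?Jp - {p, q})" if "p \<in> ?Jp" "q \<in> ?Jp" "p \<noteq> q" for p q
  proof -
    have yq: "y q \<in> W (?Jp - {u, q})" if "q \<in> ?Jp" "q \<noteq> u" for q
    proof -
      have "y q \<in> W (?J' - {q})" using y that by blast
      also have "?J' - {q} = ?Jp - {u, q}" using uw by blast
      finally show ?thesis .
    qed
    consider "p = u" "q \<noteq> u" | "q = u" "p \<noteq> u" | "p \<noteq> u" "q \<noteq> u" using \<open>p \<noteq> q\<close> by auto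
    then show ?thesis
    proof cases
      case 1 then show ?thesis using yq[OF that(2)] by (simp add: Y_def)
    next
      case 2
      then have "- y p \<in> W (?Jp - {u, p})" using yq[OF that(1)] subspace_neg[OF subspace_W] by blast
      then show ?thesis using 2 by (simp add: Y_def insert_commute)
    next
      case 3
      then have eq: "insert u (?J' - {p, q}) = ?Jp - {p, q}" using u uw by blast
      have "x p q \<in> W (insert u (?J' - {p, q}))" using x(1)[of p q] that 3 by blast
      then show ?thesis unfolding eq using 3 by (simp add: Y_def)
    qed
  qed
  have Y_sum: "(\<Sum>q\<in>?Jp. Y p q) = 0" if "p \<in> ?Jp" for p
  proof -
    have Jp: "?Jp = insert u ?J'" "u \<notin> ?J'" "finite ?J'" using u uw finJ by auto
    have "(\<Sum>q\<in>?Jp. Y p q) = Y p u + (\<Sum>q\<in>?J'. Y p q)"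
      unfolding Jp(1) using Jp(2,3) by (rule sum.insert[rotated])
    also have "(\<Sum>q\<in>?J'. Y p q) = (\<Sum>q\<in>?J'. if p = u then y q else x p q)"
      by (rule sum.cong[OF refl]) (use Jp(2) in \<open>auto simp: Y_def\<close>)
    also have "Y p u + \<dots> = 0"
    proof (cases "p = u")
      case True
      then show ?thesis using y0 by (simp add: Y_def)
    next
      case False
      then have "p \<in> ?J'" using that by blast
      then show ?thesis using False x(4)[of p] by (simp add: Y_def)
    qed
    finally show ?thesis .
  qed
  \<comment> \<open>Row \<open>w\<close> lives in subspaces from whose index sets \<open>w\<close>
    has been removed, so it is a relation for \<open>J\<close> and \<open>good J\<close> applies to
    it.\<close>
  have Yw_mem: "Y w q \<in> W (J - {q})" if "q \<in> J" for q
  proof -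
    have "Y w q \<in> W (?Jp - {w, q})" using Y_mem[of w q] that w by blast
    also have "?Jp - {w, q} = J - {q}" using w that by blast
    finally show ?thesis .
  qed
  have Yw_sum: "(\<Sum>q\<in>J. Y w q) = 0"
    using Y_sum[of w] w(2) finJ Y_anti[of w w] uw x(3) by (simp add: Y_def)
  obtain t where t: "\<And>p q. p \<in> J \<Longrightarrow> q \<in> J \<Longrightarrow> t p q \<in> W (J - {p, q})"
      "\<And>p q. p \<in> J \<Longrightarrow> q \<in> J \<Longrightarrow> t p q = - t q p" "\<And>p. p \<in> J \<Longrightarrow> t p p = 0"
      "\<And>p. p \<in> J \<Longrightarrow> Y w p = (\<Sum>q\<in>J. t p q)"
    using goodE[OF J(1) Yw_mem Yw_sum] by blast
  \<comment> \<open>Subtracting \<open>t\<close> compensates for the missing column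
    \<open>w\<close>: the rows of the array restricted to \<open>J\<close> again sum to zero, now in
    the family cut at \<open>w\<close>.\<close>
  define Y' where "Y' p q = Y p q - t p q" for p q
  have wJ: "J \<subseteq> {1..n} - {w}" using J(2) w(2) by blast
  have Y'_diag: "Y' p p = 0" if "p \<in> J" for p
    unfolding Y'_def using t(3)[OF that] x(3)[of p] by (simp add: Y_def)
  have Y'_mem: "Y' p q \<in> W (insert w (J - {p, q}))" if "p \<in> J" "q \<in> J" for p q
  proof (cases "p = q")
    case True then show ?thesis using Y'_diag[OF that(1)] subspace_0[OF subspace_W] by simp
  next
    case False
    have "?Jp - {p, q} = insert w (J - {p, q})" using w(2) that by blast
    moreover have "Y p q \<in> W (?Jp - {p, q})" using Y_mem[of p q] that False by blast
    ultimately have "Y p q \<in> W (insert w (J - {p, q}))" by (rule subst)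
    moreover have "t p q \<in> W (insert w (J - {p, q}))"
      using t(1)[OF that] W_mono[of "J - {p, q}" "insert w (J - {p, q})"] by blast
    ultimately show ?thesis unfolding Y'_def by (rule subspace_diff[OF subspace_W])
  qed
  have Y'_anti: "Y' p q = - Y' q p" if "p \<in> J" "q \<in> J" for p q
    unfolding Y'_def using Y_anti[of p q] t(2)[OF that] by simp
  have Y'_sum: "(\<Sum>q\<in>J. Y' p q) = 0" if "p \<in> J" for p
  proof -
    have "Y p w + (\<Sum>q\<in>J. Y p q) = 0" using Y_sum[of p] that w(2) finJ by simp
    then have "(\<Sum>q\<in>J. Y p q) = Y w p" using Y_anti[of p w] by simp
    then show ?thesis unfolding Y'_def sum_subtractf using t(4)[OF that] by simp
  qed
  obtain Z where Z: "\<And>p q r. p \<in> J \<Longrightarrow> q \<in> J \<Longrightarrow> r \<in> J \<Longrightarrow> Z p q r \<in> W (insert w (J - {p, q, r}))"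
      "\<And>p q r. p \<in> J \<Longrightarrow> q \<in> J \<Longrightarrow> r \<in> J \<Longrightarrow> Z p q r = - Z p r q"
      "\<And>p q. p \<in> J \<Longrightarrow> q \<in> J \<Longrightarrow> Z p q q = 0"
      "\<And>p q. p \<in> J \<Longrightarrow> q \<in> J \<Longrightarrow> Z p q p = 0"
      "\<And>p q. p \<in> J \<Longrightarrow> q \<in> J \<Longrightarrow> Y' p q = (\<Sum>r\<in>J. Z p q r)"
    using cut_relation_trivial2[OF w(1) wJ Y'_mem Y'_anti Y'_diag Y'_sum] by blast
  \<comment> \<open>Row \<open>u\<close> of the filled array says that \<open>y p\<close> is
    \<open>t u p\<close> plus the sum of the \<open>Z u p q\<close>. The entries of \<open>z\<close>
    involving \<open>w\<close> absorb the term \<open>t u p\<close>.\<close>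
  define z where "z q r = (if q = w then (if r = w then 0 else - t u r)
      else if r = w then t u q else Z u q r)" for q r
  have "z p q \<in> W (?J' - {p, q}) \<and> z p q = - z q p" if pq: "p \<in> ?J'" "q \<in> ?J'" for p q
  proof
    have tq: "t u q \<in> W (?J' - {w, q})" if "q \<in> J" "q \<noteq> u" for q
    proof -
      have "t u q \<in> W (J - {u, q})" by (rule t(1)[OF u that(1)])
      also have "J - {u, q} = ?J' - {w, q}" using w(2) by blast
      finally show ?thesis .
    qed
    consider "p = w" "q = w" | "p = w" "q \<noteq> w" | "q = w" "p \<noteq> w" | "p \<noteq> w" "q \<noteq> w" by blast
    then show "z p q \<in> W (?J' - {p, q})"
    proof cases
      case 1 then show ?thesis by (simp add: z_def subspace_0[OF subspace_W])
    next
      case 2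
      then have "- t u q \<in> W (?J' - {w, q})" using tq[of q] pq subspace_neg[OF subspace_W] by blast
      then show ?thesis using 2 by (simp add: z_def)
    next
      case 3
      then have "t u p \<in> W (?J' - {w, p})" using tq[of p] pq by blast
      then show ?thesis using 3 by (simp add: z_def insert_commute)
    next
      case 4
      then have eq: "insert w (J - {u, p, q}) = ?J' - {p, q}" by blast
      have "Z u p q \<in> W (insert w (J - {u, p, q}))" using Z(1)[OF u, of p q] pq 4 by blast
      then show ?thesis unfolding eq using 4 by (simp add: z_def)
    qed
    show "z p q = - z q p" using Z(2)[OF u, of p q] pq by (auto simp: z_def)
  qed
  moreover have "z p p = 0" if "p \<in> ?J'" for p
    using Z(3)[OF u, of p] that by (auto simp: z_def)
  moreover have "y p = (\<Sum>q\<in>?J'. z p q)" if "p \<in> ?J'" for p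
  proof -
    have sp: "(\<Sum>q\<in>?J'. z p q) = z p w + (\<Sum>q\<in>J - {u}. z p q)" using finJ w(2) by simp
    show ?thesis
    proof (cases "p = w")
      case True
      have "(\<Sum>q\<in>J - {u}. z p q) = (\<Sum>q\<in>J - {u}. - t u q)"
        by (rule sum.cong[OF refl]) (use w(2) True in \<open>auto simp: z_def\<close>)
      also have "\<dots> = - (\<Sum>q\<in>J. t u q)"
        using finJ u t(3)[OF u] by (simp add: sum_negf sum.remove[of J u])
      also have "\<dots> = - Y w u" using t(4)[OF u] by simp
      also have "\<dots> = y w" using uw by (simp add: Y_def)
      finally show ?thesis using sp True by (simp add: z_def)
    next
      case False
      then have p: "p \<in> J" "p \<noteq> u" using that by auto
      have "(\<Sum>q\<in>J - {u}. z p q) = (\<Sum>q\<in>J - {u}. Z u p q)"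
        by (rule sum.cong[OF refl]) (use w(2) False in \<open>auto simp: z_def\<close>)
      also have "\<dots> = (\<Sum>q\<in>J. Z u p q)"
        using finJ u Z(4)[OF u p(1)] by (simp add: sum.remove[of J u])
      also have "\<dots> = Y' u p" using Z(5)[OF u p(1)] by simp
      also have "\<dots> = y p - t u p" using p(2) by (simp add: Y'_def Y_def)
      finally show ?thesis using sp False by (simp add: z_def)
    qed
  qed
  ultimately show "\<exists>z. (\<forall>p\<in>?J'. \<forall>q\<in>?J'. z p q \<in> W (?J' - {p, q}) \<and> z p q = - z q p)
      \<and> (\<forall>p\<in>?J'. z p p = 0) \<and> (\<forall>p\<in>?J'. y p = (\<Sum>q\<in>?J'. z p q))"
    by (intro exI[of _ z]) blast
qed

end

lemma (in vector_space) span_UN_subspaces: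
  assumes "finite F" "\<And>j. j \<in> F \<Longrightarrow> subspace (S j)" "x \<in> span (\<Union>j\<in>F. S j)"
  shows "\<exists>f. (\<forall>j\<in>F. f j \<in> S j) \<and> x = (\<Sum>j\<in>F. f j)"
  using assms
proof (induction F arbitrary: x rule: finite_induct)
  case empty
  then show ?case by simp
next
  case (insert i F)
  have "x \<in> span (S i \<union> (\<Union>j\<in>F. S j))" using insert.prems(2) by simp
  then obtain a b where ab: "x = a + b" "a \<in> span (S i)" "b \<in> span (\<Union>j\<in>F. S j)"
    unfolding span_Un by auto
  obtain f where f: "\<forall>j\<in>F. f j \<in> S j" "b = (\<Sum>j\<in>F. f j)"
    using insert.IH[OF _ ab(3)] insert.prems(1) by auto
  have "a \<in> S i" using ab(2) span_minimal[OF order_refl] insert.prems(1) by blast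
  then show ?case
    using insert.hyps f ab(1) by (intro exI[of _ "f(i := a)"]) (auto intro!: sum.cong)
qed

section \<open>The dimension count when no label is an initial interval\<close>

text \<open>The case \<open>m = 0\<close> excludes the empty label, which forces \<open>W {}\<close>
  to be zero.\<close>

locale cyclic_subspaces_no_interval = cyclic_subspaces +
  assumes L_not_interval: "\<And>b m. b \<in> B \<Longrightarrow> L b \<noteq> {1..m}"
begin

lemma W_insert_n: "D \<subseteq> {1..n} - {n} \<Longrightarrow> W (insert n D) = span {b \<in> B. L b \<subseteq> D}"
  unfolding W_def by (rule adapted_B)

lemma span_W_cut:
  assumes D: "D \<subseteq> {1..n} - {n}"
  shows "span (\<Union>j\<in>D. W (insert n (D - {j}))) = span {b \<in> B. L b \<subset> D}"
proof (rule equalityI; rule span_minimal[OF _ subspace_span])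
  show "(\<Union>j\<in>D. W (insert n (D - {j}))) \<subseteq> span {b \<in> B. L b \<subset> D}"
  proof (rule UN_least)
    fix j assume j: "j \<in> D"
    have "W (insert n (D - {j})) = span {b \<in> B. L b \<subseteq> D - {j}}"
      using D by (intro W_insert_n) blast
    also have "\<dots> \<subseteq> span {b \<in> B. L b \<subset> D}" using j by (intro span_mono) blast
    finally show "W (insert n (D - {j})) \<subseteq> span {b \<in> B. L b \<subset> D}" .
  qed
  show "{b \<in> B. L b \<subset> D} \<subseteq> span (\<Union>j\<in>D. W (insert n (D - {j})))"
  proof
    fix b assume b: "b \<in> {b \<in> B. L b \<subset> D}"
    then obtain j where j: "j \<in> D" "L b \<subseteq> D - {j}" by blast
    have "b \<in> span {b \<in> B. L b \<subseteq> D - {j}}" using b j(2) by (intro span_base) blast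
    also have "\<dots> = W (insert n (D - {j}))"
      using D by (intro W_insert_n[symmetric]) blast
    finally show "b \<in> span (\<Union>j\<in>D. W (insert n (D - {j})))" using j(1) by (intro span_base) blast
  qed
qed

text \<open>Since no label equals the interval, every label inside it already lies in the interval
  with one element removed.\<close>

lemma W_interval_aux:
  assumes m: "m < n"
  shows "W (insert n {1..m}) = W' (insert n {1..m})"
proof
  let ?D = "{1..m}"
  have D: "?D \<subseteq> {1..n} - {n}" using m by auto
  have "{b \<in> B. L b \<subseteq> ?D} = {b \<in> B. L b \<subset> ?D}" using L_not_interval by blast
  then have "W (insert n ?D) = span (\<Union>j\<in>?D. W (insert n (?D - {j})))"
    unfolding W_insert_n[OF D] span_W_cut[OF D] by simp
  also have "\<dots> \<subseteq> W' (insert n ?D)"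
    unfolding W'_def
  proof (intro span_mono UN_least)
    fix j assume j: "j \<in> ?D"
    then have "insert n (?D - {j}) = insert n ?D - {j}" using m by auto
    then show "W (insert n (?D - {j})) \<subseteq> (\<Union>j\<in>insert n ?D. W (insert n ?D - {j}))"
      using j by auto
  qed
  finally show "W (insert n ?D) \<subseteq> W' (insert n ?D)" .
qed (rule W'_subset)

lemma W_empty: "W {} = {0}"
proof -
  have "W (insert n {}) = span {b \<in> B. L b \<subseteq> {}}" by (rule W_insert_n) simp
  also have "{b \<in> B. L b \<subseteq> {}} = {}" using L_not_interval[of _ 0] by auto
  finally have "W (insert n {}) = {0}" by simp
  then show ?thesis
    using W_mono[of "{}" "insert n {}"] subspace_0[OF subspace_W, of "{}"] by blast
qed

text \<open>A single rotation turns \<open>insert n {1..m}\<close> into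
  \<open>{1..Suc m}\<close>.\<close>

lemma W_interval:
  assumes "k \<le> n"
  shows "W {1..k} = W' {1..k}"
proof (cases k)
  case 0
  then show ?thesis using W_empty by (simp add: W'_def)
next
  case (Suc m)
  then have m: "m < n" using assms by simp
  have "csucc n ` insert n {1..m} = insert 1 (Suc ` {1..m})"
    using m by (auto simp: csucc_self csucc_less image_iff)
  also have "\<dots> = {1..k}" unfolding Suc by auto
  finally have sh: "cshift n (insert n {1..m}) = {1..k}" by (simp add: cshift_eq_image_csucc)
  have sub: "insert n {1..m} \<subseteq> {1..n}" using m by auto
  show ?thesis
    using image_c_W[OF sub] image_c_W'[OF sub] W_interval_aux[OF m] unfolding sh by simp
qed

lemma g_interval: "k \<le> n \<Longrightarrow> g {1..k} = 0"
  unfolding g_def using W_interval by simp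

text \<open>The component at \<open>n\<close> lies in \<open>W {1..k}\<close>, which equals
  \<open>W' {1..k}\<close>. Distributing it over the other components leaves a relation in the
  family cut at \<open>n\<close>, and the distributed pieces \<open>x\<close> become the entries of
  \<open>z'\<close> that involve \<open>n\<close>.\<close>

lemma good_interval:
  assumes k: "k < n"
  shows "good (insert n {1..k})"
  unfolding good_def
proof (intro allI impI)
  let ?D = "{1..k}" let ?J = "insert n ?D"
  fix y assume y: "\<forall>j\<in>?J. y j \<in> W (?J - {j})" and y0: "(\<Sum>j\<in>?J. y j) = 0"
  have D: "?D \<subseteq> {1..n} - {n}" and nD: "n \<notin> ?D" and n1: "n \<in> {1..n}" using k by auto
  have "?J - {n} = ?D" using nD by blast
  then have "y n \<in> span (\<Union>j\<in>?D. W (?D - {j}))"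
    using y W_interval[of k] k unfolding W'_def by auto
  then obtain x where x: "\<forall>j\<in>?D. x j \<in> W (?D - {j})" "y n = (\<Sum>j\<in>?D. x j)"
    using span_UN_subspaces[of ?D "\<lambda>j. W (?D - {j})" "y n"] subspace_W by auto
  define y' where "y' j = y j + x j" for j
  have y'_mem: "y' p \<in> W (insert n (?D - {p}))" if p: "p \<in> ?D" for p
  proof -
    have "y p \<in> W (?J - {p})" using y p by blast
    also have "?J - {p} = insert n (?D - {p})" using p nD by blast
    finally have "y p \<in> W (insert n (?D - {p}))" .
    moreover have "x p \<in> W (insert n (?D - {p}))"
      using x(1) p W_mono[of "?D - {p}" "insert n (?D - {p})"] by blast
    ultimately show ?thesis unfolding y'_def by (rule subspace_add[OF subspace_W])
  qed
  have y'_sum: "(\<Sum>p\<in>?D. y' p) = 0"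
    using y0 nD x(2) unfolding y'_def sum.distrib by (simp add: add.commute)
  obtain z where z: "\<And>p q. p \<in> ?D \<Longrightarrow> q \<in> ?D \<Longrightarrow> z p q \<in> W (insert n (?D - {p, q}))"
      "\<And>p q. z p q = - z q p" "\<And>p. z p p = 0" "\<And>p. p \<in> ?D \<Longrightarrow> y' p = (\<Sum>q\<in>?D. z p q)"
    using cut_relation_trivial[OF n1 D y'_mem y'_sum] by blast
  define z' where "z' p q = (if p = n then (if q = n then 0 else x q) else if q = n then - x p else z p q)"
    for p q
  have "z' p q \<in> W (?J - {p, q}) \<and> z' p q = - z' q p" if pq: "p \<in> ?J" "q \<in> ?J" for p q
  proof
    have xm: "x q \<in> W (?J - {n, q})" if "q \<in> ?D" for q
    proof -
      have "x q \<in> W (?D - {q})" using x(1) that by blast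
      also have "?D - {q} = ?J - {n, q}" using nD by blast
      finally show ?thesis .
    qed
    consider "p = n" "q = n" | "p = n" "q \<noteq> n" | "q = n" "p \<noteq> n" | "p \<noteq> n" "q \<noteq> n" by blast
    then show "z' p q \<in> W (?J - {p, q})"
    proof cases
      case 1 then show ?thesis by (simp add: z'_def subspace_0[OF subspace_W])
    next
      case 2
      then have "x q \<in> W (?J - {n, q})" using xm[of q] pq by blast
      then show ?thesis using 2 by (simp add: z'_def)
    next
      case 3
      then have "- x p \<in> W (?J - {n, p})" using xm[of p] pq subspace_neg[OF subspace_W] by blast
      then show ?thesis using 3 by (simp add: z'_def insert_commute)
    next
      case 4
      then have eq: "insert n (?D - {p, q}) = ?J - {p, q}" by blast
      have "z p q \<in> W (insert n (?D - {p, q}))" using z(1)[of p q] pq 4 by blast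
      then show ?thesis unfolding eq using 4 by (simp add: z'_def)
    qed
    show "z' p q = - z' q p" using z(2)[of p q] by (simp add: z'_def)
  qed
  moreover have "z' p p = 0" if "p \<in> ?J" for p using z(3) by (simp add: z'_def)
  moreover have "y p = (\<Sum>q\<in>?J. z' p q)" if "p \<in> ?J" for p
  proof -
    have sp: "(\<Sum>q\<in>?J. z' p q) = z' p n + (\<Sum>q\<in>?D. z' p q)" using nD by simp
    show ?thesis
    proof (cases "p = n")
      case True
      have "(\<Sum>q\<in>?D. z' p q) = (\<Sum>q\<in>?D. x q)"
        by (rule sum.cong[OF refl]) (use nD True in \<open>auto simp: z'_def\<close>)
      then show ?thesis using sp True x(2) by (simp add: z'_def)
    next
      case False
      then have p: "p \<in> ?D" using that by blast
      have "(\<Sum>q\<in>?D. z' p q) = (\<Sum>q\<in>?D. z p q)"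
        by (rule sum.cong[OF refl]) (use nD False in \<open>auto simp: z'_def\<close>)
      also have "\<dots> = y p + x p" using z(4)[OF p] by (simp add: y'_def)
      finally show ?thesis using sp False by (simp add: z'_def)
    qed
  qed
  ultimately show "\<exists>z. (\<forall>p\<in>?J. \<forall>q\<in>?J. z p q \<in> W (?J - {p, q}) \<and> z p q = - z q p)
      \<and> (\<forall>p\<in>?J. z p p = 0) \<and> (\<forall>p\<in>?J. y p = (\<Sum>q\<in>?J. z p q))"
    by (intro exI[of _ z']) blast
qed

text \<open>Induction on the number of elements of \<open>J\<close> outside the reference set
  \<open>insert n {1..k}\<close>, lowered by one exchange at a time through
  \<open>good_swap\<close>.\<close>

lemma good_all:
  assumes "J \<subseteq> {1..n}" "card J = Suc k"
  shows "good J"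
proof -
  let ?T = "insert n {1..k}"
  have "card J \<le> card {1..n}" using assms(1) by (intro card_mono) auto
  then have k: "k < n" using assms(2) by simp
  then have cT: "card ?T = Suc k" by simp
  have "\<forall>J. J \<subseteq> {1..n} \<longrightarrow> card J = Suc k \<longrightarrow> card (J - ?T) = m \<longrightarrow> good J" for m
  proof (induction m)
    case 0
    show ?case
    proof (intro allI impI)
      fix J assume J: "J \<subseteq> {1..n}" "card J = Suc k" "card (J - ?T) = 0"
      have "finite J" using J(1) finite_subset by blast
      then have "J \<subseteq> ?T" using J(3) by simp
      then have "J = ?T" using cT J(2) by (intro card_subset_eq) auto
      then show "good J" using good_interval[OF k] by simp
    qed
  next
    case (Suc m)
    show ?case
    proof (intro allI impI)
      fix J assume J: "J \<subseteq> {1..n}" "card J = Suc k" "card (J - ?T) = Suc m"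
      have fin: "finite J" using J(1) finite_subset by blast
      obtain w where w: "w \<in> J" "w \<notin> ?T" using J(3) by (metis DiffE card.empty equals0I nat.distinct(1))
      have "\<not> ?T \<subseteq> J"
      proof
        assume "?T \<subseteq> J"
        then have "?T = J" using cT J(2) fin by (intro card_subset_eq) auto
        then show False using w by blast
      qed
      then obtain u where u: "u \<in> ?T" "u \<notin> J" by blast
      let ?I = "insert u (J - {w})"
      have I: "?I \<subseteq> {1..n}" using J(1) u(1) k by auto
      have "card ?I = Suc k" using fin u(2) w(1) J(2) by simp
      moreover have "?I - ?T = (J - ?T) - {w}" using u(1) by blast
      then have "card (?I - ?T) = m" using J(3) w fin by simp
      ultimately have "good ?I" using Suc I by blast
      then have "good (insert w (?I - {u}))"
        using good_swap[OF _ I, of u w] w J(1) u by blast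
      moreover have "insert w (?I - {u}) = J" using u(2) w(1) by blast
      ultimately show "good J" by simp
    qed
  qed
  then show ?thesis using assms by blast
qed

text \<open>If \<open>x\<close> in \<open>W D\<close> is a sum of vectors from the cut subspaces,
  then these vectors together with \<open>- x\<close> at index \<open>n\<close> form a relation on
  \<open>insert n D\<close>. Row \<open>n\<close> of an array trivialising it expresses
  \<open>x\<close> through the \<open>W (D - {q})\<close>.\<close>

lemma W_Int_cut:
  assumes D: "D \<subseteq> {1..n} - {n}"
  shows "W D \<inter> span (\<Union>j\<in>D. W (insert n (D - {j}))) = W' D"
proof
  show "W' D \<subseteq> W D \<inter> span (\<Union>j\<in>D. W (insert n (D - {j})))"
    using W'_subset unfolding W'_def by (intro Int_greatest span_mono UN_mono W_mono) auto
  show "W D \<inter> span (\<Union>j\<in>D. W (insert n (D - {j}))) \<subseteq> W' D"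
  proof
    fix x assume "x \<in> W D \<inter> span (\<Union>j\<in>D. W (insert n (D - {j})))"
    then have x: "x \<in> W D" "x \<in> span (\<Union>j\<in>D. W (insert n (D - {j})))" by auto
    have fin: "finite D" using D finite_subset by blast
    have nD: "n \<notin> D" using D by blast
    obtain f where f: "\<forall>j\<in>D. f j \<in> W (insert n (D - {j}))" "x = (\<Sum>j\<in>D. f j)"
      using span_UN_subspaces[OF fin _ x(2)] subspace_W by blast
    let ?J = "insert n D"
    have good: "good ?J"
      using D n_pos fin nD by (intro good_all[of ?J "card D"]) auto
    define y where "y j = (if j = n then - x else f j)" for j
    have y_mem: "y j \<in> W (?J - {j})" if "j \<in> ?J" for j
    proof (cases "j = n")
      case True
      have "?J - {n} = D" using nD by blast
      then show ?thesis using True x(1) subspace_neg[OF subspace_W] by (simp add: y_def)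
    next
      case False
      then have j: "j \<in> D" using that by blast
      have "f j \<in> W (insert n (D - {j}))" using f(1) j by blast
      also have "insert n (D - {j}) = ?J - {j}" using False by blast
      finally show ?thesis using False by (simp add: y_def)
    qed
    have "(\<Sum>j\<in>D. y j) = x"
      unfolding f(2) by (rule sum.cong[OF refl]) (use nD in \<open>auto simp: y_def\<close>)
    then have y_sum: "(\<Sum>j\<in>?J. y j) = 0" using fin nD by (simp add: y_def)
    obtain z where z: "\<And>p q. p \<in> ?J \<Longrightarrow> q \<in> ?J \<Longrightarrow> z p q \<in> W (?J - {p, q})"
        "\<And>p q. p \<in> ?J \<Longrightarrow> q \<in> ?J \<Longrightarrow> z p q = - z q p"
        "\<And>p. p \<in> ?J \<Longrightarrow> z p p = 0" "\<And>p. p \<in> ?J \<Longrightarrow> y p = (\<Sum>q\<in>?J. z p q)"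
      using goodE[OF good y_mem y_sum] by blast
    have "- x = (\<Sum>q\<in>D. z n q)"
      using z(4)[of n] z(3)[of n] fin nD by (simp add: y_def)
    then have xe: "x = - (\<Sum>q\<in>D. z n q)" by (metis minus_minus)
    have "z n q \<in> W (D - {q})" if "q \<in> D" for q
    proof -
      have "z n q \<in> W (?J - {n, q})" using z(1)[of n q] that by blast
      also have "?J - {n, q} = D - {q}" using nD by blast
      finally show ?thesis .
    qed
    then have "z n q \<in> W' D" if "q \<in> D" for q
      unfolding W'_def using that by (intro span_base) blast
    then show "x \<in> W' D"
      unfolding xe by (intro subspace_neg[OF subspace_W'] subspace_sum[OF subspace_W'])
  qed
qed

text \<open>\<open>W' (insert n D)\<close> is the sum of \<open>W D\<close> and \<open>S\<close>,
  and these intersect in \<open>W' D\<close>. By the dimension formula the contributions of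
  \<open>W D\<close> and \<open>W' D\<close> cancel, leaving the dimension of
  \<open>W (insert n D)\<close> minus that of \<open>S\<close>.\<close>

lemma g_add_insert_n:
  assumes D: "D \<subseteq> {1..n} - {n}"
  shows "g D + g (insert n D) = card {b \<in> B. L b = D}"
proof -
  define S where "S = span (\<Union>j\<in>D. W (insert n (D - {j})))"
  have nD: "n \<notin> D" using D by blast
  have S: "S = span {b \<in> B. L b \<subset> D}" unfolding S_def by (rule span_W_cut[OF D])
  have ind: "independent X" if "X \<subseteq> B" for X
    using independent_mono[OF independent_B that] .
  have dimS: "dim S = card {b \<in> B. L b \<subset> D}"
    unfolding S by (rule dim_span_eq_card_independent) (rule ind, blast)
  have dimW: "dim (W (insert n D)) = card {b \<in> B. L b \<subseteq> D}"
    unfolding W_insert_n[OF D] by (rule dim_span_eq_card_independent) (rule ind, blast)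
  have subS: "S \<subseteq> span B" unfolding S by (rule span_mono) blast
  have W'J: "W' (insert n D) = span (W D \<union> S)"
  proof -
    have "insert n D - {n} = D" using nD by blast
    moreover have "(\<Union>j\<in>D. W (insert n D - {j})) = (\<Union>j\<in>D. W (insert n (D - {j})))"
    proof (intro SUP_cong refl)
      fix j assume "j \<in> D"
      then have "insert n D - {j} = insert n (D - {j})" using nD by blast
      then show "W (insert n D - {j}) = W (insert n (D - {j}))" by simp
    qed
    ultimately have "W' (insert n D) = span (W D \<union> (\<Union>j\<in>D. W (insert n (D - {j}))))"
      unfolding W'_def by simp
    also have "\<dots> = span (W D \<union> S)"
      unfolding S_def span_Un span_span by simp
    finally show ?thesis .
  qed
  have "dim (W D \<union> S) + dim (W D \<inter> S) = dim (W D) + dim S"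
    by (rule dim_Un_Int_finite[OF subspace_W _ W_subset subS finite_B]) (simp add: S_def subspace_span)
  then have 1: "dim (W' (insert n D)) + dim (W' D) = dim (W D) + card {b \<in> B. L b \<subset> D}"
    unfolding W'J dim_span using W_Int_cut[OF D] dimS by (simp add: S_def)
  have "{b \<in> B. L b \<subseteq> D} = {b \<in> B. L b \<subset> D} \<union> {b \<in> B. L b = D}" by blast
  moreover have "card ({b \<in> B. L b \<subset> D} \<union> {b \<in> B. L b = D})
      = card {b \<in> B. L b \<subset> D} + card {b \<in> B. L b = D}"
    using finite_B by (intro card_Un_disjoint) auto
  ultimately have 2: "card {b \<in> B. L b \<subseteq> D} = card {b \<in> B. L b \<subset> D} + card {b \<in> B. L b = D}"
    by simp
  have le: "dim (W' J) \<le> dim (W J)" for J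
    using W'_subset span_superset by (intro dim_mono_finite[OF _ W_subset finite_B]) blast
  show ?thesis
    using 1 2 dimW le[of D] le[of "insert n D"] unfolding g_def by linarith
qed

end

section \<open>The seminormal representation on standard tableaux\<close>

definition fscale :: "real \<Rightarrow> ('x \<Rightarrow> real) \<Rightarrow> 'x \<Rightarrow> real" where
  "fscale a f = (\<lambda>x. a * f x)"

interpretation fv: vector_space fscale
  by standard (auto simp: fscale_def fun_eq_iff algebra_simps)

lemma linear_fscaleI:
  assumes "\<And>f g. F (f + g) = F f + F g" "\<And>a f. F (fscale a f) = fscale a (F f)"
  shows "Vector_Spaces.linear fscale fscale F"
  by standard (simp_all add: assms)

text \<open>The composition with descent set \<open>D\<close> cuts the numbers into blocks, each
  ending at an element of \<open>D\<close>. Blocks are numbered from 1 so that the numbers are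
  admissible entries of semistandard tableaux.\<close>

definition blk :: "nat set \<Rightarrow> nat \<Rightarrow> nat" where
  "blk D k = Suc (card {d \<in> D. d < k})"

lemma blk_mono: "finite D \<Longrightarrow> k \<le> l \<Longrightarrow> blk D k \<le> blk D l"
  unfolding blk_def by (simp add: card_mono Collect_mono_iff subset_eq)

lemma blk_Suc: "finite D \<Longrightarrow> blk D (Suc i) = (if i \<in> D then Suc (blk D i) else blk D i)"
proof -
  assume "finite D"
  have "{d \<in> D. d < Suc i} = (if i \<in> D then insert i {d \<in> D. d < i} else {d \<in> D. d < i})"
    by (auto simp: less_Suc_eq)
  then show ?thesis using \<open>finite D\<close> by (simp add: blk_def)
qed

lemma finite_skew_cells: "finite (skew_cells la mu)"
proof (rule finite_subset)
  show "skew_cells la mu \<subseteq> (SIGMA i:{..<length la}. {..<la ! i})" by (auto simp: skew_cells_def)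
qed simp

lemma finite_SYT: "finite (SYT la mu)"
proof (rule finite_subset)
  let ?C = "skew_cells la mu"
  show "SYT la mu \<subseteq> {f. \<forall>c. (c \<in> ?C \<longrightarrow> f c \<in> {1..card ?C}) \<and> (c \<notin> ?C \<longrightarrow> f c = 0)}"
    unfolding SYT_def bij_betw_def by blast
  show "finite {f. \<forall>c. (c \<in> ?C \<longrightarrow> f c \<in> {1..card ?C}) \<and> (c \<notin> ?C \<longrightarrow> f c = (0::nat))}"
    by (rule finite_set_of_finite_funs[OF finite_skew_cells]) simp
qed

section \<open>Standard tableaux, contents and exchanges of consecutive entries\<close>

locale partition_shape =
  fixes la :: "nat list"
  assumes partition: "is_partition la"
begin

abbreviation cells :: "(nat \<times> nat) set" where "cells \<equiv> skew_cells la []"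
abbreviation N :: nat where "N \<equiv> card cells"
abbreviation tabs :: "((nat \<times> nat) \<Rightarrow> nat) set" where "tabs \<equiv> SYT la []"
abbreviation DT :: "((nat \<times> nat) \<Rightarrow> nat) \<Rightarrow> nat set" where "DT \<equiv> DesT la []"

definition pos :: "((nat \<times> nat) \<Rightarrow> nat) \<Rightarrow> nat \<Rightarrow> nat \<times> nat" where
  "pos T k = inv_into cells T k"

text \<open>The content of the cell holding \<open>k\<close>; differences of contents are axial
  distances.\<close>

definition ct :: "((nat \<times> nat) \<Rightarrow> nat) \<Rightarrow> nat \<Rightarrow> int" where
  "ct T k = int (snd (pos T k)) - int (fst (pos T k))"

definition swap :: "nat \<Rightarrow> ((nat \<times> nat) \<Rightarrow> nat) \<Rightarrow> ((nat \<times> nat) \<Rightarrow> nat)" where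
  "swap i T = transpose i (Suc i) \<circ> T"

lemma cells_iff: "(i, j) \<in> cells \<longleftrightarrow> i < length la \<and> j < la ! i"
  by (simp add: skew_cells_def)

lemma cells_down: "(i, j) \<in> cells \<Longrightarrow> i' \<le> i \<Longrightarrow> j' \<le> j \<Longrightarrow> (i', j') \<in> cells"
proof -
  assume a: "(i, j) \<in> cells" "i' \<le> i" "j' \<le> j"
  have "la ! i \<le> la ! i'"
  proof (cases "i' = i")
    case False
    then show ?thesis
      using partition a by (simp add: is_partition_def cells_iff sorted_wrt_iff_nth_less)
  qed simp
  then show ?thesis using a by (simp add: cells_iff)
qed

lemma tabs_bij: "T \<in> tabs \<Longrightarrow> bij_betw T cells {1..N}"
  by (simp add: SYT_def)

lemma tabs_outside: "T \<in> tabs \<Longrightarrow> c \<notin> cells \<Longrightarrow> T c = 0"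
  unfolding SYT_def by blast

lemma tabs_row: "T \<in> tabs \<Longrightarrow> (i, j + k) \<in> cells \<Longrightarrow> T (i, j) + k \<le> T (i, j + k)"
proof (induction k)
  case (Suc k)
  have 1: "(i, j + k) \<in> cells" "(i, j + k + 1) \<in> cells"
    using Suc.prems(2) cells_down[OF Suc.prems(2)] by auto
  then have "T (i, j + k) < T (i, j + k + 1)" using Suc.prems(1) unfolding SYT_def by blast
  then show ?case using Suc 1(1) by simp
qed simp

lemma tabs_col: "T \<in> tabs \<Longrightarrow> (i + k, j) \<in> cells \<Longrightarrow> T (i, j) + k \<le> T (i + k, j)"
proof (induction k)
  case (Suc k)
  have 1: "(i + k, j) \<in> cells" "(i + k + 1, j) \<in> cells"
    using Suc.prems(2) cells_down[OF Suc.prems(2)] by auto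
  then have "T (i + k, j) < T (i + k + 1, j)" using Suc.prems(1) unfolding SYT_def by blast
  then show ?case using Suc 1(1) by simp
qed simp

lemma tabs_le:
  assumes T: "T \<in> tabs" and c: "(i', j') \<in> cells" and le: "i \<le> i'" "j \<le> j'"
  shows "T (i, j) + (i' - i) + (j' - j) \<le> T (i', j')"
proof -
  have "(i, j + (j' - j)) \<in> cells" using cells_down[OF c] le by simp
  from tabs_row[OF T this] have "T (i, j) + (j' - j) \<le> T (i, j')" using le by simp
  moreover have "T (i, j') + (i' - i) \<le> T (i', j')" using tabs_col[OF T, of i "i' - i" j'] c le by simp
  ultimately show ?thesis by simp
qed

lemma pos_mem:
  assumes "bij_betw T cells {1..N}" "k \<in> {1..N}"
  shows "pos T k \<in> cells" "T (pos T k) = k"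
  using assms unfolding pos_def bij_betw_def by (auto intro: inv_into_into f_inv_into_f)

lemma pos_eq:
  assumes "bij_betw T cells {1..N}" "c \<in> cells"
  shows "pos T (T c) = c"
  using assms unfolding pos_def bij_betw_def by simp

lemma swap_bij:
  assumes "bij_betw T cells {1..N}" "1 \<le> i" "i < N"
  shows "bij_betw (swap i T) cells {1..N}"
proof -
  have "transpose i (Suc i) permutes {1..N}"
    using assms by (intro permutes_swap_id) auto
  then show ?thesis
    unfolding swap_def using assms(1) bij_betw_trans permutes_imp_bij by blast
qed

lemma swap_swap: "swap i (swap i T) = T"
  by (simp add: swap_def o_assoc)

lemma pos_swap:
  assumes "bij_betw T cells {1..N}" "1 \<le> i" "i < N" "k \<in> {1..N}"
  shows "pos (swap i T) k = pos T (transpose i (Suc i) k)"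
proof -
  have "transpose i (Suc i) permutes {1..N}"
    using assms by (intro permutes_swap_id) auto
  then have m: "transpose i (Suc i) k \<in> {1..N}" using assms(4) permutes_in_image by metis
  have "swap i T (pos T (transpose i (Suc i) k)) = k"
    using pos_mem(2)[OF assms(1) m] by (simp add: swap_def)
  then show ?thesis
    using pos_eq[OF swap_bij[OF assms(1-3)] pos_mem(1)[OF assms(1) m]] by simp
qed

lemma ct_swap:
  assumes "T \<in> tabs" "1 \<le> i" "i < N" "k \<in> {1..N}"
  shows "ct (swap i T) k = ct T (transpose i (Suc i) k)"
  using pos_swap[OF tabs_bij[OF assms(1)] assms(2-4)] by (simp add: ct_def)

text \<open>The later of two cells on one diagonal lies strictly south-east of the earlier one, and
  the cells to the right of and below the earlier one carry two distinct intermediate entries. Hence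
  the axial distances among \<open>i\<close>, \<open>i + 1\<close>, \<open>i + 2\<close> never
  vanish.\<close>

lemma ct_eq_imp_gap:
  assumes T: "T \<in> tabs" and k: "k \<in> {1..N}" and l: "l \<in> {1..N}" and "k < l" "ct T k = ct T l"
  shows "k + 3 \<le> l"
proof -
  obtain r c where p: "pos T k = (r, c)" by fastforce
  obtain r' c' where q: "pos T l = (r', c')" by fastforce
  have pq: "(r, c) \<in> cells" "T (r, c) = k" "(r', c') \<in> cells" "T (r', c') = l"
    using pos_mem[OF tabs_bij[OF T]] k l p q by metis+
  have eq: "int c - int r = int c' - int r'" using assms(5) by (simp add: ct_def p q)
  have "r < r'"
  proof (rule ccontr)
    assume "\<not> r < r'"
    then have "r' \<le> r" "c' \<le> c" using eq by auto
    then show False using tabs_le[OF T pq(1)] pq \<open>k < l\<close> by fastforce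
  qed
  then have le: "r + 1 \<le> r'" "c + 1 \<le> c'" using eq by auto
  have in1: "(r + 1, c + 1) \<in> cells" "(r, c + 1) \<in> cells" "(r + 1, c) \<in> cells"
    using cells_down[OF pq(3)] le by auto
  have "(r, c + 1) \<noteq> (r + 1, c)" by simp
  then have ne: "T (r, c + 1) \<noteq> T (r + 1, c)"
    using in1 tabs_bij[OF T] unfolding bij_betw_def inj_on_def by blast
  have "T (r, c) < T (r, c + 1)" "T (r, c) < T (r + 1, c)"
      "T (r, c + 1) < T (r + 1, c + 1)" "T (r + 1, c) < T (r + 1, c + 1)"
    using tabs_le[OF T in1(2), of r c] tabs_le[OF T in1(3), of r c]
      tabs_le[OF T in1(1), of r "c + 1"] tabs_le[OF T in1(1), of "r + 1" c] by auto
  moreover have "T (r + 1, c + 1) \<le> T (r', c')" using tabs_le[OF T pq(3) le] by simp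
  ultimately show ?thesis using pq ne by linarith
qed

lemma ct_Suc_neq:
  assumes "T \<in> tabs" "1 \<le> i" "i < N"
  shows "ct T (Suc i) \<noteq> ct T i"
  using ct_eq_imp_gap[OF assms(1), of i "Suc i"] assms(2,3) by auto

lemma ct_Suc_Suc_neq:
  assumes "T \<in> tabs" "1 \<le> i" "Suc i < N"
  shows "ct T (Suc (Suc i)) \<noteq> ct T i"
  using ct_eq_imp_gap[OF assms(1), of i "Suc (Suc i)"] assms(2,3) by auto

text \<open>Any other cell on the next diagonal lies weakly north-west of the cell of
  \<open>i\<close>, or so far south-east of it that further entries come in between.\<close>

lemma ct_Suc_right:
  assumes T: "T \<in> tabs" and i: "1 \<le> i" "i < N" and "ct T (Suc i) - ct T i = 1"
    and p: "pos T i = (r, c)"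
  shows "pos T (Suc i) = (r, c + 1)"
proof -
  obtain r' c' where q: "pos T (Suc i) = (r', c')" by fastforce
  have pq: "(r, c) \<in> cells" "T (r, c) = i" "(r', c') \<in> cells" "T (r', c') = Suc i"
    using pos_mem[OF tabs_bij[OF T], of i] pos_mem[OF tabs_bij[OF T], of "Suc i"] i p q by auto
  have eq: "int c' - int r' = int c - int r + 1" using assms(4) by (simp add: ct_def p q)
  have "\<not> (r' < r)"
    using tabs_le[OF T pq(1), of r' c'] pq eq by auto
  moreover have "\<not> (r < r')"
    using tabs_le[OF T pq(3), of r c] pq eq by auto
  ultimately show ?thesis using eq q by simp
qed

lemma ct_Suc_below:
  assumes T: "T \<in> tabs" and i: "1 \<le> i" "i < N" and "ct T (Suc i) - ct T i = -1"
    and p: "pos T i = (r, c)"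
  shows "pos T (Suc i) = (r + 1, c)"
proof -
  obtain r' c' where q: "pos T (Suc i) = (r', c')" by fastforce
  have pq: "(r, c) \<in> cells" "T (r, c) = i" "(r', c') \<in> cells" "T (r', c') = Suc i"
    using pos_mem[OF tabs_bij[OF T], of i] pos_mem[OF tabs_bij[OF T], of "Suc i"] i p q by auto
  have eq: "int c' - int r' = int c - int r - 1" using assms(4) by (simp add: ct_def p q)
  have "\<not> (c' < c)"
    using tabs_le[OF T pq(1), of r' c'] pq eq by auto
  moreover have "\<not> (c < c')"
    using tabs_le[OF T pq(3), of r c] pq eq by auto
  ultimately show ?thesis using eq q by simp
qed

lemma transpose_Suc_less:
  assumes "x < (y::nat)" "\<not> (x = i \<and> y = Suc i)"
  shows "transpose i (Suc i) x < transpose i (Suc i) y"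
  using assms by (auto simp: transpose_def)

lemma swap_mem_iff:
  assumes T: "T \<in> tabs" and i: "1 \<le> i" "i < N"
  shows "swap i T \<in> tabs \<longleftrightarrow> \<bar>ct T (Suc i) - ct T i\<bar> \<noteq> 1"
proof
  obtain r c where p: "pos T i = (r, c)" by fastforce
  note pm = pos_mem[OF tabs_bij[OF T], of i] pos_mem[OF tabs_bij[OF T], of "Suc i"]
  assume S: "swap i T \<in> tabs"
  show "\<bar>ct T (Suc i) - ct T i\<bar> \<noteq> 1"
  proof
    assume "\<bar>ct T (Suc i) - ct T i\<bar> = 1"
    then consider "ct T (Suc i) - ct T i = 1" | "ct T (Suc i) - ct T i = -1" by linarith
    then have q: "pos T (Suc i) = (r, c + 1) \<or> pos T (Suc i) = (r + 1, c)"
      using ct_Suc_right[OF T i _ p] ct_Suc_below[OF T i _ p] by cases auto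
    have q1: "pos T (Suc i) \<in> cells" using pm i by simp
    have "swap i T (r, c) < swap i T (pos T (Suc i))"
      using q tabs_le[OF S, of r "c + 1" r c] tabs_le[OF S, of "r + 1" c r c] q1 by auto
    then show False using pm i p by (simp add: swap_def)
  qed
next
  assume nadj: "\<bar>ct T (Suc i) - ct T i\<bar> \<noteq> 1"
  have adj: "\<not> (T (r, c) = i \<and> T (r', c') = Suc i)"
    if "(r, c) \<in> cells" "(r', c') \<in> cells" "r' = r \<and> c' = c + 1 \<or> r' = r + 1 \<and> c' = c" for r c r' c'
  proof
    assume "T (r, c) = i \<and> T (r', c') = Suc i"
    then have "pos T i = (r, c)" "pos T (Suc i) = (r', c')"
      using pos_eq[OF tabs_bij[OF T]] that(1,2) by metis+
    then show False using nadj that(3) by (auto simp: ct_def)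
  qed
  show "swap i T \<in> tabs"
    unfolding SYT_def
  proof (intro CollectI conjI allI impI)
    show "bij_betw (swap i T) cells {1..N}" by (rule swap_bij[OF tabs_bij[OF T] i])
    show "swap i T c = 0" if "c \<notin> cells" for c
      using tabs_outside[OF T that] i by (simp add: swap_def transpose_def)
    show "swap i T (r, c) < swap i T (r, c + 1)" if "(r, c) \<in> cells \<and> (r, c + 1) \<in> cells" for r c
      unfolding swap_def comp_apply
      using that tabs_row[OF T, of r c 1] adj[of r c r "c + 1"] by (intro transpose_Suc_less) auto
    show "swap i T (r, c) < swap i T (r + 1, c)" if "(r, c) \<in> cells \<and> (r + 1, c) \<in> cells" for r c
      unfolding swap_def comp_apply
      using that tabs_col[OF T, of r 1 c] adj[of r c "r + 1" c] by (intro transpose_Suc_less) auto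
  qed
qed

section \<open>The simple transpositions and their Coxeter relations\<close>

definition tvec :: "(((nat \<times> nat) \<Rightarrow> nat) \<Rightarrow> real) set" where
  "tvec = {\<phi>. \<forall>T. T \<notin> tabs \<longrightarrow> \<phi> T = 0}"

text \<open>The action of the i-th simple transposition in the seminormal form, normalised such that a
  function is fixed iff it takes equal values on \<open>T\<close> and \<open>swap i T\<close> unless \<open>Suc i\<close> stands
  immediately to the right of \<open>i\<close>; \<open>ax\<close> is the inverse axial distance.\<close>

definition ax :: "nat \<Rightarrow> ((nat \<times> nat) \<Rightarrow> nat) \<Rightarrow> real" where
  "ax i T = 1 / of_int (ct T (Suc i) - ct T i)"

definition op :: "nat \<Rightarrow> (((nat \<times> nat) \<Rightarrow> nat) \<Rightarrow> real) \<Rightarrow> ((nat \<times> nat) \<Rightarrow> nat) \<Rightarrow> real" where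
  "op i \<phi> T = (if T \<in> tabs then ax i T * \<phi> T + (1 - ax i T) * \<phi> (swap i T) else 0)"

lemma op_tvec: "op i \<phi> \<in> tvec"
  by (simp add: op_def tvec_def)

lemma tvec_outside: "\<phi> \<in> tvec \<Longrightarrow> T \<notin> tabs \<Longrightarrow> \<phi> T = 0"
  by (simp add: tvec_def)

text \<open>A polynomial condition on \<open>ax\<close>, in the form required by the ring
  computations for the Coxeter relations.\<close>

lemma swap_tabs_iff:
  assumes "T \<in> tabs" "1 \<le> i" "i < N"
  shows "swap i T \<in> tabs \<longleftrightarrow> ax i T * ax i T \<noteq> 1"
proof -
  define d where "d = real_of_int (ct T (Suc i) - ct T i)"
  have "d \<noteq> 0" using ct_Suc_neq[OF assms] by (simp add: d_def)
  then have "ax i T * ax i T = 1 \<longleftrightarrow> d\<^sup>2 = 1"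
    unfolding ax_def d_def[symmetric] by (auto simp: power2_eq_square divide_simps)
  also have "\<dots> \<longleftrightarrow> \<bar>ct T (Suc i) - ct T i\<bar> = 1"
    unfolding power2_eq_1_iff d_def by linarith
  finally show ?thesis using swap_mem_iff[OF assms] by blast
qed

lemma op_op:
  assumes \<phi>: "\<phi> \<in> tvec" and i: "1 \<le> i" "i < N"
  shows "op i (op i \<phi>) = \<phi>"
proof
  fix T
  show "op i (op i \<phi>) T = \<phi> T"
  proof (cases "T \<in> tabs")
    case T: True
    show ?thesis
    proof (cases "swap i T \<in> tabs")
      case True
      have "ax i (swap i T) = - ax i T"
        unfolding ax_def using ct_swap[OF T i] i by (simp add: minus_divide_right)
      then show ?thesis
        using T True by (simp add: op_def swap_swap algebra_simps)
    next
      case False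
      then have "ax i T * ax i T = 1" using swap_tabs_iff[OF T i] by blast
      then show ?thesis
        using T False tvec_outside[OF \<phi> False] by (simp add: op_def mult.assoc[symmetric])
    qed
  qed (simp add: op_def tvec_outside[OF \<phi>])
qed

lemma swap_commute: "Suc i < k \<Longrightarrow> swap i (swap k T) = swap k (swap i T)"
  by (rule ext) (simp add: swap_def transpose_def)

lemma op_commute:
  assumes \<phi>: "\<phi> \<in> tvec" and i: "1 \<le> i" "Suc i < k" "k < N"
  shows "op i (op k \<phi>) = op k (op i \<phi>)"
proof
  fix T
  show "op i (op k \<phi>) T = op k (op i \<phi>) T"
  proof (cases "T \<in> tabs")
    case T: True
    have i': "1 \<le> i" "i < N" and k': "1 \<le> k" "k < N" using i by auto
    have di: "ax i (swap k T) = ax i T" and dk: "ax k (swap i T) = ax k T"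
      unfolding ax_def using ct_swap[OF T k'] ct_swap[OF T i'] i by (auto simp: transpose_def)
    have sw: "swap k (swap i T) = swap i (swap k T)" using swap_commute[OF i(2)] by simp
    note iffs = swap_tabs_iff[OF T i'] swap_tabs_iff[OF T k']
    have 1: "swap i (swap k T) \<in> tabs \<longleftrightarrow> swap i T \<in> tabs" if "swap k T \<in> tabs"
      using swap_tabs_iff[OF that i'] di iffs(1) by simp
    have 2: "swap i (swap k T) \<in> tabs \<longleftrightarrow> swap k T \<in> tabs" if "swap i T \<in> tabs"
      using swap_tabs_iff[OF that k'] dk iffs(2) sw by simp
    show ?thesis
    proof (cases "swap i T \<in> tabs"; cases "swap k T \<in> tabs")
      assume "swap i T \<in> tabs" "swap k T \<in> tabs"
      then show ?thesis using T by (simp add: op_def di dk sw algebra_simps)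
    next
      assume a: "swap i T \<in> tabs" "swap k T \<notin> tabs"
      then show ?thesis
        using T 2[OF a(1)] tvec_outside[OF \<phi>, of "swap i (swap k T)"] tvec_outside[OF \<phi> a(2)]
        by (simp add: op_def di dk sw algebra_simps)
    next
      assume a: "swap i T \<notin> tabs" "swap k T \<in> tabs"
      then show ?thesis
        using T 1[OF a(2)] tvec_outside[OF \<phi>, of "swap i (swap k T)"] tvec_outside[OF \<phi> a(1)]
        by (simp add: op_def di dk sw algebra_simps)
    next
      assume a: "swap i T \<notin> tabs" "swap k T \<notin> tabs"
      then show ?thesis
        using T tvec_outside[OF \<phi> a(1)] tvec_outside[OF \<phi> a(2)] by (simp add: op_def)
    qed
  qed (simp add: op_def)
qed

lemma swap_braid: "swap i (swap (Suc i) (swap i T)) = swap (Suc i) (swap i (swap (Suc i) T))"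
  by (rule ext) (simp add: swap_def transpose_def)

text \<open>Both sides are combinations of the values of \<open>\<phi>\<close> at the six fillings
  obtained by permuting \<open>i\<close>, \<open>i + 1\<close>, \<open>i + 2\<close>. A filling that
  is not standard has value 0, and the inverse axial distance of the exchange leading to it squares
  to 1; the cases record which fillings drop out.\<close>

lemma op_braid:
  assumes \<phi>: "\<phi> \<in> tvec" and i: "1 \<le> i" "Suc i < N"
  shows "op i (op (Suc i) (op i \<phi>)) = op (Suc i) (op i (op (Suc i) \<phi>))"
proof
  fix T
  let ?k = "Suc i"
  show "op i (op ?k (op i \<phi>)) T = op ?k (op i (op ?k \<phi>)) T"
  proof (cases "T \<in> tabs")
    case T: True
    have i': "1 \<le> i" "i < N" and k': "1 \<le> ?k" "?k < N" using i by auto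
    define a b c where "a = ax i T" and "b = ax ?k T" and "c = 1 / real_of_int (ct T (Suc ?k) - ct T i)"
    \<comment> \<open>Axial distances are additive: the reciprocals of \<open>a\<close> and
      \<open>b\<close> add up to that of \<open>c\<close>.\<close>
    have abc: "a * b = c * (a + b)"
    proof -
      define x y z where "x = real_of_int (ct T i)" and "y = real_of_int (ct T ?k)"
        and "z = real_of_int (ct T (Suc ?k))"
      have "y - x \<noteq> 0" "z - y \<noteq> 0" "z - x \<noteq> 0"
        using ct_Suc_neq[OF T i'] ct_Suc_neq[OF T k'] ct_Suc_Suc_neq[OF T i]
        by (auto simp: x_def y_def z_def)
      moreover have "a = 1 / (y - x)" "b = 1 / (z - y)" "c = 1 / (z - x)"
        by (simp_all add: a_def b_def c_def ax_def x_def y_def z_def)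
      ultimately have "a * (y - x) = 1" "b * (z - y) = 1" "c * (z - x) = 1" by simp_all
      then show ?thesis by algebra
    qed
    have ctA: "ct (swap i T) i = ct T ?k" "ct (swap i T) ?k = ct T i"
        "ct (swap i T) (Suc ?k) = ct T (Suc ?k)"
      using ct_swap[OF T i'] i by (auto simp: transpose_def)
    have ctB: "ct (swap ?k T) i = ct T i" "ct (swap ?k T) ?k = ct T (Suc ?k)"
        "ct (swap ?k T) (Suc ?k) = ct T ?k"
      using ct_swap[OF T k'] i by (auto simp: transpose_def)
    have axA: "ax i (swap i T) = - a" "ax ?k (swap i T) = c"
      and axB: "ax ?k (swap ?k T) = - b" "ax i (swap ?k T) = c"
      using ctA ctB by (auto simp: ax_def a_def b_def c_def minus_divide_right)
    have axBA: "ax i (swap ?k (swap i T)) = b" if A: "swap i T \<in> tabs"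
      using ct_swap[OF A k'] ctA i by (simp add: ax_def b_def transpose_def)
    have axAB: "ax ?k (swap i (swap ?k T)) = a" if B: "swap ?k T \<in> tabs"
      using ct_swap[OF B i'] ctB i by (simp add: ax_def a_def transpose_def)
    have stA: "swap i T \<in> tabs \<longleftrightarrow> a * a \<noteq> 1"
      using swap_tabs_iff[OF T i'] by (simp add: a_def)
    have stB: "swap ?k T \<in> tabs \<longleftrightarrow> b * b \<noteq> 1"
      using swap_tabs_iff[OF T k'] by (simp add: b_def)
    have stBA: "swap ?k (swap i T) \<in> tabs \<longleftrightarrow> c * c \<noteq> 1" if "swap i T \<in> tabs"
      using swap_tabs_iff[OF that k'] axA by simp
    have stAB: "swap i (swap ?k T) \<in> tabs \<longleftrightarrow> c * c \<noteq> 1" if "swap ?k T \<in> tabs"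
      using swap_tabs_iff[OF that i'] axB by simp
    have stABA: "swap i (swap ?k (swap i T)) \<in> tabs \<longleftrightarrow> b * b \<noteq> 1"
      if "swap i T \<in> tabs" "swap ?k (swap i T) \<in> tabs"
      using swap_tabs_iff[OF that(2) i'] axBA[OF that(1)] by simp
    have stBAB: "swap ?k (swap i (swap ?k T)) \<in> tabs \<longleftrightarrow> a * a \<noteq> 1"
      if "swap ?k T \<in> tabs" "swap i (swap ?k T) \<in> tabs"
      using swap_tabs_iff[OF that(2) k'] axAB[OF that(1)] by simp
    define p0 pA pB pBA pAB p5 where "p0 = \<phi> T" and "pA = \<phi> (swap i T)" and "pB = \<phi> (swap ?k T)"
      and "pBA = \<phi> (swap ?k (swap i T))" and "pAB = \<phi> (swap i (swap ?k T))"
      and "p5 = \<phi> (swap i (swap ?k (swap i T)))"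
    note ps = p0_def[symmetric] pA_def[symmetric] pB_def[symmetric] pBA_def[symmetric]
      pAB_def[symmetric] p5_def[symmetric]
    have p5': "\<phi> (swap ?k (swap i (swap ?k T))) = p5" by (simp add: p5_def swap_braid)
    note ab = a_def[symmetric] b_def[symmetric]
    show ?thesis
    proof (cases "swap i T \<in> tabs"; cases "swap ?k T \<in> tabs")
      assume A: "swap i T \<in> tabs" and B: "swap ?k T \<in> tabs"
      show ?thesis
      proof (cases "swap ?k (swap i T) \<in> tabs")
        case BA: True
        then have AB: "swap i (swap ?k T) \<in> tabs" using stBA[OF A] stAB[OF B] by simp
        have "op i (op ?k (op i \<phi>)) T = a * (b * (a * p0 + (1 - a) * pA) + (1 - b) * (c * pB + (1 - c) * pAB))
            + (1 - a) * (c * (- a * pA + (1 + a) * p0) + (1 - c) * (b * pBA + (1 - b) * p5))"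
          by (simp add: op_def T A B BA axA axB axBA[OF A] ab swap_swap ps)
        moreover have "op ?k (op i (op ?k \<phi>)) T = b * (a * (b * p0 + (1 - b) * pB) + (1 - a) * (c * pA + (1 - c) * pBA))
            + (1 - b) * (c * (- b * pB + (1 + b) * p0) + (1 - c) * (a * pAB + (1 - a) * p5))"
          by (simp add: op_def T A B AB axA axB axAB[OF B] ab swap_swap ps p5')
        ultimately show ?thesis using abc by algebra
      next
        case BA: False
        then have AB: "swap i (swap ?k T) \<notin> tabs" using stBA[OF A] stAB[OF B] by simp
        have z: "pBA = 0" "pAB = 0"
          using tvec_outside[OF \<phi>] BA AB by (auto simp: pBA_def pAB_def)
        have "op i (op ?k (op i \<phi>)) T = a * (b * (a * p0 + (1 - a) * pA) + (1 - b) * (c * pB))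
            + (1 - a) * (c * (- a * pA + (1 + a) * p0))"
          by (simp add: op_def T A B BA axA axB ab swap_swap ps z)
        moreover have "op ?k (op i (op ?k \<phi>)) T = b * (a * (b * p0 + (1 - b) * pB) + (1 - a) * (c * pA))
            + (1 - b) * (c * (- b * pB + (1 + b) * p0))"
          by (simp add: op_def T A B AB axA axB ab swap_swap ps z)
        ultimately show ?thesis using abc by algebra
      qed
    next
      assume A: "swap i T \<in> tabs" and B: "swap ?k T \<notin> tabs"
      have z: "pB = 0" using tvec_outside[OF \<phi> B] by (simp add: pB_def)
      have bb: "b * b = 1" using B stB by blast
      show ?thesis
      proof (cases "swap ?k (swap i T) \<in> tabs")
        case BA: True
        then have ABA: "swap i (swap ?k (swap i T)) \<notin> tabs" using stABA[OF A] bb by blast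
        have z5: "p5 = 0" using tvec_outside[OF \<phi> ABA] by (simp add: p5_def)
        have "op i (op ?k (op i \<phi>)) T = a * (b * (a * p0 + (1 - a) * pA))
            + (1 - a) * (c * (- a * pA + (1 + a) * p0) + (1 - c) * (b * pBA))"
          by (simp add: op_def T A B BA axA axBA[OF A] ab swap_swap ps z z5)
        moreover have "op ?k (op i (op ?k \<phi>)) T = b * (a * (b * p0) + (1 - a) * (c * pA + (1 - c) * pBA))"
          by (simp add: op_def T A B axA ab swap_swap ps z)
        ultimately show ?thesis using abc bb by algebra
      next
        case BA: False
        have z2: "pBA = 0" using tvec_outside[OF \<phi> BA] by (simp add: pBA_def)
        have "op i (op ?k (op i \<phi>)) T = a * (b * (a * p0 + (1 - a) * pA))
            + (1 - a) * (c * (- a * pA + (1 + a) * p0))"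
          by (simp add: op_def T A B BA axA ab swap_swap ps z)
        moreover have "op ?k (op i (op ?k \<phi>)) T = b * (a * (b * p0) + (1 - a) * (c * pA))"
          by (simp add: op_def T A B axA ab swap_swap ps z z2)
        ultimately show ?thesis using abc bb by algebra
      qed
    next
      assume A: "swap i T \<notin> tabs" and B: "swap ?k T \<in> tabs"
      have z: "pA = 0" using tvec_outside[OF \<phi> A] by (simp add: pA_def)
      have aa: "a * a = 1" using A stA by blast
      show ?thesis
      proof (cases "swap i (swap ?k T) \<in> tabs")
        case AB: True
        then have BAB: "swap ?k (swap i (swap ?k T)) \<notin> tabs" using stBAB[OF B] aa by blast
        have z5: "p5 = 0" using tvec_outside[OF \<phi> BAB] by (simp add: p5')
        have "op ?k (op i (op ?k \<phi>)) T = b * (a * (b * p0 + (1 - b) * pB))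
            + (1 - b) * (c * (- b * pB + (1 + b) * p0) + (1 - c) * (a * pAB))"
          by (simp add: op_def T A B AB axB axAB[OF B] ab swap_swap ps p5' z z5)
        moreover have "op i (op ?k (op i \<phi>)) T = a * (b * (a * p0) + (1 - b) * (c * pB + (1 - c) * pAB))"
          by (simp add: op_def T A B axB ab swap_swap ps z)
        ultimately show ?thesis using abc aa by algebra
      next
        case AB: False
        have z2: "pAB = 0" using tvec_outside[OF \<phi> AB] by (simp add: pAB_def)
        have "op ?k (op i (op ?k \<phi>)) T = b * (a * (b * p0 + (1 - b) * pB))
            + (1 - b) * (c * (- b * pB + (1 + b) * p0))"
          by (simp add: op_def T A B AB axB ab swap_swap ps z)
        moreover have "op i (op ?k (op i \<phi>)) T = a * (b * (a * p0) + (1 - b) * (c * pB))"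
          by (simp add: op_def T A B axB ab swap_swap ps z z2)
        ultimately show ?thesis using abc aa by algebra
      qed
    next
      assume A: "swap i T \<notin> tabs" and B: "swap ?k T \<notin> tabs"
      have z: "pA = 0" "pB = 0" using tvec_outside[OF \<phi>] A B by (auto simp: pA_def pB_def)
      have aa: "a * a = 1" "b * b = 1" using A B stA stB by blast+
      have "op i (op ?k (op i \<phi>)) T = a * (b * (a * p0))" "op ?k (op i (op ?k \<phi>)) T = b * (a * (b * p0))"
        by (simp_all add: op_def T A B ab ps z)
      \<comment> \<open>Here \<open>i\<close>, \<open>i + 1\<close>, \<open>i + 2\<close> are
        consecutive in one row or in one column, so the two signs agree.\<close>
      moreover have "a = b"
      proof -
        have "(a - b) * (a + b) = 0" using aa by (simp add: algebra_simps)
        moreover have "a + b \<noteq> 0" using abc aa by auto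
        ultimately show ?thesis by simp
      qed
      ultimately show ?thesis by simp
    qed
  qed (simp add: op_def)
qed

section \<open>The Coxeter element and the cyclic family of fixed spaces\<close>

text \<open>\<open>opP m\<close> applies the generators with indices \<open>m\<close> down to 1, and
  is the Coxeter element for \<open>m = N - 1\<close>. Below, \<open>opQ m\<close> is its inverse on
  \<open>tvec\<close> and \<open>opR m\<close> the same product with all indices raised by
  one.\<close>

fun opP where
  "opP 0 \<phi> = \<phi>"
| "opP (Suc m) \<phi> = opP m (op (Suc m) \<phi>)"

fun opQ where
  "opQ 0 \<phi> = \<phi>"
| "opQ (Suc m) \<phi> = op (Suc m) (opQ m \<phi>)"

fun opR where
  "opR 0 \<phi> = \<phi>"
| "opR (Suc m) \<phi> = opR m (op (Suc (Suc m)) \<phi>)"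

lemma opP_tvec: "\<phi> \<in> tvec \<Longrightarrow> opP m \<phi> \<in> tvec"
  by (induction m arbitrary: \<phi>) (simp_all add: op_tvec)

lemma opQ_tvec: "\<phi> \<in> tvec \<Longrightarrow> opQ m \<phi> \<in> tvec"
  by (induction m) (simp_all add: op_tvec)

lemma opP_opQ: "\<phi> \<in> tvec \<Longrightarrow> m < N \<Longrightarrow> opP m (opQ m \<phi>) = \<phi>"
proof (induction m)
  case (Suc m)
  then show ?case using op_op[OF opQ_tvec[OF Suc.prems(1)], of "Suc m" m] by simp
qed simp

lemma opQ_opP: "\<phi> \<in> tvec \<Longrightarrow> m < N \<Longrightarrow> opQ m (opP m \<phi>) = \<phi>"
proof (induction m arbitrary: \<phi>)
  case (Suc m)
  then show ?case using Suc.IH[OF op_tvec, of "Suc m" \<phi>] op_op[OF Suc.prems(1), of "Suc m"] by simp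
qed simp

lemma op_opP_commute:
  "\<phi> \<in> tvec \<Longrightarrow> Suc m < k \<Longrightarrow> k < N \<Longrightarrow> op k (opP m \<phi>) = opP m (op k \<phi>)"
proof (induction m arbitrary: \<phi>)
  case (Suc m)
  then show ?case
    using Suc.IH[OF op_tvec, of "Suc m" \<phi>] op_commute[OF Suc.prems(1), of "Suc m" k] by simp
qed simp

text \<open>The generator \<open>i\<close> commutes past the factors with index above
  \<open>i + 1\<close>, becomes the generator \<open>i + 1\<close> by one braid relation, and
  commutes past the remaining factors.\<close>

lemma opP_op:
  "\<phi> \<in> tvec \<Longrightarrow> 1 \<le> i \<Longrightarrow> i < m \<Longrightarrow> m < N \<Longrightarrow> opP m (op i \<phi>) = op (Suc i) (opP m \<phi>)"
proof (induction m arbitrary: \<phi>)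
  case (Suc m)
  show ?case
  proof (cases "i = m")
    case False
    then have i: "i < m" using Suc.prems by simp
    have "opP (Suc m) (op i \<phi>) = opP m (op i (op (Suc m) \<phi>))"
      using op_commute[of \<phi> i "Suc m"] Suc.prems i by simp
    also have "\<dots> = op (Suc i) (opP m (op (Suc m) \<phi>))"
      using Suc.IH[OF op_tvec, of "Suc m" \<phi>] Suc.prems i by simp
    finally show ?thesis by simp
  next
    case True
    then obtain l where l: "m = Suc l" using Suc.prems(2) by (cases m) auto
    have "opP (Suc m) (op i \<phi>) = opP l (op m (op (Suc m) (op m \<phi>)))"
      using True l by simp
    also have "\<dots> = opP l (op (Suc m) (op m (op (Suc m) \<phi>)))"
      using op_braid[of \<phi> m] Suc.prems True by simp
    also have "\<dots> = op (Suc m) (opP l (op m (op (Suc m) \<phi>)))"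
      using op_opP_commute[OF op_tvec, of l "Suc m" m "op (Suc m) \<phi>"] Suc.prems l by simp
    finally show ?thesis using True l by simp
  qed
qed simp

lemma opP_Suc_R: "opP (Suc m) \<phi> = op 1 (opR m \<phi>)"
  by (induction m arbitrary: \<phi>) simp_all

lemma opP_opP_R:
  "\<phi> \<in> tvec \<Longrightarrow> m < M \<Longrightarrow> M < N \<Longrightarrow> opP M (opP m \<phi>) = opR m (opP M \<phi>)"
proof (induction m arbitrary: \<phi>)
  case (Suc m)
  then show ?case using Suc.IH[OF op_tvec, of "Suc m" \<phi>] opP_op[of \<phi> "Suc m" M] by simp
qed simp

text \<open>With \<open>opP (Suc m)\<close> the Coxeter element, its square conjugates the last generator to the first.\<close>

lemma op_1_opP_opP:
  assumes "\<phi> \<in> tvec" "Suc m < N"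
  shows "op 1 (opP (Suc m) (opP (Suc m) \<phi>)) = opP (Suc m) (opP (Suc m) (op (Suc m) \<phi>))"
proof -
  have "opP (Suc m) (opP (Suc m) \<phi>) = opR m (opP (Suc m) (op (Suc m) \<phi>))"
    using opP_opP_R[OF op_tvec, of m "Suc m" "Suc m" \<phi>] assms by simp
  then show ?thesis using opP_Suc_R[of m "opP (Suc m) (op (Suc m) \<phi>)"] by simp
qed

lemma linear_op: "Vector_Spaces.linear fscale fscale (op i)"
  by (rule linear_fscaleI) (auto simp: op_def fscale_def fun_eq_iff algebra_simps)

lemma linear_opP: "Vector_Spaces.linear fscale fscale (opP m)"
proof (induction m)
  case 0
  show ?case by (rule linear_fscaleI) (simp_all add: fun_eq_iff)
next
  case (Suc m)
  have "opP (Suc m) = opP m \<circ> op (Suc m)" by (simp add: fun_eq_iff)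
  then show ?case using Vector_Spaces.linear_compose[OF linear_op Suc] by (simp only:)
qed

definition fixsp :: "nat \<Rightarrow> (((nat \<times> nat) \<Rightarrow> nat) \<Rightarrow> real) set" where
  "fixsp i = {\<phi> \<in> tvec. op i \<phi> = \<phi>}"

text \<open>At index \<open>N\<close> the last generator, conjugated by the Coxeter element, plays
  the part of the transposition \<open>(N, 1)\<close>.\<close>

definition fixc :: "nat \<Rightarrow> (((nat \<times> nat) \<Rightarrow> nat) \<Rightarrow> real) set" where
  "fixc i = (if i < N then fixsp i else opP (N - 1) ` fixsp (N - 1))"

lemma subspace_tvec: "fv.subspace tvec"
  by (rule fv.subspaceI) (auto simp: tvec_def fscale_def)

lemma subspace_fixsp: "fv.subspace (fixsp i)"
proof (rule fv.subspaceI)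
  interpret l: Vector_Spaces.linear fscale fscale "op i" by (rule linear_op)
  show "0 \<in> fixsp i" using l.zero subspace_tvec fv.subspace_0 by (auto simp: fixsp_def)
  show "x + y \<in> fixsp i" if "x \<in> fixsp i" "y \<in> fixsp i" for x y
    using that l.add fv.subspace_add[OF subspace_tvec] by (auto simp: fixsp_def)
  show "fscale c x \<in> fixsp i" if "x \<in> fixsp i" for c x
    using that l.scale fv.subspace_scale[OF subspace_tvec] by (auto simp: fixsp_def)
qed

text \<open>The invariants of the Young subgroup that permutes entries within the blocks of
  \<open>D\<close>.\<close>

definition fixD :: "nat set \<Rightarrow> (((nat \<times> nat) \<Rightarrow> nat) \<Rightarrow> real) set" where
  "fixD D = {\<phi> \<in> tvec. \<forall>i\<in>{1..<N} - D. op i \<phi> = \<phi>}"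

lemma subspace_fixD: "fv.subspace (fixD D)"
proof -
  have "fixD D = tvec \<inter> (\<Inter>i\<in>{1..<N} - D. fixsp i)" by (auto simp: fixD_def fixsp_def)
  moreover have "\<forall>S\<in>fixsp ` ({1..<N} - D). fv.subspace S" using subspace_fixsp by blast
  ultimately show ?thesis by (simp add: fv.subspace_inter fv.subspace_Inter subspace_tvec)
qed

lemma opP_bij: "inj_on (opP (N - 1)) tvec" "opP (N - 1) ` tvec = tvec" if "0 < N"
proof -
  have m: "N - 1 < N" using that by simp
  show "inj_on (opP (N - 1)) tvec" by (rule inj_on_inverseI) (rule opQ_opP[OF _ m])
  show "opP (N - 1) ` tvec = tvec"
    using opP_tvec opQ_tvec opP_opQ[OF _ m] by (metis image_subsetI rev_image_eqI subsetI subset_antisym)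
qed

lemma image_opP_fix:
  assumes N: "0 < N" and "\<And>\<phi>. \<phi> \<in> tvec \<Longrightarrow> op j (opP (N - 1) \<phi>) = opP (N - 1) (op i \<phi>)"
  shows "opP (N - 1) ` fixsp i = fixsp j"
proof
  show "opP (N - 1) ` fixsp i \<subseteq> fixsp j"
    using assms(2) opP_tvec by (auto simp: fixsp_def)
  show "fixsp j \<subseteq> opP (N - 1) ` fixsp i"
  proof
    fix \<psi> assume \<psi>: "\<psi> \<in> fixsp j"
    then obtain \<phi> where \<phi>: "\<phi> \<in> tvec" "\<psi> = opP (N - 1) \<phi>"
      using opP_bij(2)[OF N] by (auto simp: fixsp_def)
    then have "opP (N - 1) (op i \<phi>) = opP (N - 1) \<phi>" using \<psi> assms(2) by (simp add: fixsp_def)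
    then have "op i \<phi> = \<phi>" using inj_onD[OF opP_bij(1)[OF N]] op_tvec \<phi>(1) by blast
    then show "\<psi> \<in> opP (N - 1) ` fixsp i" using \<phi> by (auto simp: fixsp_def)
  qed
qed

text \<open>Below \<open>N - 1\<close> this is \<open>opP_op\<close>, and the passage from
  \<open>N - 1\<close> to \<open>N\<close> is the definition of \<open>fixc\<close>. The cycle
  closes from \<open>N\<close> to 1 by \<open>op_1_opP_opP\<close>.\<close>

lemma image_opP_fixc:
  assumes N: "2 \<le> N" and i: "i \<in> {1..N}"
  shows "opP (N - 1) ` fixc i = fixc (csucc N i)"
proof -
  obtain m where m: "N - 1 = Suc m" using N by (cases "N - 1") auto
  have mN: "Suc m < N" using m by simp
  have key: "op 1 (opP (N - 1) (opP (N - 1) \<phi>)) = opP (N - 1) (opP (N - 1) (op (N - 1) \<phi>))"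
    if "\<phi> \<in> tvec" for \<phi>
    unfolding m by (rule op_1_opP_opP[OF that mN])
  consider "i < N - 1" | "i = N - 1" | "i = N" using i by fastforce
  then show ?thesis
  proof cases
    case 1
    then have "opP (N - 1) ` fixsp i = fixsp (Suc i)"
      using N i opP_op[of _ i "N - 1"] by (intro image_opP_fix) auto
    then show ?thesis using 1 i by (simp add: fixc_def csucc_less)
  next
    case 2
    then show ?thesis using N i csucc_less[of i N] by (simp add: fixc_def)
  next
    case 3
    have "opP (N - 1) ` opP (N - 1) ` fixsp (N - 1) = fixsp 1"
    proof
      show "opP (N - 1) ` opP (N - 1) ` fixsp (N - 1) \<subseteq> fixsp 1"
        using key opP_tvec by (auto simp: fixsp_def)
      show "fixsp 1 \<subseteq> opP (N - 1) ` opP (N - 1) ` fixsp (N - 1)"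
      proof
        fix \<psi> assume \<psi>: "\<psi> \<in> fixsp 1"
        have N0: "0 < N" using N by simp
        obtain \<psi>' where \<psi>': "\<psi>' \<in> tvec" "\<psi> = opP (N - 1) \<psi>'"
          using opP_bij(2)[OF N0] \<psi> by (auto simp: fixsp_def)
        obtain \<phi> where \<phi>: "\<phi> \<in> tvec" "\<psi>' = opP (N - 1) \<phi>"
          using opP_bij(2)[OF N0] \<psi>'(1) by auto
        have "opP (N - 1) (opP (N - 1) (op (N - 1) \<phi>)) = opP (N - 1) (opP (N - 1) \<phi>)"
          using key[OF \<phi>(1)] \<psi> \<psi>' \<phi> by (simp add: fixsp_def)
        then have "op (N - 1) \<phi> = \<phi>"
          using inj_onD[OF opP_bij(1)[OF N0]] op_tvec \<phi>(1) opP_tvec by blast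
        then show "\<psi> \<in> opP (N - 1) ` opP (N - 1) ` fixsp (N - 1)"
          using \<psi>' \<phi> by (auto simp: fixsp_def)
      qed
    qed
    then show ?thesis using 3 N by (simp add: fixc_def csucc_self)
  qed
qed

section \<open>Descents and blocks of standard tableaux\<close>

lemma DT_iff: "i \<in> DT T \<longleftrightarrow> 1 \<le> i \<and> i < N \<and> fst (pos T i) < fst (pos T (Suc i))"
  by (auto simp: DesT_def row_of_def pos_def)

lemma DT_ct_neq:
  assumes T: "T \<in> tabs" and i: "i \<in> DT T"
  shows "ct T (Suc i) - ct T i \<noteq> 1"
  using ct_Suc_right[OF T, of i "fst (pos T i)" "snd (pos T i)"] i by (auto simp: DT_iff)

lemma finite_DT: "finite (DT T)"
  by (simp add: DesT_def)

lemma DT_subset: "DT T \<subseteq> {1..<N}"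
  by (auto simp: DesT_def)

lemma no_descent_right:
  assumes T: "T \<in> tabs" and i: "1 \<le> i" "i < N" "i \<notin> DT T"
  shows "snd (pos T i) < snd (pos T (Suc i))"
proof (rule ccontr)
  assume *: "\<not> snd (pos T i) < snd (pos T (Suc i))"
  obtain r c where p: "pos T i = (r, c)" by fastforce
  obtain r' c' where q: "pos T (Suc i) = (r', c')" by fastforce
  have "r' \<le> r" "c' \<le> c" using * i by (auto simp: DT_iff p q)
  moreover have "(r, c) \<in> cells" "T (r, c) = i" "T (r', c') = Suc i"
    using pos_mem[OF tabs_bij[OF T], of i] pos_mem[OF tabs_bij[OF T], of "Suc i"] i p q by auto
  ultimately show False using tabs_le[OF T, of r c r' c'] by simp
qed

lemma block_columns:
  assumes T: "T \<in> tabs" and D: "finite D" "DT T \<subseteq> D"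
    and "k < l" "1 \<le> k" "l \<le> N" "blk D k = blk D l"
  shows "snd (pos T k) < snd (pos T l)"
  using assms(4-7)
proof (induction l)
  case (Suc l)
  have "blk D k \<le> blk D l" "blk D l \<le> blk D (Suc l)" using Suc.prems blk_mono[OF D(1), of k l] blk_mono[OF D(1), of l "Suc l"] by auto
  then have eq: "blk D k = blk D l" "blk D l = blk D (Suc l)" using Suc.prems by auto
  then have "l \<notin> DT T" using blk_Suc[OF D(1), of l] D(2) by (auto split: if_splits)
  then have "snd (pos T l) < snd (pos T (Suc l))" using no_descent_right[OF T, of l] Suc.prems by simp
  moreover have "k = l \<or> snd (pos T k) < snd (pos T l)" using Suc eq by (cases "k = l") auto
  ultimately show ?case by auto
qed simp

text \<open>Within a block without inner descents the entries move strictly to the right. Block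
  numbers and columns therefore determine the order of the entries, as in standardization.\<close>

lemma tab_less_iff:
  assumes T: "T \<in> tabs" and D: "finite D" "DT T \<subseteq> D" and x: "x \<in> cells" and y: "y \<in> cells"
  shows "T x < T y \<longleftrightarrow> blk D (T x) < blk D (T y) \<or> blk D (T x) = blk D (T y) \<and> snd x < snd y"
proof -
  have dir: "blk D (T x) < blk D (T y) \<or> blk D (T x) = blk D (T y) \<and> snd x < snd y"
    if "T x < T y" "x \<in> cells" "y \<in> cells" for x y
  proof -
    have xy: "T x \<in> {1..N}" "T y \<in> {1..N}" using tabs_bij[OF T] that unfolding bij_betw_def by auto
    have "blk D (T x) \<le> blk D (T y)" using blk_mono[OF D(1)] that by simp
    moreover have "snd x < snd y" if "blk D (T x) = blk D (T y)"
      using block_columns[OF T D \<open>T x < T y\<close>] xy that pos_eq[OF tabs_bij[OF T]] \<open>x \<in> cells\<close> \<open>y \<in> cells\<close>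
      by simp
    ultimately show ?thesis by linarith
  qed
  consider "T x < T y" | "T y < T x" | "T x = T y" by linarith
  then show ?thesis
  proof cases
    case 1 then show ?thesis using dir x y by blast
  next
    case 2 then show ?thesis using dir[OF 2 y x] by linarith
  next
    case 3
    then have "x = y" using tabs_bij[OF T] x y unfolding bij_betw_def inj_on_def by blast
    then show ?thesis by simp
  qed
qed

lemma bij_rank:
  assumes "bij_betw T cells {1..N}" "x \<in> cells"
  shows "T x = Suc (card {y \<in> cells. T y < T x})"
proof -
  have "T ` {y \<in> cells. T y < T x} = {1..<T x}"
  proof
    show "T ` {y \<in> cells. T y < T x} \<subseteq> {1..<T x}" using assms unfolding bij_betw_def by auto
    show "{1..<T x} \<subseteq> T ` {y \<in> cells. T y < T x}"
    proof
      fix k assume k: "k \<in> {1..<T x}"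
      have "T x \<in> {1..N}" using assms unfolding bij_betw_def by blast
      then have "k \<in> {1..N}" using k by auto
      then show "k \<in> T ` {y \<in> cells. T y < T x}"
        using pos_mem[OF assms(1), of k] k by (intro image_eqI[of _ _ "pos T k"]) auto
    qed
  qed
  moreover have "inj_on T {y \<in> cells. T y < T x}"
    by (rule inj_on_subset[of T cells]) (use assms(1) in \<open>auto simp: bij_betw_def\<close>)
  ultimately have "card {y \<in> cells. T y < T x} = card {1..<T x}" using card_image by metis
  moreover have "T x \<ge> 1" using assms unfolding bij_betw_def by auto
  ultimately show ?thesis by simp
qed

lemma tab_eq_of_blk:
  assumes T: "T \<in> tabs" "DT T \<subseteq> D" and T': "T' \<in> tabs" "DT T' \<subseteq> D" and D: "finite D"
    and eq: "\<forall>x\<in>cells. blk D (T x) = blk D (T' x)"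
  shows "T = T'"
proof
  fix x
  show "T x = T' x"
  proof (cases "x \<in> cells")
    case True
    have "{y \<in> cells. T y < T x} = {y \<in> cells. T' y < T' x}"
      using tab_less_iff[OF T(1) D T(2) _ True] tab_less_iff[OF T'(1) D T'(2) _ True] eq True by auto
    then show ?thesis
      using bij_rank[OF tabs_bij[OF T(1)] True] bij_rank[OF tabs_bij[OF T'(1)] True] by simp
  qed (simp add: tabs_outside[OF T(1)] tabs_outside[OF T'(1)])
qed

lemma blk_column_strict:
  assumes T: "T \<in> tabs" "DT T \<subseteq> D" and D: "finite D" and c: "(i + 1, j) \<in> cells"
  shows "blk D (T (i, j)) < blk D (T (i + 1, j))"
proof -
  have c': "(i, j) \<in> cells" using cells_down[OF c] by simp
  have "T (i, j) < T (i + 1, j)" using tabs_col[OF T(1), of i 1 j] c by simp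
  then show ?thesis using tab_less_iff[OF T(1) D T(2) c' c] by simp
qed

section \<open>The basis adapted to descent sets\<close>

text \<open>The indicator function of all tableaux that differ from \<open>T\<close> by permuting
  entries within the blocks of its descent set. By \<open>tab_eq_of_blk\<close>, \<open>T\<close> is
  the only one among them whose own descents lie in that set.\<close>

definition bvec :: "((nat \<times> nat) \<Rightarrow> nat) \<Rightarrow> ((nat \<times> nat) \<Rightarrow> nat) \<Rightarrow> real" where
  "bvec T T' = (if T' \<in> tabs \<and> (\<forall>x\<in>cells. blk (DT T) (T' x) = blk (DT T) (T x)) then 1 else 0)"

text \<open>Swapping a descent away lowers the weight, so \<open>T\<close> is the lowest term of \<open>bvec T\<close>.\<close>

definition weight :: "((nat \<times> nat) \<Rightarrow> nat) \<Rightarrow> nat" where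
  "weight T = (\<Sum>x\<in>cells. fst x * T x)"

lemma weight_swap:
  assumes T: "T \<in> tabs" and i: "i \<in> DT T"
  shows "weight (swap i T) < weight T"
proof -
  obtain p q where p: "p = pos T i" and q: "q = pos T (Suc i)" by blast
  have i': "1 \<le> i" "i < N" "fst p < fst q" using i by (auto simp: DT_iff p q)
  have pq: "p \<in> cells" "T p = i" "q \<in> cells" "T q = Suc i"
    using pos_mem[OF tabs_bij[OF T], of i] pos_mem[OF tabs_bij[OF T], of "Suc i"] i' p q by auto
  then have "p \<noteq> q" by auto
  have dec: "(\<Sum>x\<in>cells. f x) = f p + f q + (\<Sum>x\<in>cells - {p, q}. f x)" for f :: "nat \<times> nat \<Rightarrow> nat"
  proof -
    have "(\<Sum>x\<in>cells. f x) = f p + (\<Sum>x\<in>cells - {p}. f x)"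
      by (rule sum.remove[OF finite_skew_cells pq(1)])
    also have "(\<Sum>x\<in>cells - {p}. f x) = f q + (\<Sum>x\<in>cells - {p} - {q}. f x)"
      by (rule sum.remove) (use finite_skew_cells pq(3) \<open>p \<noteq> q\<close> in auto)
    also have "cells - {p} - {q} = cells - {p, q}" by blast
    finally show ?thesis by simp
  qed
  have rest: "(\<Sum>x\<in>cells - {p, q}. fst x * swap i T x) = (\<Sum>x\<in>cells - {p, q}. fst x * T x)"
  proof (rule sum.cong[OF refl])
    fix x assume x: "x \<in> cells - {p, q}"
    then have "T x \<noteq> T p" "T x \<noteq> T q"
      using pq(1,3) tabs_bij[OF T] unfolding bij_betw_def inj_on_def by blast+
    then show "fst x * swap i T x = fst x * T x" using pq by (simp add: swap_def)
  qed
  have "fst p * Suc i + fst q * i < fst p * i + fst q * Suc i" using i'(3) by simp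
  then show ?thesis
    unfolding weight_def dec[of "\<lambda>x. fst x * swap i T x"] dec[of "\<lambda>x. fst x * T x"] rest
    using pq by (simp add: swap_def)
qed

lemma blk_swap:
  assumes "finite D" "i \<notin> D"
  shows "blk D (swap i T x) = blk D (T x)"
  using blk_Suc[OF assms(1), of i] assms(2) by (simp add: swap_def transpose_def)

text \<open>\<open>i\<close> and \<open>i + 1\<close> belong to one block, whereas block numbers
  strictly increase down the columns; so the two entries cannot be vertical neighbours.\<close>

lemma swap_in_class:
  assumes T: "T \<in> tabs" and T': "T' \<in> tabs" "\<forall>x\<in>cells. blk (DT T) (T' x) = blk (DT T) (T x)"
    and i: "1 \<le> i" "i < N" "i \<notin> DT T" and ct: "ct T' (Suc i) - ct T' i \<noteq> 1"
  shows "swap i T' \<in> tabs"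
proof (rule ccontr)
  assume "swap i T' \<notin> tabs"
  then have "ct T' (Suc i) - ct T' i = -1" using swap_mem_iff[OF T'(1) i(1,2)] ct by linarith
  obtain r c where p: "pos T' i = (r, c)" by fastforce
  then have q: "pos T' (Suc i) = (r + 1, c)"
    using ct_Suc_below[OF T'(1) i(1,2) \<open>ct T' (Suc i) - ct T' i = -1\<close>] by simp
  have pq: "(r, c) \<in> cells" "T' (r, c) = i" "(r + 1, c) \<in> cells" "T' (r + 1, c) = Suc i"
    using pos_mem[OF tabs_bij[OF T'(1)], of i] pos_mem[OF tabs_bij[OF T'(1)], of "Suc i"] i p q by auto
  have "blk (DT T) (T (r, c)) < blk (DT T) (T (r + 1, c))"
    using blk_column_strict[OF T order_refl finite_DT pq(3)] .
  then have "blk (DT T) i < blk (DT T) (Suc i)" using T'(2) pq by metis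
  then show False using blk_Suc[OF finite_DT, of T i] i(3) by simp
qed

lemma bvec_tvec: "bvec T \<in> tvec"
  by (simp add: bvec_def tvec_def)

lemma bvec_self: "T \<in> tabs \<Longrightarrow> bvec T T = 1"
  by (simp add: bvec_def)

lemma op_fix_iff:
  assumes \<phi>: "\<phi> \<in> tvec" and i: "1 \<le> i" "i < N"
  shows "op i \<phi> = \<phi> \<longleftrightarrow> (\<forall>T\<in>tabs. ct T (Suc i) - ct T i \<noteq> 1 \<longrightarrow> \<phi> T = \<phi> (swap i T))"
proof -
  have "op i \<phi> T = \<phi> T \<longleftrightarrow> (ct T (Suc i) - ct T i \<noteq> 1 \<longrightarrow> \<phi> T = \<phi> (swap i T))" if T: "T \<in> tabs" for T
  proof -
    have "op i \<phi> T = \<phi> T \<longleftrightarrow> (1 - ax i T) * (\<phi> T - \<phi> (swap i T)) = 0"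
      using T by (simp add: op_def algebra_simps) argo
    moreover have "ax i T = 1 \<longleftrightarrow> ct T (Suc i) - ct T i = 1"
      unfolding ax_def by (metis div_by_1 divide_eq_1_iff of_int_eq_1_iff)
    ultimately show ?thesis by auto
  qed
  moreover have "op i \<phi> T = \<phi> T" if "T \<notin> tabs" for T
    using that tvec_outside[OF \<phi>] by (simp add: op_def)
  ultimately show ?thesis by (auto simp: fun_eq_iff)
qed

lemma bvec_fix:
  assumes T: "T \<in> tabs" and i: "1 \<le> i" "i < N" "i \<notin> DT T"
  shows "op i (bvec T) = bvec T"
  unfolding op_fix_iff[OF bvec_tvec i(1,2)]
proof (intro ballI impI)
  fix T' assume T': "T' \<in> tabs" and ct: "ct T' (Suc i) - ct T' i \<noteq> 1"
  have "swap i T' \<in> tabs" if "\<forall>x\<in>cells. blk (DT T) (T' x) = blk (DT T) (T x)"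
    by (rule swap_in_class[OF T T' that i ct])
  then show "bvec T T' = bvec T (swap i T')"
    using T' by (auto simp: bvec_def blk_swap[OF finite_DT i(3)])
qed

lemma bvec_fixD: "T \<in> tabs \<Longrightarrow> DT T \<subseteq> D \<Longrightarrow> bvec T \<in> fixD D"
  using bvec_tvec by (auto simp: fixD_def intro!: bvec_fix)

text \<open>Any other member of the class has a descent outside \<open>DT T\<close>. Swapping it
  away stays in the class and lowers the weight, so induction leads down to
  \<open>T\<close>.\<close>

lemma bvec_support:
  assumes T: "T \<in> tabs" and "bvec T T' \<noteq> 0"
  shows "T' = T \<or> weight T < weight T'"
  using assms(2)
proof (induction "weight T'" arbitrary: T' rule: less_induct)
  case less
  then have T': "T' \<in> tabs" "\<forall>x\<in>cells. blk (DT T) (T' x) = blk (DT T) (T x)"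
    by (auto simp: bvec_def split: if_splits)
  show ?case
  proof (cases "DT T' \<subseteq> DT T")
    case True
    then show ?thesis using tab_eq_of_blk[OF T'(1) True T order_refl finite_DT] T'(2) by simp
  next
    case False
    then obtain i where i: "i \<in> DT T'" "i \<notin> DT T" by blast
    then have i': "1 \<le> i" "i < N" by (auto simp: DT_iff)
    have "ct T' (Suc i) - ct T' i \<noteq> 1" by (rule DT_ct_neq[OF T'(1) i(1)])
    then have "swap i T' \<in> tabs" by (rule swap_in_class[OF T T' i'(1,2) i(2)])
    then have "bvec T (swap i T') \<noteq> 0"
      using T'(2) by (simp add: bvec_def blk_swap[OF finite_DT i(2)])
    moreover have w: "weight (swap i T') < weight T'" by (rule weight_swap[OF T'(1) i(1)])
    ultimately have "swap i T' = T \<or> weight T < weight (swap i T')" by (rule less(1)[rotated])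
    then show ?thesis using w by auto
  qed
qed

text \<open>Invariance at a descent \<open>i\<close> outside \<open>D\<close> would force the same
  nonzero value at \<open>swap i T\<close>, which has lower weight.\<close>

lemma fixed_lowest_descents:
  assumes \<phi>: "\<phi> \<in> tvec" and fixed: "\<And>i. i \<in> {1..<N} - D \<Longrightarrow> op i \<phi> = \<phi>"
    and low: "\<And>T'. weight T' < weight T \<Longrightarrow> \<phi> T' = 0" and nz: "\<phi> T \<noteq> 0"
  shows "T \<in> tabs" "DT T \<subseteq> D"
proof -
  show T: "T \<in> tabs" using nz tvec_outside[OF \<phi>] by blast
  show "DT T \<subseteq> D"
  proof (rule ccontr)
    assume "\<not> DT T \<subseteq> D"
    then obtain i where i: "i \<in> DT T" "i \<notin> D" by blast
    then have i': "1 \<le> i" "i < N" by (auto simp: DT_iff)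
    have "ct T (Suc i) - ct T i \<noteq> 1" by (rule DT_ct_neq[OF T i(1)])
    then have "\<phi> T = \<phi> (swap i T)"
      using fixed[of i] op_fix_iff[OF \<phi> i'(1,2)] i(2) i'(1,2) T by auto
    then show False using low[OF weight_swap[OF T i(1)]] nz by simp
  qed
qed

lemma sum_fun_apply: "(\<Sum>t\<in>S. f t) x = (\<Sum>t\<in>S. f t x)" for f :: "'t \<Rightarrow> 'y \<Rightarrow> real"
  by (induction S rule: infinite_finite_induct) auto

text \<open>Triangular elimination: the lowest layer of an invariant function is cancelled by a
  combination of the \<open>bvec T\<close> with \<open>T\<close> in that layer, whose other terms
  are all heavier.\<close>

lemma fixD_subset_span: "fixD D \<subseteq> fv.span (bvec ` {T \<in> tabs. DT T \<subseteq> D})"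
proof
  fix \<phi> assume \<phi>: "\<phi> \<in> fixD D"
  let ?S = "fv.span (bvec ` {T \<in> tabs. DT T \<subseteq> D})"
  obtain M where M: "\<And>T. T \<in> tabs \<Longrightarrow> weight T < M"
    using finite_SYT by (metis finite_imageI finite_nat_set_iff_bounded imageI)
  \<comment> \<open>All weights are below \<open>M\<close>, so \<open>k\<close> bounds the number of
    weight levels on which \<open>\<psi>\<close> can be nonzero.\<close>
  have "\<psi> \<in> fixD D \<Longrightarrow> (\<And>T. weight T < M - k \<Longrightarrow> \<psi> T = 0) \<Longrightarrow> \<psi> \<in> ?S" for k \<psi>
  proof (induction k arbitrary: \<psi>)
    case 0
    have zero: "\<psi> = 0"
    proof
      fix T
      show "\<psi> T = 0 T"
        using M[of T] 0 tvec_outside[of \<psi> T] by (cases "T \<in> tabs") (auto simp: fixD_def)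
    qed
    show ?case unfolding zero by (rule fv.span_zero)
  next
    case (Suc k)
    show ?case
    proof (cases "k < M")
      case False
      then show ?thesis using Suc.IH Suc.prems by simp
    next
      case True
      let ?m = "M - Suc k"
      let ?R = "{T \<in> tabs. DT T \<subseteq> D \<and> weight T = ?m}"
      define \<chi> where "\<chi> = (\<Sum>T\<in>?R. fscale (\<psi> T) (bvec T))"
      have \<psi>: "\<psi> \<in> tvec" "\<And>i. i \<in> {1..<N} - D \<Longrightarrow> op i \<psi> = \<psi>" using Suc.prems(1) by (auto simp: fixD_def)
      have \<chi>S: "\<chi> \<in> ?S"
        unfolding \<chi>_def by (intro fv.span_sum fv.span_scale fv.span_base) blast
      have \<chi>F: "\<chi> \<in> fixD D"
        unfolding \<chi>_def by (intro fv.subspace_sum[OF subspace_fixD] fv.subspace_scale[OF subspace_fixD]) (use bvec_fixD in blast)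
      have finR: "finite ?R" using finite_SYT by simp
      have \<chi>_val: "\<chi> T' = (\<Sum>T\<in>?R. \<psi> T * bvec T T')" for T'
        unfolding \<chi>_def sum_fun_apply by (simp add: fscale_def)
      have "(\<psi> - \<chi>) T' = 0" if w: "weight T' < M - k" for T'
      proof -
        have off: "bvec T T' = 0" if "T \<in> ?R" "T \<noteq> T'" for T
        proof (rule ccontr)
          assume "bvec T T' \<noteq> 0"
          then have "weight T < weight T'" using bvec_support[of T T'] that by auto
          then show False using that(1) w True by simp
        qed
        consider "weight T' < ?m" | "weight T' = ?m" using w True by linarith
        then show ?thesis
        proof cases
          case 1
          then have "T' \<notin> ?R" by simp
          then have "\<chi> T' = 0" unfolding \<chi>_val using off by (intro sum.neutral) fastforce
          then show ?thesis using Suc.prems(2)[OF 1] by simp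
        next
          case 2
          have "\<chi> T' = \<psi> T'"
          proof (cases "T' \<in> ?R")
            case True
            have "\<chi> T' = \<psi> T' * bvec T' T' + (\<Sum>T\<in>?R - {T'}. \<psi> T * bvec T T')"
              unfolding \<chi>_val using finR True by (rule sum.remove)
            also have "(\<Sum>T\<in>?R - {T'}. \<psi> T * bvec T T') = 0" using off by (intro sum.neutral) auto
            finally show ?thesis using bvec_self True by simp
          next
            case False
            have "\<psi> T' = 0"
            proof (rule ccontr)
              assume nz: "\<psi> T' \<noteq> 0"
              have "T' \<in> tabs" "DT T' \<subseteq> D"
                using fixed_lowest_descents[OF \<psi> _ nz] Suc.prems(2) 2 by auto
              then show False using False 2 by simp
            qed
            moreover have "\<chi> T' = 0" unfolding \<chi>_val using off False by (intro sum.neutral) fastforce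
            ultimately show ?thesis by simp
          qed
          then show ?thesis by simp
        qed
      qed
      then have "\<psi> - \<chi> \<in> ?S"
        using Suc.IH fv.subspace_diff[OF subspace_fixD Suc.prems(1) \<chi>F] by blast
      then have "(\<psi> - \<chi>) + \<chi> \<in> ?S" using \<chi>S by (rule fv.span_add)
      then show ?thesis by simp
    qed
  qed
  from this[of \<phi> M] show "\<phi> \<in> ?S" using \<phi> by simp
qed

lemma bvec_inj: "inj_on bvec tabs"
proof (rule inj_onI)
  fix T T' assume T: "T \<in> tabs" "T' \<in> tabs" "bvec T = bvec T'"
  then have "bvec T T' \<noteq> 0" "bvec T' T \<noteq> 0" using bvec_self by (metis zero_neq_one)+
  then show "T = T'" using bvec_support[OF T(1)] bvec_support[OF T(2)] by fastforce
qed

text \<open>The matrix of the values \<open>bvec T T'\<close> is unitriangular with respect to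
  \<open>weight\<close>.\<close>

lemma bvec_independent: "fv.independent (bvec ` tabs)"
proof (rule fv.independent_if_scalars_zero)
  show "finite (bvec ` tabs)" using finite_SYT by simp
  fix f x assume sum0: "(\<Sum>x\<in>bvec ` tabs. fscale (f x) x) = 0" and x: "x \<in> bvec ` tabs"
  have val: "(\<Sum>T\<in>tabs. f (bvec T) * bvec T T') = 0" for T'
  proof -
    have "(\<Sum>T\<in>tabs. fscale (f (bvec T)) (bvec T)) = 0"
      using sum0 sum.reindex[OF bvec_inj, of "\<lambda>x. fscale (f x) x"] by (simp add: o_def)
    then have "(\<Sum>T\<in>tabs. fscale (f (bvec T)) (bvec T)) T' = 0" by simp
    then show ?thesis unfolding sum_fun_apply by (simp add: fscale_def)
  qed
  have "f (bvec T) = 0" if "T \<in> tabs" for T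
    using that
  proof (induction "weight T" arbitrary: T rule: less_induct)
    case less
    have "(\<Sum>T'\<in>tabs - {T}. f (bvec T') * bvec T' T) = 0"
    proof (rule sum.neutral, rule ballI)
      fix T' assume T': "T' \<in> tabs - {T}"
      show "f (bvec T') * bvec T' T = 0"
        using bvec_support[of T' T] T' less(1)[of T'] by (cases "bvec T' T = 0") auto
    qed
    then show ?case
      using val[of T] sum.remove[OF finite_SYT less(2), of "\<lambda>T'. f (bvec T') * bvec T' T"]
        bvec_self[OF less(2)] by simp
  qed
  then show "f x = 0" using x by blast
qed

lemma bvec_span: "fv.span (bvec ` tabs) = tvec"
proof
  show "fv.span (bvec ` tabs) \<subseteq> tvec"
    using bvec_tvec by (intro fv.span_minimal subspace_tvec) blast
  show "tvec \<subseteq> fv.span (bvec ` tabs)"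
  proof
    fix \<phi> assume "\<phi> \<in> tvec"
    then have "\<phi> \<in> fv.span (bvec ` {T \<in> tabs. DT T \<subseteq> {1..<N}})"
      using fixD_subset_span[of "{1..<N}"] by (auto simp: fixD_def)
    also have "{T \<in> tabs. DT T \<subseteq> {1..<N}} = tabs" using DT_subset by blast
    finally show "\<phi> \<in> fv.span (bvec ` tabs)" .
  qed
qed

text \<open>With descent set \<open>{1..m}\<close> the entries up to \<open>m + 1\<close> move
  strictly down and later ones never do. The cell \<open>(0, 1)\<close> must be filled in the second
  phase, and from then on everything stays in row 0; but the entry at \<open>(1, 1)\<close> is
  larger still.\<close>

lemma DT_not_interval:
  assumes "(1, 1) \<in> cells" and T: "T \<in> tabs"
  shows "DT T \<noteq> {1..m}"
proof
  assume D: "DT T = {1..m}"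
  have c: "(0, 0) \<in> cells" "(0, 1) \<in> cells" using cells_down[OF assms(1)] by auto
  have in1: "T x \<in> {1..N}" if "x \<in> cells" for x using tabs_bij[OF T] that unfolding bij_betw_def by blast
  have p0: "pos T (T x) = x" if "x \<in> cells" for x using pos_eq[OF tabs_bij[OF T] that] .
  have lt: "T (0, 0) < T (0, 1)" "T (0, 1) < T (1, 1)"
    using tabs_row[OF T, of 0 0 1] tabs_col[OF T, of 0 1 1] c assms(1) by auto
  have up: "k \<le> m \<Longrightarrow> k \<le> fst (pos T (Suc k))" for k
  proof (induction k)
    case (Suc k)
    then have "Suc k \<in> DT T" using D by simp
    then show ?case using Suc by (simp add: DT_iff)
  qed simp
  have "\<not> T (0, 1) \<le> Suc m"
  proof
    assume le: "T (0, 1) \<le> Suc m"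
    then have "T (0, 1) - 1 \<le> fst (pos T (Suc (T (0, 1) - 1)))" by (intro up) simp
    then show False using lt(1) in1[OF c(1)] p0[OF c(2)] by simp
  qed
  then have gt: "T (0, 1) > m" by simp
  have down: "fst (pos T (T (0, 1) + k)) = 0" if "T (0, 1) + k \<le> N" for k
    using that
  proof (induction k)
    case 0
    then show ?case using p0[OF c(2)] by simp
  next
    case (Suc k)
    then have "T (0, 1) + k \<notin> DT T" using D gt by simp
    then show ?case using Suc in1[OF c(2)] by (simp add: DT_iff)
  qed
  have "fst (pos T (T (1, 1))) = 0"
    using down[of "T (1, 1) - T (0, 1)"] lt(2) in1[OF assms(1)] by simp
  then show False using p0[OF assms(1)] by simp
qed

theorem cyclic_fiber_sizes:
  assumes nh: "(1, 1) \<in> cells"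
  obtains g where "\<And>J. J \<subseteq> {1..N} \<Longrightarrow> g (cshift N J) = g J"
    and "\<And>D. D \<subseteq> {1..<N} \<Longrightarrow> g D + g (insert N D) = card {T \<in> tabs. DT T = D}"
    and "\<And>k. k \<le> N \<Longrightarrow> g {1..k} = (0::nat)"
proof -
  have N2: "2 \<le> N"
  proof -
    have "{(0, 0), (1, 1)} \<subseteq> cells" using nh cells_down[OF nh] by auto
    then have "card {(0::nat, 0::nat), (1, 1)} \<le> N" using finite_skew_cells by (rule card_mono[rotated])
    then show ?thesis by simp
  qed
  define lab where "lab b = DT (inv_into tabs bvec b)" for b
  have lab: "lab (bvec T) = DT T" if "T \<in> tabs" for T
    unfolding lab_def using inv_into_f_f[OF bvec_inj that] by simp
  have sets: "{b \<in> bvec ` tabs. P (lab b)} = bvec ` {T \<in> tabs. P (DT T)}" for P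
    using lab by auto
  have iv: "{1..N} - {N} = {1..<N}" by auto
  have sub_img: "fv.subspace (opP (N - 1) ` fixsp (N - 1))"
  proof -
    interpret l: Vector_Spaces.linear fscale fscale "opP (N - 1)" by (rule linear_opP)
    show ?thesis using subspace_fixsp by (rule l.subspace_image)
  qed
  interpret cs: cyclic_subspaces_no_interval fscale N tvec fixc "opP (N - 1)" "bvec ` tabs" lab
  proof (intro cyclic_subspaces_no_interval.intro cyclic_subspaces.intro
      cyclic_subspaces_axioms.intro cyclic_subspaces_no_interval_axioms.intro)
    show "vector_space (fscale :: real \<Rightarrow> (((nat \<times> nat) \<Rightarrow> nat) \<Rightarrow> real) \<Rightarrow> _)"
      by (rule fv.vector_space_axioms)
    show "0 < N" using N2 by simp
    show "finite (bvec ` tabs)" using finite_SYT by simp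
    show "fv.independent (bvec ` tabs)" by (rule bvec_independent)
    show "fv.span (bvec ` tabs) = tvec" by (rule bvec_span)
    show "fv.subspace (fixc i)" for i using subspace_fixsp sub_img by (simp add: fixc_def)
    show "fixc i \<subseteq> tvec" for i using opP_tvec by (auto simp: fixc_def fixsp_def)
    show "Vector_Spaces.linear fscale fscale (opP (N - 1))" by (rule linear_opP)
    show "inj_on (opP (N - 1)) tvec" "opP (N - 1) ` tvec = tvec" using opP_bij N2 by auto
    show "opP (N - 1) ` fixc i = fixc (csucc N i)" if "i \<in> {1..N}" for i
      by (rule image_opP_fixc[OF N2 that])
    show "lab b \<subseteq> {1..N} - {N}" if "b \<in> bvec ` tabs" for b
      using that lab DT_subset unfolding iv by auto
    show "lab b \<noteq> {1..m}" if "b \<in> bvec ` tabs" for b m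
      using that lab DT_not_interval[OF nh] by auto
    show "tvec \<inter> (\<Inter>i\<in>{1..N} - insert N D. fixc i) = fv.span {b \<in> bvec ` tabs. lab b \<subseteq> D}"
      if "D \<subseteq> {1..N} - {N}" for D
    proof -
      have "{1..N} - insert N D = {1..<N} - D" by auto
      then have eq: "tvec \<inter> (\<Inter>i\<in>{1..N} - insert N D. fixc i) = fixD D"
        by (auto simp: fixc_def fixsp_def fixD_def)
      have "{b \<in> bvec ` tabs. lab b \<subseteq> D} = bvec ` {T \<in> tabs. DT T \<subseteq> D}" by (rule sets)
      moreover have "fv.span (bvec ` {T \<in> tabs. DT T \<subseteq> D}) \<subseteq> fixD D"
        using bvec_fixD by (intro fv.span_minimal subspace_fixD) blast
      ultimately show ?thesis unfolding eq using fixD_subset_span[of D] by (simp only: subset_antisym)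
    qed
  qed
  show thesis
  proof (rule that[of cs.g])
    show "cs.g (cshift N J) = cs.g J" if "J \<subseteq> {1..N}" for J by (rule cs.g_cshift[OF that])
    show "cs.g {1..k} = 0" if "k \<le> N" for k by (rule cs.g_interval[OF that])
    show "cs.g D + cs.g (insert N D) = card {T \<in> tabs. DT T = D}" if "D \<subseteq> {1..<N}" for D
    proof -
      have "cs.g D + cs.g (insert N D) = card {b \<in> bvec ` tabs. lab b = D}"
        by (rule cs.g_add_insert_n) (use that iv in simp)
      also have "{b \<in> bvec ` tabs. lab b = D} = bvec ` {T \<in> tabs. DT T = D}" by (rule sets)
      also have "card \<dots> = card {T \<in> tabs. DT T = D}"
        by (rule card_image) (rule inj_on_subset[OF bvec_inj], blast)
      finally show ?thesis .
    qed
  qed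
qed

end

section \<open>Standardization\<close>

text \<open>The content of the word of blocks of \<open>D\<close>; evaluating at this monomial extracts the number of
  descent sets contained in \<open>D\<close>.\<close>

definition bcont :: "nat \<Rightarrow> nat set \<Rightarrow> nat \<Rightarrow> nat" where
  "bcont n D k = card {i \<in> {1..n}. blk D i = k}"

lemma card_less_eq_sum:
  "finite C \<Longrightarrow> card {y \<in> C. f y < v} = (\<Sum>k<v. card {y \<in> C. f y = k})" for f :: "'c \<Rightarrow> nat"
proof (induction v)
  case (Suc v)
  have "{y \<in> C. f y < Suc v} = {y \<in> C. f y < v} \<union> {y \<in> C. f y = v}" by auto
  moreover have "card ({y \<in> C. f y < v} \<union> {y \<in> C. f y = v}) = card {y \<in> C. f y < v} + card {y \<in> C. f y = v}"
    using Suc.prems by (intro card_Un_disjoint) auto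
  ultimately show ?case using Suc by simp
qed simp

lemma rank_bij:
  fixes key :: "'c \<Rightarrow> nat"
  assumes C: "finite C" and inj: "inj_on key C"
  defines "R \<equiv> \<lambda>c. Suc (card {y \<in> C. key y < key c})"
  shows "bij_betw R C {1..card C}"
    and "\<And>x y. x \<in> C \<Longrightarrow> y \<in> C \<Longrightarrow> R x < R y \<longleftrightarrow> key x < key y"
proof -
  have lt: "R x < R y" if "x \<in> C" "y \<in> C" "key x < key y" for x y
  proof -
    have "{z \<in> C. key z < key x} \<subset> {z \<in> C. key z < key y}" using that by auto
    then show ?thesis unfolding R_def using C by (simp add: psubset_card_mono)
  qed
  show iff: "R x < R y \<longleftrightarrow> key x < key y" if "x \<in> C" "y \<in> C" for x y
  proof -
    consider "key x < key y" | "key y < key x" | "key x = key y" by linarith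
    then show ?thesis
    proof cases
      case 3
      then have "x = y" using inj that by (simp add: inj_on_def)
      then show ?thesis by simp
    qed (use lt that in fastforce)+
  qed
  have inR: "inj_on R C"
  proof (rule inj_onI)
    fix x y assume xy: "x \<in> C" "y \<in> C" "R x = R y"
    then have "key x = key y" using iff[of x y] iff[of y x] by auto
    then show "x = y" using inj xy by (simp add: inj_on_def)
  qed
  have "R ` C \<subseteq> {1..card C}"
  proof
    fix k assume "k \<in> R ` C"
    then obtain x where x: "x \<in> C" "k = R x" by blast
    have "card {y \<in> C. key y < key x} < card C" using C x(1) by (intro psubset_card_mono) auto
    then show "k \<in> {1..card C}" using x(2) by (simp add: R_def)
  qed
  then have "R ` C = {1..card C}" using inR C by (intro card_subset_eq) (auto simp: card_image)
  then show "bij_betw R C {1..card C}" using inR by (simp add: bij_betw_def)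
qed

context partition_shape
begin

lemma SSYT_row:
  assumes S: "S \<in> SSYT la" and c: "(i, j + k) \<in> cells"
  shows "S (i, j) \<le> S (i, j + k)"
  using c
proof (induction k)
  case (Suc k)
  have 1: "(i, j + k) \<in> cells" "(i, j + k + 1) \<in> cells"
    using Suc.prems cells_down[OF Suc.prems] by auto
  then have "S (i, j + k) \<le> S (i, j + k + 1)" using S unfolding SSYT_def by blast
  then show ?case using Suc 1(1) by simp
qed simp

lemma SSYT_col:
  assumes S: "S \<in> SSYT la" and c: "(i + Suc k, j) \<in> cells"
  shows "S (i, j) < S (i + Suc k, j)"
  using c
proof (induction k)
  case 0
  then have "(i, j) \<in> cells" "(i + 1, j) \<in> cells" using cells_down by auto
  then have "S (i, j) < S (i + 1, j)" using S unfolding SSYT_def by blast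
  then show ?case by simp
next
  case (Suc k)
  have 1: "(i + Suc k, j) \<in> cells" "(i + Suc k + 1, j) \<in> cells"
    using Suc.prems cells_down[OF Suc.prems] by auto
  then have "S (i + Suc k, j) < S (i + Suc k + 1, j)" using S unfolding SSYT_def by blast
  then show ?case using Suc.IH[OF 1(1)] by simp
qed

lemma SSYT_SE:
  assumes S: "S \<in> SSYT la" and c: "(i', j') \<in> cells" "i < i'" "j \<le> j'"
  shows "S (i, j) < S (i', j')"
proof -
  have "(i, j + (j' - j)) \<in> cells" using cells_down[OF c(1)] c by simp
  from SSYT_row[OF S this] have "S (i, j) \<le> S (i, j')" using c(3) by simp
  moreover have "S (i, j') < S (i', j')"
    using SSYT_col[OF S, of i "i' - Suc i" j'] c by simp
  ultimately show ?thesis by simp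
qed

text \<open>The inverse of standardization on tableaux with descents in \<open>D\<close>.\<close>

definition destd :: "nat set \<Rightarrow> (nat \<times> nat \<Rightarrow> nat) \<Rightarrow> nat \<times> nat \<Rightarrow> nat" where
  "destd D T c = (if c \<in> cells then blk D (T c) else 0)"

lemma destd_SSYT:
  assumes T: "T \<in> tabs" "DT T \<subseteq> D" and D: "finite D"
  shows "destd D T \<in> SSYT la" "card {c \<in> cells. destd D T c = k} = bcont N D k"
proof -
  show "destd D T \<in> SSYT la"
    unfolding SSYT_def
  proof (intro CollectI conjI allI impI ballI)
    show "destd D T c = 0" if "c \<notin> cells" for c using that by (simp add: destd_def)
    show "1 \<le> destd D T c" if "c \<in> cells" for c using that by (simp add: destd_def blk_def)
    show "destd D T (i, j) \<le> destd D T (i, j + 1)" if "(i, j) \<in> cells \<and> (i, j + 1) \<in> cells" for i j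
      using that tabs_row[OF T(1), of i j 1] by (simp add: destd_def blk_mono[OF D])
    show "destd D T (i, j) < destd D T (i + 1, j)" if "(i, j) \<in> cells \<and> (i + 1, j) \<in> cells" for i j
      using that blk_column_strict[OF T D, of i j] by (simp add: destd_def)
  qed
  have "T ` {c \<in> cells. destd D T c = k} = {i \<in> {1..N}. blk D i = k}"
  proof
    show "T ` {c \<in> cells. destd D T c = k} \<subseteq> {i \<in> {1..N}. blk D i = k}"
      using tabs_bij[OF T(1)] unfolding bij_betw_def destd_def by auto
    show "{i \<in> {1..N}. blk D i = k} \<subseteq> T ` {c \<in> cells. destd D T c = k}"
    proof
      fix i assume "i \<in> {i \<in> {1..N}. blk D i = k}"
      then show "i \<in> T ` {c \<in> cells. destd D T c = k}"
        using pos_mem[OF tabs_bij[OF T(1)], of i]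
        by (intro image_eqI[of _ _ "pos T i"]) (auto simp: destd_def)
    qed
  qed
  moreover have "inj_on T {c \<in> cells. destd D T c = k}"
    by (rule inj_on_subset[of T cells]) (use tabs_bij[OF T(1)] in \<open>auto simp: bij_betw_def\<close>)
  ultimately show "card {c \<in> cells. destd D T c = k} = bcont N D k"
    unfolding bcont_def using card_image[of T "{c \<in> cells. destd D T c = k}"] by simp
qed

text \<open>Cells are numbered by increasing value and, among equal values, from left to right. The
  prescribed content makes the cells of value \<open>k\<close> receive exactly the numbers of the
  \<open>k\<close>-th block.\<close>

lemma std_exists:
  assumes S: "S \<in> SSYT la" and D: "finite D" and cont: "\<forall>k. card {c \<in> cells. S c = k} = bcont N D k"
  obtains T where "T \<in> tabs" "DT T \<subseteq> D" "destd D T = S"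
proof -
  obtain K where K: "\<And>c. c \<in> cells \<Longrightarrow> snd c < K"
    using finite_skew_cells by (metis finite_imageI finite_nat_set_iff_bounded imageI)
  \<comment> \<open>As \<open>K\<close> exceeds all columns, this encodes the lexicographic order of
    value and column.\<close>
  define key where "key c = S c * K + snd c" for c
  have key_less: "key x < key y \<longleftrightarrow> S x < S y \<or> S x = S y \<and> snd x < snd y"
    if "x \<in> cells" "y \<in> cells" for x y
  proof -
    have *: "key x < key y" if "S x < S y" "x \<in> cells" for x y
    proof -
      have "S x * K + K \<le> S y * K" using mult_le_mono1[of "Suc (S x)" "S y" K] that by simp
      then show ?thesis using K[OF that(2)] by (simp add: key_def)
    qed
    consider "S x < S y" | "S y < S x" | "S x = S y" by linarith
    then show ?thesis
    proof cases
      case 1 then show ?thesis using * that by blast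
    next
      case 2 then show ?thesis using *[of y x] that by simp
    next
      case 3 then show ?thesis by (simp add: key_def)
    qed
  qed
  have inj: "inj_on key cells"
  proof (rule inj_onI)
    fix x y assume xy: "x \<in> cells" "y \<in> cells" "key x = key y"
    have eq: "S x = S y" "snd x = snd y" using key_less[OF xy(1,2)] key_less[OF xy(2,1)] xy(3) by auto
    obtain i j i' j' where x: "x = (i, j)" and y: "y = (i', j')" by fastforce
    have "\<not> i < i'" using SSYT_SE[OF S, of i' j' i j] xy eq by (auto simp: x y)
    moreover have "\<not> i' < i" using SSYT_SE[OF S, of i j i' j'] xy eq by (auto simp: x y)
    ultimately show "x = y" using eq by (simp add: x y)
  qed
  define R where "R = (\<lambda>c. Suc (card {y \<in> cells. key y < key c}))"
  define T where "T c = (if c \<in> cells then R c else 0)" for c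
  have Rb: "bij_betw R cells {1..N}" and Rl: "\<And>x y. x \<in> cells \<Longrightarrow> y \<in> cells \<Longrightarrow> R x < R y \<longleftrightarrow> key x < key y"
    using rank_bij[OF finite_skew_cells inj] unfolding R_def by auto
  have Tb: "bij_betw T cells {1..N}" using Rb by (rule iffD1[OF bij_betw_cong, rotated]) (simp add: T_def)
  have Tl: "T x < T y \<longleftrightarrow> S x < S y \<or> S x = S y \<and> snd x < snd y" if "x \<in> cells" "y \<in> cells" for x y
    using Rl[OF that] key_less[OF that] that by (simp add: T_def)
  have T: "T \<in> tabs"
    unfolding SYT_def
  proof (intro CollectI conjI allI impI)
    show "bij_betw T cells {1..N}" by (rule Tb)
    show "T c = 0" if "c \<notin> cells" for c using that by (simp add: T_def)
    show "T (i, j) < T (i, j + 1)" if "(i, j) \<in> cells \<and> (i, j + 1) \<in> cells" for i j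
      using that Tl[of "(i, j)" "(i, j + 1)"] SSYT_row[OF S, of i j 1] by auto
    show "T (i, j) < T (i + 1, j)" if "(i, j) \<in> cells \<and> (i + 1, j) \<in> cells" for i j
      using that Tl[of "(i, j)" "(i + 1, j)"] SSYT_col[OF S, of i 0 j] by auto
  qed
  have cards: "card {y \<in> cells. S y < v} = card {i \<in> {1..N}. blk D i < v}" for v
    unfolding card_less_eq_sum[OF finite_skew_cells] card_less_eq_sum[OF finite_atLeastAtMost]
    using cont by (simp add: bcont_def)
  have blkT: "blk D (T c) = S c" if c: "c \<in> cells" for c
  proof -
    have Tc: "T c = Suc (card {y \<in> cells. T y < T c})" by (rule bij_rank[OF Tb c])
    have TcN: "T c \<in> {1..N}" using Tb c unfolding bij_betw_def by blast
    have "\<not> blk D (T c) < S c"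
    proof
      assume a: "blk D (T c) < S c"
      have "{1..T c} \<subseteq> {i \<in> {1..N}. blk D i < S c}"
      proof
        fix i assume i: "i \<in> {1..T c}"
        then have "blk D i \<le> blk D (T c)" using blk_mono[OF D] by simp
        then show "i \<in> {i \<in> {1..N}. blk D i < S c}" using a i TcN by simp
      qed
      then have "card {1..T c} \<le> card {i \<in> {1..N}. blk D i < S c}" by (intro card_mono) auto
      also have "\<dots> = card {y \<in> cells. S y < S c}" using cards by simp
      also have "\<dots> \<le> card {y \<in> cells. T y < T c}"
        using Tl[OF _ c] finite_skew_cells by (intro card_mono) auto
      finally show False using Tc by simp
    qed
    moreover have "\<not> S c < blk D (T c)"
    proof
      assume a: "S c < blk D (T c)"
      have "{i \<in> {1..N}. blk D i < Suc (S c)} \<subseteq> {1..<T c}"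
      proof
        fix i assume i: "i \<in> {i \<in> {1..N}. blk D i < Suc (S c)}"
        have "\<not> T c \<le> i"
        proof
          assume "T c \<le> i"
          then have "blk D (T c) \<le> blk D i" using blk_mono[OF D] by simp
          then show False using a i by simp
        qed
        then show "i \<in> {1..<T c}" using i by simp
      qed
      then have "card {i \<in> {1..N}. blk D i < Suc (S c)} \<le> card {1..<T c}" by (intro card_mono) auto
      then have "card {y \<in> cells. S y < Suc (S c)} \<le> T c - 1" using cards[of "Suc (S c)"] by simp
      moreover have "insert c {y \<in> cells. T y < T c} \<subseteq> {y \<in> cells. S y < Suc (S c)}"
        using Tl[OF _ c] c by auto
      then have "card (insert c {y \<in> cells. T y < T c}) \<le> card {y \<in> cells. S y < Suc (S c)}"
        using finite_skew_cells by (intro card_mono) auto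
      ultimately show False using Tc finite_skew_cells by simp
    qed
    ultimately show ?thesis by simp
  qed
  have S_outside: "S c = 0" if "c \<notin> cells" for c using S that unfolding SSYT_def by blast
  have "DT T \<subseteq> D"
  proof
    fix i assume "i \<in> DT T"
    then have i: "1 \<le> i" "i < N" "fst (pos T i) < fst (pos T (Suc i))" by (auto simp: DT_iff)
    \<comment> \<open>If \<open>i\<close> and \<open>i + 1\<close> were in one block, they would
      come from equal values in cells of which the second is both lower and further right, which
      column strictness forbids.\<close>
    show "i \<in> D"
    proof (rule ccontr)
      assume "i \<notin> D"
      then have eq: "blk D (Suc i) = blk D i" using blk_Suc[OF D] by simp
      obtain r c where p: "pos T i = (r, c)" by fastforce
      obtain r' c' where q: "pos T (Suc i) = (r', c')" by fastforce
      have pq: "(r, c) \<in> cells" "T (r, c) = i" "(r', c') \<in> cells" "T (r', c') = Suc i"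
        using pos_mem[OF Tb, of i] pos_mem[OF Tb, of "Suc i"] i p q by auto
      have Seq: "S (r, c) = S (r', c')" using blkT[OF pq(1)] blkT[OF pq(3)] pq eq by simp
      then have "c < c'" using Tl[OF pq(1,3)] pq by simp
      then show False using SSYT_SE[OF S pq(3), of r c] i(3) Seq by (simp add: p q)
    qed
  qed
  moreover have "destd D T = S"
  proof
    fix c show "destd D T c = S c"
      using blkT[of c] S_outside[of c] by (cases "c \<in> cells") (simp_all add: destd_def)
  qed
  ultimately show thesis using that T by blast
qed

lemma schur_bcont:
  assumes D: "finite D"
  shows "schur la (bcont N D) = int (card {T \<in> tabs. DT T \<subseteq> D})"
proof -
  have "destd D ` {T \<in> tabs. DT T \<subseteq> D} = {S \<in> SSYT la. \<forall>k. card {c \<in> cells. S c = k} = bcont N D k}"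
  proof
    show "destd D ` {T \<in> tabs. DT T \<subseteq> D} \<subseteq> {S \<in> SSYT la. \<forall>k. card {c \<in> cells. S c = k} = bcont N D k}"
      using destd_SSYT[OF _ _ D] by blast
    show "{S \<in> SSYT la. \<forall>k. card {c \<in> cells. S c = k} = bcont N D k} \<subseteq> destd D ` {T \<in> tabs. DT T \<subseteq> D}"
    proof
      fix S assume "S \<in> {S \<in> SSYT la. \<forall>k. card {c \<in> cells. S c = k} = bcont N D k}"
      then obtain T where "T \<in> tabs" "DT T \<subseteq> D" "destd D T = S" using std_exists[OF _ D] by blast
      then show "S \<in> destd D ` {T \<in> tabs. DT T \<subseteq> D}" by blast
    qed
  qed
  moreover have "inj_on (destd D) {T \<in> tabs. DT T \<subseteq> D}"
  proof (rule inj_onI)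
    fix T T' assume TT: "T \<in> {T \<in> tabs. DT T \<subseteq> D}" "T' \<in> {T \<in> tabs. DT T \<subseteq> D}" "destd D T = destd D T'"
    have "\<forall>x\<in>cells. blk D (T x) = blk D (T' x)" using TT(3) by (metis destd_def)
    then show "T = T'" using tab_eq_of_blk[of T D T'] TT D by simp
  qed
  ultimately show ?thesis
    unfolding schur_def using card_image[of "destd D" "{T \<in> tabs. DT T \<subseteq> D}"] by simp
qed

text \<open>The block content has total degree \<open>n\<close>, so it cannot be the content of a
  filling with a different number of cells.\<close>

lemma schur_bcont_other:
  assumes D: "finite D" and "N \<noteq> n"
  shows "schur la (bcont n D) = 0"
proof -
  have "{S \<in> SSYT la. \<forall>k. card {c \<in> cells. S c = k} = bcont n D k} = {}"
  proof (rule ccontr)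
    assume "\<not> ?thesis"
    then obtain S where S: "\<forall>k. card {c \<in> cells. S c = k} = bcont n D k" by blast
    obtain v where v: "\<forall>x\<in>S ` cells \<union> blk D ` {1..n}. x < v"
      using finite_nat_set_iff_bounded[of "S ` cells \<union> blk D ` {1..n}"] finite_skew_cells by auto
    have "card {y \<in> cells. S y < v} = card {i \<in> {1..n}. blk D i < v}"
      unfolding card_less_eq_sum[OF finite_skew_cells] card_less_eq_sum[OF finite_atLeastAtMost]
      using S by (simp add: bcont_def)
    moreover have "{y \<in> cells. S y < v} = cells" "{i \<in> {1..n}. blk D i < v} = {1..n}" using v by auto
    ultimately show False using \<open>N \<noteq> n\<close> by simp
  qed
  then show ?thesis unfolding schur_def by (simp only: card.empty of_nat_0)
qed

end

text \<open>A monomial determines its weakly increasing word. Here it is the word of block numbers,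
  which increases strictly exactly after the positions in \<open>D\<close>.\<close>

lemma Fund_bcont:
  assumes D: "D \<subseteq> {1..<n}" and E: "E \<subseteq> {1..<n}"
  shows "Fund n E (bcont n D) = (if E \<subseteq> D then 1 else 0)"
proof -
  have fD: "finite D" using D finite_subset by blast
  define w where "w = map (blk D) [1..<Suc n]"
  have lw: "length w = n" by (simp add: w_def del: upt_Suc)
  have nth: "w ! j = blk D (Suc j)" if "j < n" for j
    using that unfolding w_def by (simp del: upt_Suc)
  have sw: "sorted w"
    unfolding sorted_iff_nth_mono lw using nth blk_mono[OF fD] by simp
  have cw: "content_of_list w = bcont n D"
  proof
    fix k
    have "count_list w k = length (filter (\<lambda>i. k = blk D i) [1..<Suc n])"
      unfolding w_def by (simp add: count_list_eq_length_filter filter_map o_def del: upt_Suc)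
    also have "\<dots> = card (set (filter (\<lambda>i. k = blk D i) [1..<Suc n]))"
      by (rule distinct_card[symmetric]) (simp del: upt_Suc)
    also have "set (filter (\<lambda>i. k = blk D i) [1..<Suc n]) = {i \<in> {1..n}. blk D i = k}" by auto
    finally show "content_of_list w k = bcont n D k" by (simp add: content_of_list_def bcont_def)
  qed
  have uniq: "u = w" if "sorted u" "content_of_list u = bcont n D" for u
  proof -
    have "count_list u k = count_list w k" for k
      using that(2) cw unfolding content_of_list_def fun_eq_iff by simp
    then have "mset u = mset w" by (intro multiset_eqI) (simp add: count_mset)
    then show ?thesis using that(1) sw by (metis sorted_sort_id properties_for_sort)
  qed
  have st: "(\<forall>j\<in>E. 1 \<le> j \<and> j < n \<longrightarrow> w ! (j - 1) < w ! j) \<longleftrightarrow> E \<subseteq> D"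
  proof -
    have "w ! (j - 1) < w ! j \<longleftrightarrow> j \<in> D" if "j \<in> E" for j
    proof -
      have j: "1 \<le> j" "j < n" using that E by auto
      then have "w ! (j - 1) = blk D j" "w ! j = blk D (Suc j)" using nth[of "j - 1"] nth[of j] by auto
      then show ?thesis using blk_Suc[OF fD, of j] by simp
    qed
    then show ?thesis using E by fastforce
  qed
  have w1: "\<forall>k\<in>set w. 1 \<le> k" unfolding w_def by (simp add: blk_def del: upt_Suc)
  have "length u = n \<and> (\<forall>k\<in>set u. 1 \<le> k) \<and> sorted u
       \<and> (\<forall>j\<in>E. 1 \<le> j \<and> j < n \<longrightarrow> u ! (j - 1) < u ! j) \<and> content_of_list u = bcont n D
     \<longleftrightarrow> u = w \<and> E \<subseteq> D" for u
    using uniq[of u] st w1 lw sw cw by blast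
  then have "{u. length u = n \<and> (\<forall>k\<in>set u. 1 \<le> k) \<and> sorted u
       \<and> (\<forall>j\<in>E. 1 \<le> j \<and> j < n \<longrightarrow> u ! (j - 1) < u ! j) \<and> content_of_list u = bcont n D}
     = (if E \<subseteq> D then {w} else {})"
    by simp
  then show ?thesis unfolding Fund_def by simp
qed

section \<open>Cyclic descent extensions from fibre sizes\<close>

lemma cshift_inj:
  assumes "I \<subseteq> {1..n}" "J \<subseteq> {1..n}" "cshift n I = cshift n J"
  shows "I = J"
  using assms inj_on_image_eq_iff[OF inj_on_csucc[of n]] unfolding cshift_eq_image_csucc by blast

text \<open>A cyclic descent extension with prescribed fibre sizes; \<open>g\<close> may take
  arbitrary values on sets that are not contained in \<open>[n]\<close>.\<close>

definition realised :: "nat list \<Rightarrow> nat list \<Rightarrow> nat \<Rightarrow> (nat set \<Rightarrow> nat) \<Rightarrow> bool" where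
  "realised la mu n g \<longleftrightarrow> (\<exists>cD \<psi>. cyclic_descent_ext la mu cD \<psi>
    \<and> (\<forall>J. card {T \<in> SYT la mu. cD T = J} = (if J \<subseteq> {1..n} then g J else 0)))"

text \<open>Only sizes matter. Among the tableaux with descent set \<open>D\<close>, any
  \<open>g D\<close> of them keep \<open>D\<close> as cyclic descent set and the others receive
  \<open>n\<close> in addition. Since fibres over rotated sets are equinumerous,
  \<open>\<psi>\<close> can be glued from arbitrary bijections between them.\<close>

lemma realisedI:
  assumes n: "card (skew_cells la mu) = n" "0 < n"
    and rot: "\<And>J. J \<subseteq> {1..n} \<Longrightarrow> g (cshift n J) = g J"
    and split: "\<And>D. D \<subseteq> {1..<n} \<Longrightarrow> g D + g (insert n D) = card {T \<in> SYT la mu. DesT la mu T = D}"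
    and ends: "g {} = 0" "g {1..n} = (0::nat)"
  shows "realised la mu n g"
proof -
  let ?Y = "SYT la mu" and ?D = "DesT la mu"
  have fin: "finite {T \<in> ?Y. P T}" for P using finite_SYT by simp
  have Dsub: "?D T \<subseteq> {1..<n}" for T by (auto simp: DesT_def n)
  have "\<forall>D. \<exists>X. D \<subseteq> {1..<n} \<longrightarrow> X \<subseteq> {T \<in> ?Y. ?D T = D} \<and> card X = g D"
  proof
    fix D
    show "\<exists>X. D \<subseteq> {1..<n} \<longrightarrow> X \<subseteq> {T \<in> ?Y. ?D T = D} \<and> card X = g D"
    proof (cases "D \<subseteq> {1..<n}")
      case True
      then have "g D \<le> card {T \<in> ?Y. ?D T = D}" using split[OF True] by simp
      then obtain X where "X \<subseteq> {T \<in> ?Y. ?D T = D}" "card X = g D"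
        by (rule obtain_subset_with_card_n)
      then show ?thesis by blast
    qed simp
  qed
  then obtain X where X: "\<And>D. D \<subseteq> {1..<n} \<Longrightarrow> X D \<subseteq> {T \<in> ?Y. ?D T = D}" "\<And>D. D \<subseteq> {1..<n} \<Longrightarrow> card (X D) = g D"
    by metis
  define cD where "cD T = (if T \<in> X (?D T) then ?D T else insert n (?D T))" for T
  have cD_cases: "cD T = ?D T \<or> cD T = insert n (?D T)" for T by (simp add: cD_def)
  have nD: "n \<notin> ?D T" for T using Dsub[of T] by auto
  have cDsub: "cD T \<subseteq> {1..n}" for T using cD_cases[of T] Dsub[of T] n(2) by fastforce
  have fib1: "{T \<in> ?Y. cD T = J} = X J" if "J \<subseteq> {1..<n}" for J
  proof -
    have "n \<notin> J" using that by auto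
    then show ?thesis using X(1)[OF that] by (auto simp: cD_def split: if_splits)
  qed
  have fib2: "{T \<in> ?Y. cD T = insert n D} = {T \<in> ?Y. ?D T = D} - X D" if D: "D \<subseteq> {1..<n}" for D
  proof -
    have nn: "n \<notin> D" using D by auto
    have "cD T = insert n D \<longleftrightarrow> ?D T = D \<and> T \<notin> X D" for T
    proof -
      have "insert n (?D T) = insert n D \<longleftrightarrow> ?D T = D" using nD[of T] nn by (metis insert_ident)
      moreover have "?D T \<noteq> insert n D" using nD[of T] by blast
      ultimately show ?thesis by (auto simp: cD_def)
    qed
    then show ?thesis by auto
  qed
  have size: "card {T \<in> ?Y. cD T = J} = g J" if J: "J \<subseteq> {1..n}" for J
  proof (cases "n \<in> J")
    case False
    then have "J \<subseteq> {1..<n}" using J by (metis atLeastLessThanSuc_atLeastAtMost atLeastLessThan_iff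
          less_Suc_eq subset_iff)
    then show ?thesis using fib1 X(2) by simp
  next
    case True
    define D where "D = J - {n}"
    have D: "D \<subseteq> {1..<n}" "J = insert n D" using J True by (auto simp: D_def order_less_le)
    have "card ({T \<in> ?Y. ?D T = D} - X D) = card {T \<in> ?Y. ?D T = D} - card (X D)"
      using X(1)[OF D(1)] finite_subset[OF X(1)[OF D(1)] fin] by (rule card_Diff_subset[rotated])
    then show ?thesis using fib2[OF D(1)] X(2)[OF D(1)] split[OF D(1)] D(2) by simp
  qed
  have shsub: "cshift n J \<subseteq> {1..n}" if "J \<subseteq> {1..n}" for J
    using that image_csucc[of n] unfolding cshift_eq_image_csucc by blast
  have "\<exists>h. bij_betw h {T \<in> ?Y. cD T = J} {T \<in> ?Y. cD T = cshift n J}" if J: "J \<subseteq> {1..n}" for J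
    using size[OF J] size[OF shsub[OF J]] rot[OF J] by (intro finite_same_card_bij fin) simp
  then have "\<forall>J. \<exists>h. J \<subseteq> {1..n} \<longrightarrow> bij_betw h {T \<in> ?Y. cD T = J} {T \<in> ?Y. cD T = cshift n J}"
    by blast
  from choice[OF this] obtain h
    where h: "\<And>J. J \<subseteq> {1..n} \<Longrightarrow> bij_betw (h J) {T \<in> ?Y. cD T = J} {T \<in> ?Y. cD T = cshift n J}"
    by blast
  define \<psi> where "\<psi> T = h (cD T) T" for T
  have \<psi>: "\<psi> T \<in> ?Y" "cD (\<psi> T) = cshift n (cD T)" if "T \<in> ?Y" for T
    using h[OF cDsub[of T]] that unfolding \<psi>_def bij_betw_def by auto
  have "inj_on \<psi> ?Y"
  proof (rule inj_onI)
    fix T T' assume T: "T \<in> ?Y" "T' \<in> ?Y" "\<psi> T = \<psi> T'"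
    then have "cshift n (cD T) = cshift n (cD T')" using \<psi>(2) by metis
    then have eq: "cD T = cD T'" using cshift_inj[OF cDsub cDsub] by blast
    then show "T = T'"
      using h[OF cDsub[of T]] T unfolding \<psi>_def bij_betw_def inj_on_def by auto
  qed
  moreover have "\<psi> ` ?Y \<subseteq> ?Y" using \<psi>(1) by blast
  ultimately have bij: "bij_betw \<psi> ?Y ?Y" using endo_inj_surj[OF finite_SYT] unfolding bij_betw_def by blast
  have cap: "cD T \<inter> {1..<n} = ?D T" for T
    using cD_cases[of T] Dsub[of T] by auto
  have ne: "cD T \<noteq> J" if "T \<in> ?Y" "g J = 0" "J \<subseteq> {1..n}" for T J
  proof
    assume "cD T = J"
    then have "{T \<in> ?Y. cD T = J} \<noteq> {}" using that(1) by blast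
    then have "card {T \<in> ?Y. cD T = J} \<noteq> 0" using fin by simp
    then show False using size[OF that(3)] that(2) by simp
  qed
  have "cyclic_descent_ext la mu cD \<psi>"
    unfolding cyclic_descent_ext_def Let_def n(1)
    using bij cDsub cap \<psi>(2) ne[of _ "{}"] ne[of _ "{1..n}"] ends by blast
  moreover have "card {T \<in> ?Y. cD T = J} = (if J \<subseteq> {1..n} then g J else 0)" for J
  proof (cases "J \<subseteq> {1..n}")
    case False
    then have "{T \<in> ?Y. cD T = J} = {}" using cDsub by blast
    then have "card {T \<in> ?Y. cD T = J} = 0" by (simp only: card.empty)
    then show ?thesis using False by simp
  qed (simp add: size)
  ultimately show ?thesis unfolding realised_def by blast
qed

section \<open>Hooks and disconnected hooks\<close>

text \<open>An arm of \<open>r\<close> cells in row 0 and a leg of \<open>k\<close> cells below row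
  0. For \<open>a = 0\<close> they form a hook; for \<open>a = 1\<close> the corner is missing and
  arm and leg are disconnected.\<close>

definition hookcells :: "nat \<Rightarrow> nat \<Rightarrow> nat \<Rightarrow> (nat \<times> nat) set" where
  "hookcells a r k = {0} \<times> {a..<a + r} \<union> {1..k} \<times> {0}"

lemma card_hookcells: "card (hookcells a r k) = r + k"
  unfolding hookcells_def by (subst card_Un_disjoint) (auto simp: card_cartesian_product)

lemma sorted_list_of_set_nth_less:
  fixes S :: "nat set"
  assumes "i < j" "j < card S"
  shows "sorted_list_of_set S ! i < sorted_list_of_set S ! j"
  using assms strict_sorted_list_of_set[of S] sorted_wrt_nth_less[of "(<)" "sorted_list_of_set S" i j] by simp

locale hook_shape =
  fixes la mu :: "nat list" and a r k :: nat
  assumes cells: "skew_cells la mu = hookcells a r k" and a: "a \<le> 1" and r: "0 < r"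
begin

definition leg :: "((nat \<times> nat) \<Rightarrow> nat) \<Rightarrow> nat set" where
  "leg T = (\<lambda>i. T (i, 0)) ` {1..k}"

lemma mem_SYT_iff:
  "T \<in> SYT la mu \<longleftrightarrow> bij_betw T (hookcells a r k) {1..r + k}
     \<and> (\<forall>c. c \<notin> hookcells a r k \<longrightarrow> T c = 0)
     \<and> (\<forall>j. Suc j < r \<longrightarrow> T (0, a + j) < T (0, a + Suc j))
     \<and> (\<forall>i. 1 \<le> i \<and> i < k \<longrightarrow> T (i, 0) < T (Suc i, 0))
     \<and> (a = 0 \<and> 0 < k \<longrightarrow> T (0, 0) < T (1, 0))"
proof -
  have row: "(\<forall>i j. (i, j) \<in> hookcells a r k \<and> (i, j + 1) \<in> hookcells a r k \<longrightarrow> T (i, j) < T (i, j + 1))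
      \<longleftrightarrow> (\<forall>j. Suc j < r \<longrightarrow> T (0, a + j) < T (0, a + Suc j))"
  proof
    assume L: "\<forall>i j. (i, j) \<in> hookcells a r k \<and> (i, j + 1) \<in> hookcells a r k \<longrightarrow> T (i, j) < T (i, j + 1)"
    show "\<forall>j. Suc j < r \<longrightarrow> T (0, a + j) < T (0, a + Suc j)"
    proof (intro allI impI)
      fix j assume "Suc j < r"
      then show "T (0, a + j) < T (0, a + Suc j)" using L[rule_format, of 0 "a + j"] by (simp add: hookcells_def)
    qed
  next
    assume R: "\<forall>j. Suc j < r \<longrightarrow> T (0, a + j) < T (0, a + Suc j)"
    show "\<forall>i j. (i, j) \<in> hookcells a r k \<and> (i, j + 1) \<in> hookcells a r k \<longrightarrow> T (i, j) < T (i, j + 1)"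
    proof (intro allI impI)
      fix i j assume ij: "(i, j) \<in> hookcells a r k \<and> (i, j + 1) \<in> hookcells a r k"
      then have i0: "i = 0" "a \<le> j" "j + 1 < a + r" by (auto simp: hookcells_def)
      then show "T (i, j) < T (i, j + 1)" using R[rule_format, of "j - a"] by simp
    qed
  qed
  have col: "(\<forall>i j. (i, j) \<in> hookcells a r k \<and> (i + 1, j) \<in> hookcells a r k \<longrightarrow> T (i, j) < T (i + 1, j))
      \<longleftrightarrow> (\<forall>i. 1 \<le> i \<and> i < k \<longrightarrow> T (i, 0) < T (Suc i, 0)) \<and> (a = 0 \<and> 0 < k \<longrightarrow> T (0, 0) < T (1, 0))"
  proof
    assume L: "\<forall>i j. (i, j) \<in> hookcells a r k \<and> (i + 1, j) \<in> hookcells a r k \<longrightarrow> T (i, j) < T (i + 1, j)"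
    show "(\<forall>i. 1 \<le> i \<and> i < k \<longrightarrow> T (i, 0) < T (Suc i, 0)) \<and> (a = 0 \<and> 0 < k \<longrightarrow> T (0, 0) < T (1, 0))"
    proof (intro conjI allI impI)
      fix i assume "1 \<le> i \<and> i < k"
      then show "T (i, 0) < T (Suc i, 0)" using L[rule_format, of i 0] by (simp add: hookcells_def)
    next
      assume "a = 0 \<and> 0 < k"
      then show "T (0, 0) < T (1, 0)" using L[rule_format, of 0 0] r by (simp add: hookcells_def)
    qed
  next
    assume R: "(\<forall>i. 1 \<le> i \<and> i < k \<longrightarrow> T (i, 0) < T (Suc i, 0)) \<and> (a = 0 \<and> 0 < k \<longrightarrow> T (0, 0) < T (1, 0))"
    show "\<forall>i j. (i, j) \<in> hookcells a r k \<and> (i + 1, j) \<in> hookcells a r k \<longrightarrow> T (i, j) < T (i + 1, j)"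
    proof (intro allI impI)
      fix i j assume ij: "(i, j) \<in> hookcells a r k \<and> (i + 1, j) \<in> hookcells a r k"
      then have j0: "j = 0" "i + 1 \<le> k" by (auto simp: hookcells_def)
      show "T (i, j) < T (i + 1, j)"
      proof (cases "i = 0")
        case True
        then have "a = 0" using ij j0 by (simp add: hookcells_def)
        then show ?thesis using R True j0 by simp
      next
        case False
        then show ?thesis using R j0 by simp
      qed
    qed
  qed
  show ?thesis unfolding SYT_def cells card_hookcells mem_Collect_eq row col by blast
qed

lemma leg_mono:
  assumes T: "T \<in> SYT la mu" and "1 \<le> i" "i < j" "j \<le> k"
  shows "T (i, 0) < T (j, 0)"
  using assms(3,4)
proof (induction j)
  case (Suc j)
  have step: "T (j, 0) < T (Suc j, 0)" if "1 \<le> j" using T Suc.prems that unfolding mem_SYT_iff by simp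
  show ?case
  proof (cases "i = j")
    case True then show ?thesis using step assms(2) by simp
  next
    case False
    then have "T (i, 0) < T (j, 0)" using Suc by simp
    then show ?thesis using step assms(2) False Suc.prems by force
  qed
qed simp

lemma arm_mono:
  assumes T: "T \<in> SYT la mu" and "i < j" "j < r"
  shows "T (0, a + i) < T (0, a + j)"
  using assms(2,3)
proof (induction j)
  case (Suc j)
  have step: "T (0, a + j) < T (0, a + Suc j)" using T Suc.prems unfolding mem_SYT_iff by simp
  show ?case
  proof (cases "i = j")
    case False
    then have "T (0, a + i) < T (0, a + j)" using Suc by simp
    then show ?thesis using step by simp
  qed (use step in simp)
qed simp

lemma SYT_inj: "T \<in> SYT la mu \<Longrightarrow> inj_on T (hookcells a r k)"
  and SYT_image: "T \<in> SYT la mu \<Longrightarrow> T ` hookcells a r k = {1..r + k}"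
  unfolding mem_SYT_iff bij_betw_def by auto

lemma arm_image:
  assumes T: "T \<in> SYT la mu"
  shows "(\<lambda>j. T (0, a + j)) ` {..<r} = {1..r + k} - leg T"
proof -
  have arm: "(\<lambda>j. T (0, a + j)) ` {..<r} = T ` ({0} \<times> {a..<a + r})"
  proof -
    have "{0::nat} \<times> {a..<a + r} = (\<lambda>j. (0, a + j)) ` {..<r}"
    proof (intro equalityI subsetI)
      fix x assume "x \<in> {0::nat} \<times> {a..<a + r}"
      then show "x \<in> (\<lambda>j. (0, a + j)) ` {..<r}"
        by (intro image_eqI[of _ _ "snd x - a"]) auto
    qed auto
    then show ?thesis by (simp add: image_image)
  qed
  have leg: "leg T = T ` ({1..k} \<times> {0})" by (auto simp: leg_def)
  have "T ` ({0} \<times> {a..<a + r}) = T ` (hookcells a r k - {1..k} \<times> {0})"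
    by (rule arg_cong[of _ _ "image T"]) (auto simp: hookcells_def)
  also have "\<dots> = T ` hookcells a r k - T ` ({1..k} \<times> {0})"
    by (rule inj_on_image_set_diff[OF SYT_inj[OF T]]) (auto simp: hookcells_def)
  finally show ?thesis using SYT_image[OF T] arm leg by simp
qed

lemma leg_subset: "T \<in> SYT la mu \<Longrightarrow> leg T \<subseteq> {1..r + k}"
  using SYT_image[of T] by (auto simp: leg_def hookcells_def)

lemma card_leg: "T \<in> SYT la mu \<Longrightarrow> card (leg T) = k"
proof -
  assume T: "T \<in> SYT la mu"
  have "inj_on (\<lambda>i. T (i, 0)) {1..k}"
  proof (rule inj_onI)
    fix i j assume "i \<in> {1..k}" "j \<in> {1..k}" "T (i, 0) = T (j, 0)"
    then have "(i, 0::nat) = (j, 0)" using inj_onD[OF SYT_inj[OF T], of "(i, 0)" "(j, 0)"]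
      by (simp add: hookcells_def)
    then show "i = j" by simp
  qed
  then show ?thesis by (simp add: leg_def card_image)
qed

lemma leg_arm_zero: "T \<in> SYT la mu \<Longrightarrow> a = 0 \<Longrightarrow> 1 \<notin> leg T"
proof
  assume T: "T \<in> SYT la mu" and a0: "a = 0" and "1 \<in> leg T"
  then obtain i where i: "1 \<le> i" "i \<le> k" "T (i, 0) = 1" by (auto simp: leg_def)
  have lt: "T (0, 0) < T (1, 0)" using T a0 i unfolding mem_SYT_iff by simp
  moreover have "T (1, 0) \<le> T (i, 0)" using leg_mono[OF T, of 1 i] i by (cases "i = 1") auto
  moreover have "(0, 0) \<in> hookcells a r k" using a0 r by (simp add: hookcells_def)
  then have "T (0, 0) \<in> {1..r + k}" using SYT_image[OF T] by blast
  ultimately show False using i(3) by simp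
qed

text \<open>The leg and the arm are filled increasingly, by the leg set and its complement.\<close>

lemma leg_inj: "inj_on leg (SYT la mu)"
proof (rule inj_onI)
  fix T T' assume T: "T \<in> SYT la mu" and T': "T' \<in> SYT la mu" and eq: "leg T = leg T'"
  have legs: "map (\<lambda>i. T (i, 0)) [1..<Suc k] = sorted_list_of_set (leg T)" if T: "T \<in> SYT la mu" for T
  proof -
    have "sorted_wrt (<) (map (\<lambda>i. T (i, 0)) [1..<Suc k])"
      unfolding sorted_wrt_iff_nth_less using leg_mono[OF T] by (simp del: upt_Suc)
    moreover have "set (map (\<lambda>i. T (i, 0)) [1..<Suc k]) = set (sorted_list_of_set (leg T))"
      by (auto simp: leg_def)
    ultimately show ?thesis by (rule strict_sorted_equal[OF strict_sorted_list_of_set])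
  qed
  have arms: "map (\<lambda>j. T (0, a + j)) [0..<r] = sorted_list_of_set ({1..r + k} - leg T)"
    if T: "T \<in> SYT la mu" for T
  proof -
    have "sorted_wrt (<) (map (\<lambda>j. T (0, a + j)) [0..<r])"
      unfolding sorted_wrt_iff_nth_less using arm_mono[OF T] by simp
    moreover have "set (map (\<lambda>j. T (0, a + j)) [0..<r]) = set (sorted_list_of_set ({1..r + k} - leg T))"
      using arm_image[OF T] by (simp add: lessThan_atLeast0)
    ultimately show ?thesis by (rule strict_sorted_equal[OF strict_sorted_list_of_set])
  qed
  have L: "T (i, 0) = T' (i, 0)" if "i \<in> {1..k}" for i
  proof -
    have "map (\<lambda>i. T (i, 0)) [1..<Suc k] = map (\<lambda>i. T' (i, 0)) [1..<Suc k]"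
      unfolding legs[OF T] legs[OF T'] eq ..
    then show ?thesis using that unfolding map_eq_conv by (simp del: upt_Suc)
  qed
  have A: "T (0, a + j) = T' (0, a + j)" if "j < r" for j
  proof -
    have "map (\<lambda>j. T (0, a + j)) [0..<r] = map (\<lambda>j. T' (0, a + j)) [0..<r]"
      unfolding arms[OF T] arms[OF T'] eq ..
    then show ?thesis using that unfolding map_eq_conv by auto
  qed
  show "T = T'"
  proof
    fix c
    show "T c = T' c"
    proof (cases "c \<in> hookcells a r k")
      case True
      then consider j where "c = (0, a + j)" "j < r" | i where "c = (i, 0)" "i \<in> {1..k}"
        unfolding hookcells_def by (auto simp: le_iff_add)
      then show ?thesis using L A by cases auto
    next
      case False
      then show ?thesis using T T' unfolding mem_SYT_iff by metis
    qed
  qed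
qed

text \<open>For \<open>a = 0\<close> the corner belongs to the arm and must hold the entry 1, whence
  the condition on \<open>S\<close>.\<close>

lemma leg_surj:
  assumes S: "S \<subseteq> {1..r + k}" "card S = k" "a = 0 \<longrightarrow> 1 \<notin> S"
  shows "\<exists>T\<in>SYT la mu. leg T = S"
proof -
  let ?c = "sorted_list_of_set ({1..r + k} - S)" and ?s = "sorted_list_of_set S"
  have fS: "finite S" using S(1) finite_subset by blast
  have cc: "card ({1..r + k} - S) = r" using S fS by (simp add: card_Diff_subset)
  define T where "T c = (if c \<in> hookcells a r k then if fst c = 0 then ?c ! (snd c - a) else ?s ! (fst c - 1) else 0)" for c
  have T0: "T (0, a + j) = ?c ! j" if "j < r" for j using that by (simp add: T_def hookcells_def)
  have T1: "T (i, 0) = ?s ! (i - 1)" if "1 \<le> i" "i \<le> k" for i using that by (simp add: T_def hookcells_def)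
  have legT: "leg T = S"
  proof -
    have "leg T = (\<lambda>i. ?s ! (i - 1)) ` {1..k}" unfolding leg_def using T1 by (intro image_cong) auto
    also have "\<dots> = (\<lambda>i. ?s ! i) ` {..<k}"
    proof -
      have "{..<k} = (\<lambda>i. i - 1) ` {1..k}"
      proof (intro equalityI subsetI)
        fix x assume "x \<in> {..<k}"
        then show "x \<in> (\<lambda>i. i - 1) ` {1..k}" by (intro image_eqI[of _ _ "Suc x"]) auto
      qed auto
      then show ?thesis by (simp add: image_image)
    qed
    also have "\<dots> = set ?s" using S(2) by (simp add: set_conv_nth lessThan_def setcompr_eq_image)
    finally show ?thesis using fS by simp
  qed
  have armT: "(\<lambda>j. T (0, a + j)) ` {..<r} = {1..r + k} - S"
  proof -
    have "(\<lambda>j. T (0, a + j)) ` {..<r} = (\<lambda>j. ?c ! j) ` {..<r}" using T0 by (intro image_cong) auto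
    also have "\<dots> = set ?c" using cc by (simp add: set_conv_nth lessThan_def setcompr_eq_image)
    finally show ?thesis by simp
  qed
  have img: "T ` hookcells a r k = {1..r + k}"
  proof -
    have "hookcells a r k = (\<lambda>j. (0, a + j)) ` {..<r} \<union> (\<lambda>i. (i, 0)) ` {1..k}"
    proof (intro equalityI subsetI)
      fix x assume "x \<in> hookcells a r k"
      then consider "fst x = 0" "a \<le> snd x" "snd x < a + r" | "fst x \<in> {1..k}" "snd x = 0"
        unfolding hookcells_def by auto
      then show "x \<in> (\<lambda>j. (0, a + j)) ` {..<r} \<union> (\<lambda>i. (i, 0)) ` {1..k}"
      proof cases
        case 1
        then show ?thesis by (intro UnI1 image_eqI[of _ _ "snd x - a"]) (auto simp: prod_eq_iff)
      next
        case 2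
        then show ?thesis by (intro UnI2 image_eqI[of _ _ "fst x"]) (auto simp: prod_eq_iff)
      qed
    qed (auto simp: hookcells_def)
    then have "T ` hookcells a r k = (\<lambda>j. T (0, a + j)) ` {..<r} \<union> leg T"
      by (simp add: image_Un image_image leg_def)
    then show ?thesis using armT legT S(1) by auto
  qed
  have finh: "finite (hookcells a r k)" by (simp add: hookcells_def)
  have "inj_on T (hookcells a r k)"
    by (rule eq_card_imp_inj_on[OF finh]) (simp add: img card_hookcells)
  then have bij: "bij_betw T (hookcells a r k) {1..r + k}" using img by (simp add: bij_betw_def)
  have "T \<in> SYT la mu"
    unfolding mem_SYT_iff
  proof (intro conjI allI impI)
    show "bij_betw T (hookcells a r k) {1..r + k}" by (rule bij)
    show "T c = 0" if "c \<notin> hookcells a r k" for c using that by (simp add: T_def)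
    show "T (0, a + j) < T (0, a + Suc j)" if "Suc j < r" for j
      using T0[of j] T0[of "Suc j"] that cc sorted_list_of_set_nth_less[of j "Suc j" "{1..r + k} - S"] by simp
    show "T (i, 0) < T (Suc i, 0)" if "1 \<le> i \<and> i < k" for i
      using T1[of i] T1[of "Suc i"] that S(2) fS sorted_list_of_set_nth_less[of "i - 1" i S] by simp
    show "T (0, 0) < T (1, 0)" if a0: "a = 0 \<and> 0 < k"
    proof -
      have "1 \<in> (\<lambda>j. T (0, a + j)) ` {..<r}" unfolding armT using S(3) a0 by simp
      then obtain j where j: "j < r" "T (0, a + j) = 1" by auto
      have "T (0, 0) \<le> T (0, a + j)"
        using T0[of 0] T0[of j] j(1) a0 cc sorted_list_of_set_nth_less[of 0 j "{1..r + k} - S"]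
        by (cases "j = 0") auto
      moreover have "T (1, 0) \<in> leg T" using a0 by (auto simp: leg_def)
      then have "T (1, 0) \<in> S" using legT by simp
      then have "T (1, 0) \<noteq> 1" "1 \<le> T (1, 0)" using S(1,3) a0 by auto
      ultimately show ?thesis using j(2) by simp
    qed
  qed
  then show ?thesis using legT by blast
qed

text \<open>If \<open>i + 1\<close> is in the leg, then \<open>i\<close> is in the arm or higher up
  in the leg.\<close>

lemma DesT_leg:
  assumes T: "T \<in> SYT la mu"
  shows "DesT la mu T = {i \<in> {1..<r + k}. Suc i \<in> leg T}"
proof -
  let ?p = "inv_into (hookcells a r k) T"
  have p: "?p i \<in> hookcells a r k" "T (?p i) = i" if "i \<in> {1..r + k}" for i
    using that SYT_image[OF T] by (auto intro: inv_into_into f_inv_into_f)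
  have pleg: "i \<in> leg T \<longleftrightarrow> 0 < fst (?p i)" if i: "i \<in> {1..r + k}" for i
  proof
    assume "i \<in> leg T"
    then obtain j where j: "j \<in> {1..k}" "i = T (j, 0)" by (auto simp: leg_def)
    then have "?p i = (j, 0)" using inv_into_f_f[OF SYT_inj[OF T], of "(j, 0)"] by (simp add: hookcells_def)
    then show "0 < fst (?p i)" using j by simp
  next
    assume "0 < fst (?p i)"
    then have "fst (?p i) \<in> {1..k}" "snd (?p i) = 0" using p(1)[OF i] by (auto simp: hookcells_def)
    then show "i \<in> leg T" using p(2)[OF i] unfolding leg_def by (metis image_eqI prod.collapse)
  qed
  have "fst (?p i) < fst (?p (Suc i)) \<longleftrightarrow> Suc i \<in> leg T" if i: "i \<in> {1..<r + k}" for i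
  proof
    assume "fst (?p i) < fst (?p (Suc i))"
    then show "Suc i \<in> leg T" using pleg[of "Suc i"] i by simp
  next
    assume s: "Suc i \<in> leg T"
    then have s0: "0 < fst (?p (Suc i))" using pleg[of "Suc i"] i by simp
    show "fst (?p i) < fst (?p (Suc i))"
    proof (rule ccontr)
      assume n: "\<not> fst (?p i) < fst (?p (Suc i))"
      have mem: "?p i \<in> hookcells a r k" "?p (Suc i) \<in> hookcells a r k" using p i by auto
      have z: "snd (?p i) = 0" "snd (?p (Suc i)) = 0" "fst (?p i) \<le> k" using n s0 mem by (auto simp: hookcells_def)
      then have "T (?p (Suc i)) \<le> T (?p i)"
        using leg_mono[OF T, of "fst (?p (Suc i))" "fst (?p i)"] n s0
        by (metis One_nat_def Suc_leI le_eq_less_or_eq linorder_not_less prod.collapse)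
      then show False using p(2)[of i] p(2)[of "Suc i"] i by simp
    qed
  qed
  then show ?thesis unfolding DesT_def row_of_def cells card_hookcells by auto
qed

text \<open>By \<open>DesT_leg\<close> the descent set determines the leg except for the entry 1,
  which may be in the leg only when the corner is missing. The two summands correspond to legs
  without and with 1.\<close>

lemma card_DesT_eq:
  assumes D: "D \<subseteq> {1..<r + k}"
  shows "card {T \<in> SYT la mu. DesT la mu T = D}
    = (if card D = k then 1 else 0) + (if a \<noteq> 0 \<and> Suc (card D) = k then 1 else 0)"
proof -
  let ?n = "r + k"
  let ?A = "{S. S \<subseteq> {1..?n} \<and> card S = k \<and> (a = 0 \<longrightarrow> 1 \<notin> S) \<and> {i \<in> {1..<?n}. Suc i \<in> S} = D}"
  have fD: "finite D" using D finite_subset by blast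
  have "leg ` {T \<in> SYT la mu. DesT la mu T = D} = ?A"
  proof
    show "leg ` {T \<in> SYT la mu. DesT la mu T = D} \<subseteq> ?A"
    proof
      fix S assume "S \<in> leg ` {T \<in> SYT la mu. DesT la mu T = D}"
      then obtain T where T: "T \<in> SYT la mu" "DesT la mu T = D" "S = leg T" by blast
      show "S \<in> ?A"
        using leg_subset[OF T(1)] card_leg[OF T(1)] leg_arm_zero[OF T(1)] DesT_leg[OF T(1)] T(2)
        unfolding T(3) by blast
    qed
    show "?A \<subseteq> leg ` {T \<in> SYT la mu. DesT la mu T = D}"
    proof
      fix S assume S: "S \<in> ?A"
      then obtain T where "T \<in> SYT la mu" "leg T = S" using leg_surj[of S] by blast
      then show "S \<in> leg ` {T \<in> SYT la mu. DesT la mu T = D}" using S DesT_leg[of T] by auto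
    qed
  qed
  moreover have "inj_on leg {T \<in> SYT la mu. DesT la mu T = D}"
    by (rule inj_on_subset[OF leg_inj]) blast
  ultimately have card_eq: "card {T \<in> SYT la mu. DesT la mu T = D} = card ?A"
    using card_image by fastforce
  have one: "1 \<notin> Suc ` D" using D by auto
  have cS: "card (Suc ` D) = card D" by (simp add: card_image)
  have Sform: "{i \<in> {1..<?n}. Suc i \<in> S} = D \<longleftrightarrow> S = Suc ` D \<or> S = insert 1 (Suc ` D)"
    if S: "S \<subseteq> {1..?n}" for S
  proof
    assume e: "{i \<in> {1..<?n}. Suc i \<in> S} = D"
    have "S - {1} = Suc ` D"
    proof (intro equalityI subsetI)
      fix x assume x: "x \<in> S - {1}"
      then have "x \<in> {1..?n}" "x \<noteq> 1" using S by auto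
      then have "x - 1 \<in> {1..<?n}" "x = Suc (x - 1)" by auto
      then show "x \<in> Suc ` D" using x e by (metis (mono_tags, lifting) DiffD1 image_eqI mem_Collect_eq)
    next
      fix x assume "x \<in> Suc ` D"
      then show "x \<in> S - {1}" using e by auto
    qed
    then show "S = Suc ` D \<or> S = insert 1 (Suc ` D)" by blast
  next
    assume "S = Suc ` D \<or> S = insert 1 (Suc ` D)"
    then show "{i \<in> {1..<?n}. Suc i \<in> S} = D" using D by auto
  qed
  have sub: "Suc ` D \<subseteq> {1..?n}" "insert 1 (Suc ` D) \<subseteq> {1..?n}" using D r by auto
  have ci: "card (insert 1 (Suc ` D)) = Suc (card D)" using one fD cS by simp
  have "?A = (if card D = k then {Suc ` D} else {}) \<union> (if a \<noteq> 0 \<and> Suc (card D) = k then {insert 1 (Suc ` D)} else {})"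
  proof (rule set_eqI)
    fix S
    have "S \<in> ?A \<longleftrightarrow> S = Suc ` D \<and> card D = k \<or> S = insert 1 (Suc ` D) \<and> a \<noteq> 0 \<and> Suc (card D) = k"
    proof
      assume S: "S \<in> ?A"
      then have "S = Suc ` D \<or> S = insert 1 (Suc ` D)" using Sform by blast
      then show "S = Suc ` D \<and> card D = k \<or> S = insert 1 (Suc ` D) \<and> a \<noteq> 0 \<and> Suc (card D) = k"
        using S cS ci by auto
    next
      assume "S = Suc ` D \<and> card D = k \<or> S = insert 1 (Suc ` D) \<and> a \<noteq> 0 \<and> Suc (card D) = k"
      then show "S \<in> ?A"
      proof
        assume s: "S = Suc ` D \<and> card D = k"
        then have "S \<subseteq> {1..?n}" "card S = k" "1 \<notin> S" using sub(1) cS one by auto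
        then show ?thesis using Sform[of S] s by blast
      next
        assume s: "S = insert 1 (Suc ` D) \<and> a \<noteq> 0 \<and> Suc (card D) = k"
        then have "S \<subseteq> {1..?n}" "card S = k" using sub(2) ci by auto
        then show ?thesis using Sform[of S] s by blast
      qed
    qed
    then show "S \<in> ?A \<longleftrightarrow> S \<in> (if card D = k then {Suc ` D} else {})
        \<union> (if a \<noteq> 0 \<and> Suc (card D) = k then {insert 1 (Suc ` D)} else {})"
      by auto
  qed
  then show ?thesis using card_eq by auto
qed

end

lemma hook_skew_cells:
  assumes "is_partition la" "la \<noteq> []" "(1, 1) \<notin> skew_cells la []"
  shows "hook_shape la [] 0 (la ! 0) (length la - 1)"
proof
  have pos: "0 < la ! i" if "i < length la" for i using assms(1) that by (simp add: is_partition_def)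
  have one: "la ! i = 1" if i: "1 \<le> i" "i < length la" for i
  proof -
    have "la ! 1 \<ge> la ! i"
      using assms(1) i by (cases "i = 1") (auto simp: is_partition_def sorted_wrt_iff_nth_less)
    moreover have "la ! 1 \<le> 1" using assms(3) i by (simp add: skew_cells_def)
    ultimately show ?thesis using pos[OF i(2)] by simp
  qed
  show "skew_cells la [] = hookcells 0 (la ! 0) (length la - 1)"
  proof (rule set_eqI)
    fix x :: "nat \<times> nat"
    obtain i j where x: "x = (i, j)" by fastforce
    show "x \<in> skew_cells la [] \<longleftrightarrow> x \<in> hookcells 0 (la ! 0) (length la - 1)"
    proof (cases "i = 0")
      case True
      then show ?thesis using assms(2) by (simp add: x skew_cells_def hookcells_def)
    next
      case False
      have "i < length la \<and> j < la ! i \<longleftrightarrow> i < length la \<and> j = 0" using one[of i] False by auto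
      then show ?thesis using False by (auto simp: x skew_cells_def hookcells_def)
    qed
  qed
  show "0 < la ! 0" using pos assms(2) by simp
qed simp

section \<open>Shapes formed by a disconnected row and column\<close>

text \<open>A hook with \<open>n + 1\<close> cells. Removing its corner by \<open>mu = [1]\<close>
  leaves a row of \<open>n - k\<close> cells and a column of \<open>k\<close> cells.\<close>

definition disc :: "nat \<Rightarrow> nat \<Rightarrow> nat list" where
  "disc n k = (n - k + 1) # replicate k 1"

lemma disc_hook_shape:
  assumes "k < n"
  shows "hook_shape (disc n k) [1] 1 (n - k) k"
proof
  show "skew_cells (disc n k) [1] = hookcells 1 (n - k) k"
  proof (rule set_eqI)
    fix x :: "nat \<times> nat"
    obtain i j where x: "x = (i, j)" by fastforce
    show "x \<in> skew_cells (disc n k) [1] \<longleftrightarrow> x \<in> hookcells 1 (n - k) k"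
    proof (cases i)
      case 0
      then show ?thesis by (auto simp: x skew_cells_def hookcells_def disc_def)
    next
      case (Suc m)
      then show ?thesis by (auto simp: x skew_cells_def hookcells_def disc_def)
    qed
  qed
  show "0 < n - k" using assms by simp
qed simp

lemma disc_skew_shape: "k < n \<Longrightarrow> is_skew_shape (disc n k) [1]"
  by (auto simp: is_skew_shape_def is_partition_def disc_def sorted_wrt_iff_nth_less nth_Cons'
      dest: in_set_replicate[THEN iffD1])

text \<open>With \<open>(0, 0)\<close> missing, every path starting in row 0 stays in row 0.\<close>

lemma disc_not_connected_ribbon:
  assumes "1 \<le> k" "k < n"
  shows "\<not> connected_ribbon (disc n k) [1]"
proof
  interpret hook_shape "disc n k" "[1]" 1 "n - k" k by (rule disc_hook_shape[OF assms(2)])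
  let ?C = "hookcells 1 (n - k) k"
  let ?R = "\<lambda>x y. x \<in> ?C \<and> y \<in> ?C \<and> cell_adj x y"
  assume "connected_ribbon (disc n k) [1]"
  moreover have "(0, 1) \<in> ?C" "(1, 0) \<in> ?C" using assms by (auto simp: hookcells_def)
  ultimately have path: "?R\<^sup>*\<^sup>* (0, 1) (1, 0)" unfolding connected_ribbon_def Let_def cells by blast
  have "fst y = 0" if "?R\<^sup>*\<^sup>* (0, 1) y" for y
    using that
  proof (induction rule: rtranclp_induct)
    case (step y z)
    then show ?case by (auto simp: hookcells_def cell_adj_def)
  qed simp
  from this[OF path] show False by simp
qed

lemma card_disc: "k < n \<Longrightarrow> card (skew_cells (disc n k) [1]) = n"
proof -
  assume k: "k < n"
  interpret hook_shape "disc n k" "[1]" 1 "n - k" k by (rule disc_hook_shape[OF k])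
  show ?thesis unfolding cells card_hookcells using k by simp
qed

text \<open>Adding \<open>n\<close> raises the size by one, so \<open>D\<close> and
  \<open>insert n D\<close> account for the two summands of \<open>card_DesT_eq\<close>.\<close>

lemma disc_realised:
  assumes "1 \<le> k" "k < n"
  shows "realised (disc n k) [1] n (\<lambda>J. if card J = k then 1 else 0)"
proof (rule realisedI)
  interpret hook_shape "disc n k" "[1]" 1 "n - k" k by (rule disc_hook_shape[OF assms(2)])
  show "card (skew_cells (disc n k) [1]) = n" by (rule card_disc[OF assms(2)])
  show "0 < n" using assms by simp
  show "(if card (cshift n J) = k then 1 else 0) = (if card J = k then 1 else (0::nat))"
    if "J \<subseteq> {1..n}" for J
  proof -
    have "card (cshift n J) = card J"
      unfolding cshift_eq_image_csucc by (rule card_image) (rule inj_on_subset[OF inj_on_csucc that])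
    then show ?thesis by simp
  qed
  show "(if card D = k then 1 else 0) + (if card (insert n D) = k then 1 else 0)
      = card {T \<in> SYT (disc n k) [1]. DesT (disc n k) [1] T = D}" if D: "D \<subseteq> {1..<n}" for D
  proof -
    have "n \<notin> D" "finite D" using D finite_subset by auto
    then have "card (insert n D) = Suc (card D)" by simp
    then show ?thesis using card_DesT_eq[of D] D assms by simp
  qed
qed (use assms in auto)

lemma nonhook_realised:
  assumes "is_partition la" "(1, 1) \<in> skew_cells la []" and n: "card (skew_cells la []) = n"
  shows "\<exists>g. realised la [] n g
    \<and> (\<forall>J\<subseteq>{1..n}. g (cshift n J) = g J)
    \<and> (\<forall>D\<subseteq>{1..<n}. g D + g (insert n D) = card {T \<in> SYT la []. DesT la [] T = D})
    \<and> (\<forall>k\<le>n. g {1..k} = 0)"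
proof -
  interpret partition_shape la by standard (rule assms(1))
  obtain g where g: "\<And>J. J \<subseteq> {1..n} \<Longrightarrow> g (cshift n J) = g J"
    "\<And>D. D \<subseteq> {1..<n} \<Longrightarrow> g D + g (insert n D) = card {T \<in> SYT la []. DesT la [] T = D}"
    "\<And>k. k \<le> n \<Longrightarrow> g {1..k} = (0::nat)"
    using cyclic_fiber_sizes[OF assms(2)] unfolding n by blast
  have "0 < n" using assms(2) finite_skew_cells n card_gt_0_iff by blast
  then have "realised la [] n g"
    using g(3)[of 0] g(3)[of n] by (intro realisedI[OF n _ g(1,2)]) simp_all
  then show ?thesis using g by blast
qed

lemma nonhook_not_connected_ribbon:
  assumes "is_partition la" "(1, 1) \<in> skew_cells la []"
  shows "\<not> connected_ribbon la []"
proof -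
  interpret partition_shape la by standard (rule assms(1))
  have "(0, 0) \<in> cells" "(0 + 1, 0) \<in> cells" "(0, 0 + 1) \<in> cells" "(0 + 1, 0 + 1) \<in> cells"
    using cells_down[OF assms(2)] assms(2) by auto
  then show ?thesis unfolding connected_ribbon_def Let_def by blast
qed

section \<open>Schur-positive rotation-invariant sets\<close>

lemma subset_sum_cancel:
  fixes f h :: "nat set \<Rightarrow> int"
  assumes "finite X" and eq: "\<And>D. D \<subseteq> X \<Longrightarrow> (\<Sum>E\<in>Pow D. f E) = (\<Sum>E\<in>Pow D. h E)"
    and D: "D \<subseteq> X"
  shows "f D = h D"
proof -
  have "finite D" using D assms(1) finite_subset by blast
  then show ?thesis using D
  proof (induction D rule: finite_psubset_induct)
    case (psubset D)
    have P: "Pow D = insert D (Pow D - {D})" by blast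
    have "(\<Sum>E\<in>Pow D - {D}. f E) = (\<Sum>E\<in>Pow D - {D}. h E)"
      using psubset by (intro sum.cong) auto
    moreover have "sum q (Pow D) = q D + sum q (Pow D - {D})" for q :: "nat set \<Rightarrow> int"
      using psubset(1) by (intro sum.remove) auto
    ultimately show ?case using eq[OF psubset.prems] by simp
  qed
qed

lemma card_fibers_Pow:
  assumes "finite A" "finite D"
  shows "int (card {x \<in> A. F x \<subseteq> D}) = (\<Sum>E\<in>Pow D. int (card {x \<in> A. F x = E}))"
proof -
  have "{x \<in> A. F x \<subseteq> D} = (\<Union>E\<in>Pow D. {x \<in> A. F x = E})" by auto
  also have "card \<dots> = (\<Sum>E\<in>Pow D. card {x \<in> A. F x = E})"
    using assms by (intro card_UN_disjoint) auto
  finally show ?thesis by simp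
qed

text \<open>At the monomial \<open>bcont n D\<close> both sides count objects with descent set
  contained in \<open>D\<close>; inclusion-exclusion then isolates each descent set. Shapes whose
  size is not \<open>n\<close> have coefficient 0 at these monomials and are left out of
  \<open>P\<close>.\<close>

lemma schur_positive_descents:
  assumes A: "finite A" "schur_positive n A"
  obtains P and c :: "nat list \<Rightarrow> nat" where "finite P"
    and "\<And>la. la \<in> P \<Longrightarrow> is_partition la \<and> card (skew_cells la []) = n"
    and "\<And>D. D \<subseteq> {1..<n} \<Longrightarrow> int (card {\<pi> \<in> A. Des n \<pi> = D})
      = (\<Sum>la\<in>P. int (c la) * int (card {T \<in> SYT la []. DesT la [] T = D}))"
proof -
  obtain Q and c :: "nat list \<Rightarrow> nat" where Q: "finite Q" "\<forall>la\<in>Q. is_partition la"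
    "(\<lambda>e. \<Sum>\<pi>\<in>A. Fund n (Des n \<pi>) e) = (\<lambda>e. \<Sum>la\<in>Q. int (c la) * schur la e)"
    using A(2) unfolding schur_positive_def Let_def schur_nonneg_def by blast
  define P where "P = {la \<in> Q. card (skew_cells la []) = n}"
  have finP: "finite P" using Q(1) by (simp add: P_def)
  have leq: "int (card {\<pi> \<in> A. Des n \<pi> \<subseteq> D})
      = (\<Sum>la\<in>P. int (c la) * int (card {T \<in> SYT la []. DesT la [] T \<subseteq> D}))" if D: "D \<subseteq> {1..<n}" for D
  proof -
    have fD: "finite D" using D finite_subset by blast
    have "(\<Sum>\<pi>\<in>A. Fund n (Des n \<pi>) (bcont n D)) = (\<Sum>\<pi>\<in>A. if Des n \<pi> \<subseteq> D then 1 else 0)"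
      using D by (intro sum.cong refl Fund_bcont) (auto simp: Des_def)
    also have "\<dots> = int (card {\<pi> \<in> A. Des n \<pi> \<subseteq> D})"
      using A(1) by (simp add: sum.If_cases Int_def)
    finally have 1: "int (card {\<pi> \<in> A. Des n \<pi> \<subseteq> D}) = (\<Sum>la\<in>Q. int (c la) * schur la (bcont n D))"
      using fun_cong[OF Q(3), of "bcont n D"] by simp
    have "(\<Sum>la\<in>Q. int (c la) * schur la (bcont n D)) = (\<Sum>la\<in>P. int (c la) * schur la (bcont n D))"
    proof (rule sum.mono_neutral_right[OF Q(1)])
      show "P \<subseteq> Q" by (auto simp: P_def)
      show "\<forall>la\<in>Q - P. int (c la) * schur la (bcont n D) = 0"
      proof
        fix la assume la: "la \<in> Q - P"
        interpret partition_shape la by standard (use Q(2) la in blast)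
        show "int (c la) * schur la (bcont n D) = 0"
          using schur_bcont_other[OF fD, of n] la by (simp add: P_def)
      qed
    qed
    also have "\<dots> = (\<Sum>la\<in>P. int (c la) * int (card {T \<in> SYT la []. DesT la [] T \<subseteq> D}))"
    proof (rule sum.cong[OF refl])
      fix la assume la: "la \<in> P"
      interpret partition_shape la by standard (use Q(2) la in \<open>auto simp: P_def\<close>)
      have "N = n" using la by (simp add: P_def)
      then show "int (c la) * schur la (bcont n D)
          = int (c la) * int (card {T \<in> SYT la []. DesT la [] T \<subseteq> D})"
        using schur_bcont[OF fD] by simp
    qed
    finally show ?thesis using 1 by simp
  qed
  show thesis
  proof (rule that[OF finP])
    show "is_partition la \<and> card (skew_cells la []) = n" if "la \<in> P" for la
      using that Q(2) by (auto simp: P_def)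
    show "int (card {\<pi> \<in> A. Des n \<pi> = D})
      = (\<Sum>la\<in>P. int (c la) * int (card {T \<in> SYT la []. DesT la [] T = D}))" if D: "D \<subseteq> {1..<n}" for D
    proof (rule subset_sum_cancel[OF _ _ D])
      show "finite {1..<n}" by simp
      fix D assume D: "D \<subseteq> {1..<n}"
      then have fD: "finite D" using finite_subset by blast
      have "(\<Sum>E\<in>Pow D. \<Sum>la\<in>P. int (c la) * int (card {T \<in> SYT la []. DesT la [] T = E}))
          = (\<Sum>la\<in>P. int (c la) * int (card {T \<in> SYT la []. DesT la [] T \<subseteq> D}))"
        unfolding card_fibers_Pow[OF finite_SYT fD] sum_distrib_left by (rule sum.swap)
      then show "(\<Sum>E\<in>Pow D. int (card {\<pi> \<in> A. Des n \<pi> = E}))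
          = (\<Sum>E\<in>Pow D. \<Sum>la\<in>P. int (c la) * int (card {T \<in> SYT la []. DesT la [] T = E}))"
        using leq[OF D] card_fibers_Pow[OF A(1) fD, of "Des n"] by simp
    qed
  qed
qed

section \<open>Consequences of rotation invariance\<close>

lemma cshift_preimage:
  assumes "J \<subseteq> {1..n}"
  obtains I where "I \<subseteq> {1..n}" "J = cshift n I"
  using assms subset_image_iff[of J "csucc n" "{1..n}"] image_csucc[of n]
  unfolding cshift_eq_image_csucc by metis

text \<open>By rotation, \<open>split\<close> also holds with any element of the set in place of \<open>n\<close>.\<close>

lemma rotation_invariant_card:
  fixes b :: "nat set \<Rightarrow> int"
  assumes rot: "\<And>J. J \<subseteq> {1..n} \<Longrightarrow> b (cshift n J) = b J"
    and zero: "b {} = 0"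
    and split: "\<And>D. D \<subseteq> {1..<n} \<Longrightarrow> b D + b (insert n D) = m (card D)"
    and J: "J \<subseteq> {1..n}"
  shows "b J = b {1..card J}"
proof -
  have step: "b (J - {v}) + b J = m (card (J - {v}))" if "v \<in> {1..n}" "v \<in> J" "J \<subseteq> {1..n}" for v J
  proof -
    have "\<forall>J. v \<in> J \<longrightarrow> J \<subseteq> {1..n} \<longrightarrow> b (J - {v}) + b J = m (card (J - {v}))"
    proof (rule cyclic_induct[where P = "\<lambda>v. \<forall>J. v \<in> J \<longrightarrow> J \<subseteq> {1..n} \<longrightarrow> b (J - {v}) + b J = m (card (J - {v}))", OF that(1)])
      show "\<forall>J. n \<in> J \<longrightarrow> J \<subseteq> {1..n} \<longrightarrow> b (J - {n}) + b J = m (card (J - {n}))"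
      proof (intro allI impI)
        fix J assume "n \<in> J" "J \<subseteq> {1..n}"
        then have "J - {n} \<subseteq> {1..<n}" "insert n (J - {n}) = J" by (auto simp: order_less_le)
        then show "b (J - {n}) + b J = m (card (J - {n}))" using split[of "J - {n}"] by simp
      qed
    next
      fix v assume v: "v \<in> {1..n}"
        and IH: "\<forall>J. v \<in> J \<longrightarrow> J \<subseteq> {1..n} \<longrightarrow> b (J - {v}) + b J = m (card (J - {v}))"
      show "\<forall>J. csucc n v \<in> J \<longrightarrow> J \<subseteq> {1..n} \<longrightarrow> b (J - {csucc n v}) + b J = m (card (J - {csucc n v}))"
      proof (intro allI impI)
        fix J assume J: "csucc n v \<in> J" "J \<subseteq> {1..n}"
        obtain I where I: "I \<subseteq> {1..n}" "J = cshift n I" using cshift_preimage[OF J(2)] .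
        have vI: "v \<in> I"
          using J(1) inj_on_image_mem_iff[OF inj_on_csucc v I(1)] unfolding I(2) cshift_eq_image_csucc by simp
        have Jv: "J - {csucc n v} = cshift n (I - {v})"
          unfolding I(2) cshift_eq_image_csucc
          using inj_on_image_set_diff[OF inj_on_csucc[of n], of I "{v}"] I(1) v by auto
        have Iv: "I - {v} \<subseteq> {1..n}" using I(1) by blast
        have "card (cshift n (I - {v})) = card (I - {v})"
          unfolding cshift_eq_image_csucc by (rule card_image) (rule inj_on_subset[OF inj_on_csucc Iv])
        then show "b (J - {csucc n v}) + b J = m (card (J - {csucc n v}))"
          unfolding Jv unfolding I(2) rot[OF I(1)] rot[OF Iv] using IH vI I(1) by simp
      qed
    qed
    then show ?thesis using that by blast
  qed
  have "\<forall>J. J \<subseteq> {1..n} \<longrightarrow> card J = k \<longrightarrow> b J = b {1..k}" for k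
  proof (induction k)
    case 0
    then show ?case using finite_subset[OF _ finite_atLeastAtMost[of 1 n]] by auto
  next
    case (Suc k)
    show ?case
    proof (intro allI impI)
      fix J assume J: "J \<subseteq> {1..n}" "card J = Suc k"
      then have fJ: "finite J" using finite_subset by blast
      have kn: "Suc k \<le> n" using card_mono[OF _ J(1)] J(2) by simp
      obtain v where v: "v \<in> J" using J(2) by fastforce
      have "b (J - {v}) + b J = m k" using step[of v J] v J fJ by auto
      moreover have "J - {v} \<subseteq> {1..n}" "card (J - {v}) = k" using J v fJ by auto
      then have "b (J - {v}) = b {1..k}" using Suc by blast
      moreover have "{1..Suc k} - {Suc k} = {1..k}" by auto
      then have "b {1..k} + b {1..Suc k} = m k" using step[of "Suc k" "{1..Suc k}"] kn by simp
      ultimately show "b J = b {1..Suc k}" by simp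
    qed
  qed
  then show ?thesis using J by blast
qed

section \<open>Cyclic descents of permutations\<close>

lemma cyc_eq_csucc: "i \<in> {1..n} \<Longrightarrow> cyc n i = csucc n i"
  by (cases "i = n") (auto simp: cyc_def csucc_self csucc_less)

lemma cDes_subset: "cDes n \<pi> \<subseteq> {1..n}"
  by (auto simp: cDes_def)

lemma mem_cDes_iff: "i \<in> cDes n \<pi> \<longleftrightarrow> i \<in> {1..n} \<and> \<pi> (csucc n i) < \<pi> i"
  by (cases "i = n") (auto simp: cDes_def csucc_self csucc_less)

lemma cDes_rotate: "cDes n \<pi> = cshift n (cDes n (\<pi> \<circ> cyc n))"
proof -
  have *: "csucc n i \<in> cDes n \<pi> \<longleftrightarrow> i \<in> cDes n (\<pi> \<circ> cyc n)" if "i \<in> {1..n}" for i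
  proof -
    have "csucc n i \<in> {1..n}" using that image_csucc[of n] by blast
    then show ?thesis using that by (simp add: mem_cDes_iff cyc_eq_csucc)
  qed
  obtain I where I: "I \<subseteq> {1..n}" "cDes n \<pi> = cshift n I" using cshift_preimage[OF cDes_subset] .
  have "i \<in> I \<longleftrightarrow> i \<in> cDes n (\<pi> \<circ> cyc n)" if i: "i \<in> {1..n}" for i
    using *[OF i] inj_on_image_mem_iff[OF inj_on_csucc i I(1)] I(2) by (simp add: cshift_eq_image_csucc)
  then have "I = cDes n (\<pi> \<circ> cyc n)" using I(1) cDes_subset[of n "\<pi> \<circ> cyc n"] by blast
  then show ?thesis using I(2) by simp
qed

text \<open>Right multiplication by the cycle permutes \<open>A\<close> and rotates cyclic descent
  sets one step backwards.\<close>

lemma card_cDes_cshift: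
  assumes n: "0 < n" and A: "A = (\<lambda>\<sigma>. \<sigma> \<circ> cyc n) ` A" and J: "J \<subseteq> {1..n}"
  shows "card {\<pi> \<in> A. cDes n \<pi> = cshift n J} = card {\<pi> \<in> A. cDes n \<pi> = J}"
proof -
  let ?r = "\<lambda>\<sigma> :: nat \<Rightarrow> nat. \<sigma> \<circ> cyc n"
  have surj: "\<exists>x. cyc n x = y" for y
  proof (cases "y \<in> {1..n}")
    case True
    then have "y \<in> csucc n ` {1..n}" unfolding image_csucc .
    then obtain x where "y = csucc n x" "x \<in> {1..n}" by (rule imageE)
    then show ?thesis using cyc_eq_csucc[of x n] by (intro exI[of _ x]) simp
  next
    case False
    then have "cyc n y = y" using n by (auto simp: cyc_def)
    then show ?thesis by blast
  qed
  have inj: "inj ?r"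
  proof (rule injI, rule ext)
    fix \<sigma> \<tau> :: "nat \<Rightarrow> nat" and y assume eq: "?r \<sigma> = ?r \<tau>"
    obtain x where "cyc n x = y" using surj by blast
    then show "\<sigma> y = \<tau> y" using fun_cong[OF eq, of x] by simp
  qed
  have iff: "cDes n \<pi> = cshift n J \<longleftrightarrow> cDes n (?r \<pi>) = J" for \<pi>
    using cDes_rotate[of n \<pi>] cshift_inj[OF cDes_subset J] by metis
  have "?r ` {\<pi> \<in> A. cDes n \<pi> = cshift n J} = {\<pi> \<in> A. cDes n \<pi> = J}"
  proof
    show "?r ` {\<pi> \<in> A. cDes n \<pi> = cshift n J} \<subseteq> {\<pi> \<in> A. cDes n \<pi> = J}"
      using A iff by blast
    show "{\<pi> \<in> A. cDes n \<pi> = J} \<subseteq> ?r ` {\<pi> \<in> A. cDes n \<pi> = cshift n J}"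
    proof
      fix \<sigma> assume \<sigma>: "\<sigma> \<in> {\<pi> \<in> A. cDes n \<pi> = J}"
      then obtain \<pi> where "\<pi> \<in> A" "\<sigma> = ?r \<pi>" using A by blast
      then show "\<sigma> \<in> ?r ` {\<pi> \<in> A. cDes n \<pi> = cshift n J}" using iff[of \<pi>] \<sigma> by blast
    qed
  qed
  then show ?thesis
    using card_image[OF inj_on_subset[OF inj subset_UNIV], of "{\<pi> \<in> A. cDes n \<pi> = cshift n J}"] by simp
qed

text \<open>Otherwise the values would be weakly monotone all the way around the cycle, forcing
  \<open>\<pi> 1 = \<pi> n\<close>.\<close>

lemma cDes_proper:
  assumes "2 \<le> n" "\<pi> permutes {1..n}"
  shows "cDes n \<pi> \<noteq> {}" "cDes n \<pi> \<noteq> {1..n}"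
proof -
  have ne: "\<pi> 1 \<noteq> \<pi> n" using inj_eq[OF permutes_inj[OF assms(2)], of 1 n] assms(1) by simp
  show "cDes n \<pi> \<noteq> {}"
  proof
    assume e: "cDes n \<pi> = {}"
    have le: "\<pi> i \<le> \<pi> (csucc n i)" if "i \<in> {1..n}" for i using mem_cDes_iff[of i n \<pi>] e that by auto
    have "1 \<le> i \<Longrightarrow> i \<le> n \<Longrightarrow> \<pi> 1 \<le> \<pi> i" for i
    proof (induction i rule: nat_induct_at_least)
      case (Suc i)
      then show ?case using le[of i] by (simp add: csucc_less)
    qed simp
    then have "\<pi> 1 \<le> \<pi> n" using assms(1) by simp
    moreover have "\<pi> n \<le> \<pi> 1" using le[of n] assms(1) by (simp add: csucc_self)
    ultimately show False using ne by simp
  qed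
  show "cDes n \<pi> \<noteq> {1..n}"
  proof
    assume e: "cDes n \<pi> = {1..n}"
    have le: "\<pi> (csucc n i) \<le> \<pi> i" if "i \<in> {1..n}" for i using mem_cDes_iff[of i n \<pi>] e that by auto
    have "1 \<le> i \<Longrightarrow> i \<le> n \<Longrightarrow> \<pi> i \<le> \<pi> 1" for i
    proof (induction i rule: nat_induct_at_least)
      case (Suc i)
      then show ?case using le[of i] by (simp add: csucc_less)
    qed simp
    then have "\<pi> n \<le> \<pi> 1" using assms(1) by simp
    moreover have "\<pi> 1 \<le> \<pi> n" using le[of n] assms(1) by (simp add: csucc_self)
    ultimately show False using ne by simp
  qed
qed

section \<open>Choice of shapes and multiplicities\<close>

theorem theorem3p10:
  fixes n :: nat and A :: "(nat \<Rightarrow> nat) set"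
  assumes "n \<ge> 2"
    and "\<forall>\<pi>\<in>A. \<pi> permutes {1..n}"
    and "schur_positive n A"
    and "A = (\<lambda>\<sigma>. \<sigma> \<circ> cyc n) ` A"
  shows "cyclic_schur_positive n A"
proof -
  have finA: "finite A"
    by (rule finite_subset[OF _ finite_permutations[of "{1..n}"]]) (use assms(2) in auto)
  define a where "a J = card {\<pi> \<in> A. cDes n \<pi> = J}" for J
  have a_rot: "a (cshift n J) = a J" if "J \<subseteq> {1..n}" for J
    unfolding a_def using assms(1) by (intro card_cDes_cshift[OF _ assms(4) that]) simp
  have a_ends: "a {} = 0" "a {1..n} = 0"
  proof -
    have "{\<pi> \<in> A. cDes n \<pi> = {}} = {}" "{\<pi> \<in> A. cDes n \<pi> = {1..n}} = {}"
      using cDes_proper[OF assms(1)] assms(2) by blast+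
    then show "a {} = 0" "a {1..n} = 0" unfolding a_def by (simp_all only: card.empty)
  qed
  have a_split: "a D + a (insert n D) = card {\<pi> \<in> A. Des n \<pi> = D}" if D: "D \<subseteq> {1..<n}" for D
  proof -
    have nD: "n \<notin> D" using D by auto
    have cD: "cDes n \<pi> = Des n \<pi> \<or> cDes n \<pi> = insert n (Des n \<pi>)" for \<pi>
      using assms(1) by (auto simp: cDes_def Des_def)
    have Dn: "n \<notin> Des n \<pi>" for \<pi> by (simp add: Des_def)
    have "Des n \<pi> = D \<longleftrightarrow> cDes n \<pi> = D \<or> cDes n \<pi> = insert n D" for \<pi>
      using cD[of \<pi>] Dn[of \<pi>] nD by (metis insertI1 insert_ident)
    then have "{\<pi> \<in> A. Des n \<pi> = D} = {\<pi> \<in> A. cDes n \<pi> = D} \<union> {\<pi> \<in> A. cDes n \<pi> = insert n D}" by blast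
    also have "card \<dots> = a D + a (insert n D)"
      unfolding a_def using finA nD by (intro card_Un_disjoint) auto
    finally show ?thesis by simp
  qed
  obtain P and c :: "nat list \<Rightarrow> nat" where finP: "finite P"
    and P: "\<And>la. la \<in> P \<Longrightarrow> is_partition la \<and> card (skew_cells la []) = n"
    and expand: "\<And>D. D \<subseteq> {1..<n} \<Longrightarrow> int (card {\<pi> \<in> A. Des n \<pi> = D})
      = (\<Sum>la\<in>P. int (c la) * int (card {T \<in> SYT la []. DesT la [] T = D}))"
    using schur_positive_descents[OF finA assms(3)] by blast
  define NH where "NH = {la \<in> P. (1, 1) \<in> skew_cells la []}"
  define HK where "HK = {la \<in> P. (1, 1) \<notin> skew_cells la []}"
  have fin: "finite NH" "finite HK" and PU: "P = NH \<union> HK" and disj: "NH \<inter> HK = {}"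
    using finP by (auto simp: NH_def HK_def)
  have "\<forall>la. \<exists>g. la \<in> NH \<longrightarrow> realised la [] n g
    \<and> (\<forall>J\<subseteq>{1..n}. g (cshift n J) = g J)
    \<and> (\<forall>D\<subseteq>{1..<n}. g D + g (insert n D) = card {T \<in> SYT la []. DesT la [] T = D})
    \<and> (\<forall>k\<le>n. g {1..k} = (0::nat))"
    using nonhook_realised P by (simp add: NH_def)
  from choice[OF this] obtain g where g: "\<forall>la. la \<in> NH \<longrightarrow> realised la [] n (g la)
    \<and> (\<forall>J\<subseteq>{1..n}. g la (cshift n J) = g la J)
    \<and> (\<forall>D\<subseteq>{1..<n}. g la D + g la (insert n D) = card {T \<in> SYT la []. DesT la [] T = D})
    \<and> (\<forall>k\<le>n. g la {1..k} = (0::nat))" by (elim exE)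
  \<comment> \<open>Integer-valued, because nonnegativity is only known after
    \<open>b_card\<close>.\<close>
  define b where "b J = int (a J) - (\<Sum>la\<in>NH. int (c la) * int (g la J))" for J
  \<comment> \<open>The total multiplicity of the hooks whose leg has \<open>j\<close> cells. As
    these count descent sets by size alone, \<open>rotation_invariant_card\<close> becomes
    applicable to \<open>b\<close>.\<close>
  define m where "m j = (\<Sum>la\<in>HK. int (c la) * (if j = length la - 1 then 1 else 0))" for j
  have b_rot: "b (cshift n J) = b J" if "J \<subseteq> {1..n}" for J
    using g a_rot[OF that] that by (simp add: b_def)
  have g0: "g la {1..k} = 0" if "la \<in> NH" "k \<le> n" for la k using g that by blast
  have b_interval: "b {1..k} = int (a {1..k})" if "k \<le> n" for k
    using g0 that by (simp add: b_def)
  have b_split: "b D + b (insert n D) = m (card D)" if D: "D \<subseteq> {1..<n}" for D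
  proof -
    have hook: "card {T \<in> SYT la []. DesT la [] T = D} = (if card D = length la - 1 then 1 else 0)"
      if la: "la \<in> HK" for la
    proof -
      have "la \<noteq> []" using P[of la] la assms(1) by (auto simp: HK_def skew_cells_def)
      then interpret hook_shape la "[]" 0 "la ! 0" "length la - 1"
        using P[of la] la by (intro hook_skew_cells) (auto simp: HK_def)
      have "la ! 0 + (length la - 1) = n" using P[of la] la cells card_hookcells by (simp add: HK_def)
      then show ?thesis using card_DesT_eq[of D] D by simp
    qed
    have "int (a D) + int (a (insert n D))
        = (\<Sum>la\<in>NH. int (c la) * int (card {T \<in> SYT la []. DesT la [] T = D}))
        + (\<Sum>la\<in>HK. int (c la) * int (card {T \<in> SYT la []. DesT la [] T = D}))"
      using a_split[OF D] expand[OF D] unfolding PU by (simp add: sum.union_disjoint[OF fin disj] flip: of_nat_add)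
    also have "(\<Sum>la\<in>HK. int (c la) * int (card {T \<in> SYT la []. DesT la [] T = D})) = m (card D)"
      unfolding m_def using hook by (intro sum.cong refl) simp
    also have "(\<Sum>la\<in>NH. int (c la) * int (card {T \<in> SYT la []. DesT la [] T = D}))
        = (\<Sum>la\<in>NH. int (c la) * int (g la D)) + (\<Sum>la\<in>NH. int (c la) * int (g la (insert n D)))"
    proof -
      have "int (c la) * int (card {T \<in> SYT la []. DesT la [] T = D})
          = int (c la) * int (g la D) + int (c la) * int (g la (insert n D))" if "la \<in> NH" for la
      proof -
        have "card {T \<in> SYT la []. DesT la [] T = D} = g la D + g la (insert n D)" using g that D by simp
        then show ?thesis by (simp add: distrib_left)
      qed
      then show ?thesis by (simp add: sum.distrib)
    qed
    finally show ?thesis by (simp add: b_def)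
  qed
  have b_zero: "b {} = 0" using b_interval[of 0] a_ends by simp
  have b_card: "b J = int (a {1..card J})" if J: "J \<subseteq> {1..n}" for J
  proof -
    have "card J \<le> n" using card_mono[OF _ J] by simp
    then show ?thesis
      using rotation_invariant_card[OF b_rot b_zero b_split J] b_interval[of "card J"] by simp
  qed
  define S where "S = (\<lambda>la. (la, [])) ` NH \<union> (\<lambda>k. (disc n k, [1::nat])) ` {1..<n}"
  \<comment> \<open>The shape \<open>disc n k\<close> is recognised by its nonempty inner partition
    and has \<open>k + 1\<close> rows, so its multiplicity is the number of permutations in
    \<open>A\<close> with cyclic descent set \<open>{1..k}\<close>.\<close>
  define M where "M = (\<lambda>(la, mu :: nat list). if mu = [] then c la else a {1..length la - 1})"
  define G where "G = (\<lambda>(la, mu :: nat list) J. if mu = [] then g la J else if card J = length la - 1 then 1 else 0)"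
  have len: "length (disc n k) = Suc k" for k by (simp add: disc_def)
  have "\<forall>s. \<exists>p. s \<in> S \<longrightarrow> cyclic_descent_ext (fst s) (snd s) (fst p) (snd p)
      \<and> (\<forall>J. card {T \<in> SYT (fst s) (snd s). fst p T = J} = (if J \<subseteq> {1..n} then G s J else 0))"
  proof
    fix s
    have "realised (fst s) (snd s) n (G s)" if "s \<in> S"
      using that unfolding S_def
    proof
      assume "s \<in> (\<lambda>la. (la, [])) ` NH"
      then obtain la where la: "la \<in> NH" "s = (la, [])" by blast
      have "G (la, []) = g la" by (rule ext) (simp add: G_def)
      then show ?thesis using g la by simp
    next
      assume "s \<in> (\<lambda>k. (disc n k, [1::nat])) ` {1..<n}"
      then obtain k where k: "k \<in> {1..<n}" "s = (disc n k, [1::nat])" by blast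
      have "G (disc n k, [1]) = (\<lambda>J. if card J = k then 1 else 0)" by (rule ext) (simp add: G_def len)
      then show ?thesis using disc_realised[of k n] k by simp
    qed
    then have "s \<in> S \<Longrightarrow> \<exists>p. cyclic_descent_ext (fst s) (snd s) (fst p) (snd p)
      \<and> (\<forall>J. card {T \<in> SYT (fst s) (snd s). fst p T = J} = (if J \<subseteq> {1..n} then G s J else 0))"
      unfolding realised_def split_paired_Ex fst_conv snd_conv .
    then show "\<exists>p. s \<in> S \<longrightarrow> cyclic_descent_ext (fst s) (snd s) (fst p) (snd p)
      \<and> (\<forall>J. card {T \<in> SYT (fst s) (snd s). fst p T = J} = (if J \<subseteq> {1..n} then G s J else 0))"
      unfolding ex_simps by (rule impI)
  qed
  from choice[OF this] obtain X where X: "\<And>s. s \<in> S \<Longrightarrow> cyclic_descent_ext (fst s) (snd s) (fst (X s)) (snd (X s))"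
    "\<And>s J. s \<in> S \<Longrightarrow> card {T \<in> SYT (fst s) (snd s). fst (X s) T = J} = (if J \<subseteq> {1..n} then G s J else 0)"
    by blast
  have finS: "finite S" using fin by (simp add: S_def)
  have shapes: "is_skew_shape la mu \<and> card (skew_cells la mu) = n \<and> \<not> connected_ribbon la mu"
    if s: "(la, mu) \<in> S" for la mu
  proof -
    consider "la \<in> NH" "mu = []" | k where "k \<in> {1..<n}" "la = disc n k" "mu = [1]"
      using s by (auto simp: S_def)
    then show ?thesis
    proof cases
      case 1
      then have "is_partition la" "card (skew_cells la []) = n" "(1, 1) \<in> skew_cells la []"
        using P by (auto simp: NH_def)
      then show ?thesis
        using 1 nonhook_not_connected_ribbon[of la] by (simp add: is_skew_shape_def is_partition_def)
    next
      case 2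
      then show ?thesis
        using disc_skew_shape card_disc disc_not_connected_ribbon by simp
    qed
  qed
  have count: "card {\<pi> \<in> A. cDes n \<pi> = J}
      = (\<Sum>(la, mu)\<in>S. M (la, mu) * card {T \<in> SYT la mu. fst (X (la, mu)) T = J})" for J
  proof -
    have "(\<Sum>(la, mu)\<in>S. M (la, mu) * card {T \<in> SYT la mu. fst (X (la, mu)) T = J})
        = (\<Sum>s\<in>S. M s * (if J \<subseteq> {1..n} then G s J else 0))"
    proof (rule sum.cong[OF refl])
      fix s assume "s \<in> S"
      then show "(case s of (la, mu) \<Rightarrow> M (la, mu) * card {T \<in> SYT la mu. fst (X (la, mu)) T = J})
          = M s * (if J \<subseteq> {1..n} then G s J else 0)"
        using X(2)[of s J] by (cases s) simp
    qed
    also have "\<dots> = a J"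
    proof (cases "J \<subseteq> {1..n}")
      case False
      then have "{\<pi> \<in> A. cDes n \<pi> = J} = {}" using cDes_subset by blast
      then have "a J = 0" unfolding a_def by (simp only: card.empty)
      then show ?thesis using False by simp
    next
      case True
      have inj1: "inj_on (\<lambda>la. (la, [] :: nat list)) NH" by (simp add: inj_on_def)
      have inj2: "inj_on (\<lambda>k. (disc n k, [1::nat])) {1..<n}"
        by (rule inj_onI) (metis Pair_inject len nat.inject)
      have "(\<Sum>s\<in>S. M s * G s J) = (\<Sum>s\<in>(\<lambda>la. (la, [])) ` NH. M s * G s J)
          + (\<Sum>s\<in>(\<lambda>k. (disc n k, [1::nat])) ` {1..<n}. M s * G s J)"
        unfolding S_def using fin(1) by (intro sum.union_disjoint) auto
      also have "(\<Sum>s\<in>(\<lambda>la. (la, [])) ` NH. M s * G s J) = (\<Sum>la\<in>NH. c la * g la J)"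
        unfolding sum.reindex[OF inj1] by (simp add: M_def G_def)
      also have "(\<Sum>s\<in>(\<lambda>k. (disc n k, [1::nat])) ` {1..<n}. M s * G s J)
          = (\<Sum>k\<in>{1..<n}. a {1..k} * (if card J = k then 1 else 0))"
        unfolding sum.reindex[OF inj2] by (simp add: M_def G_def len)
      also have "\<dots> = a {1..card J}"
      proof (cases "card J \<in> {1..<n}")
        case True
        then show ?thesis by (simp add: if_distrib sum.delta' cong: if_cong)
      next
        case False
        \<comment> \<open>No disconnected shape is available for the sizes 0 and \<open>n\<close>,
          but \<open>a\<close> vanishes there because cyclic descent sets are nonempty and
          proper.\<close>
        have "card J \<le> n" using card_mono[OF _ \<open>J \<subseteq> {1..n}\<close>] by simp
        then have "card J = 0 \<or> card J = n" using False by auto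
        then have "a {1..card J} = 0" using a_ends by auto
        moreover have "(\<Sum>k\<in>{1..<n}. a {1..k} * (if card J = k then 1 else 0)) = 0"
          using False by (intro sum.neutral) auto
        ultimately show ?thesis by simp
      qed
      finally have "int (\<Sum>s\<in>S. M s * G s J) = int (a J)"
        using b_card[OF True] by (simp add: b_def)
      then have "(\<Sum>s\<in>S. M s * G s J) = a J" by (simp only: of_nat_eq_iff)
      then show ?thesis using True by simp
    qed
    finally show ?thesis by (simp add: a_def)
  qed
  show ?thesis
    unfolding cyclic_schur_positive_def
  proof (intro exI conjI)
    show "finite S" by (rule finS)
    show "\<forall>(la, mu)\<in>S. is_skew_shape la mu \<and> card (skew_cells la mu) = n
              \<and> \<not> connected_ribbon la mu \<and> cyclic_descent_ext la mu ((fst \<circ> X) (la, mu)) ((snd \<circ> X) (la, mu))"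
      using shapes X(1) by fastforce
    show "\<forall>J. card {\<pi> \<in> A. cDes n \<pi> = J}
               = (\<Sum>(la, mu)\<in>S. M (la, mu) * card {T \<in> SYT la mu. (fst \<circ> X) (la, mu) T = J})"
      using count by simp
  qed
qed

end
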